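(* Let $d\ge2$ and assume that $M\sim\mathbb{Q}$ has a regularly varying tail with exponent $\alpha>d$ and that $M>0$ $\mathbb{P}$-a.s. Define the point processes $$\Xi_\rho:=\sum_{\mathbf{x}=(x,m)\in\eta\cap(W_\rho\times(0,\infty))}\delta_{\left(\frac1\rho x,\,\frac{1}{q_{\alpha,\rho}}m,\,\frac{1}{q_{\alpha,\rho}}r(\mathbf{x},\eta)\right)}$$ for $\rho\ge1$. Let $\Psi_\alpha$ be a Poisson process on $W\times(0,\infty]^2$ with intensity measure $\mathbb{M}_\alpha=\lambda_d|_W\otimes\mathbb{K}_\alpha$, where $\mathbb{K}_\alpha$ is the measure on $(0,\infty]^2$ with $\mathbb{K}_\alpha(\{(x,x):a<x\le b\})=a^{-\alpha}-b^{-\alpha}$ for all $0<a<b$ and $\mathbb{K}_\alpha(\{(x,x):x\in(0,\infty)\}^c)=0$. Then $$\Xi_\rho\overset{d}{\longrightarrow}\Psi_\alpha\quad\text{as }\rho\to\infty\text{ in the space }\mathcal{M}_p(W\times(0,\infty]^2).$$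
   Context: Fix $\gamma>0$ and a compact convex set $W\subseteq\mathbb{R}^d$ of volume one; $W_\rho:=\rho W$ for $\rho\ge1$. $\lambda_d$ is Lebesgue measure on $\mathbb{R}^d$, $\lambda_d|_W$ its restriction to $W$, $B^d(x,r)$ the closed ball with center $x$ and radius $r$, $\delta_y$ the Dirac measure at $y$. $\mathbb{Q}$ is a probability measure on $[0,\infty)$ (mark distribution) and $\eta$ is a Poisson process on $\mathbb{R}^d\times[0,\infty)$ with intensity measure $\gamma\lambda_d\otimes\mathbb{Q}$. Counting measures are also treated as sets of points. $M\sim\mathbb{Q}$ has a regularly varying tail with exponent $\alpha>0$ if $\mathbb{Q}((u,\infty))=l(u)u^{-\alpha}$ for all $u>0$, where $l:(0,\infty)\to[0,\infty)$ is slowly varying at $\infty$, i.e. $\lim_{v\to\infty}l(tv)/l(v)=1$ for any $t>0$. For $\rho\ge1$, $q_{\alpha,\rho}:=\gamma^{1/\alpha}q(\rho)$, where $q(\rho)$ is the $(1-\rho^{-d})$-quantile of $\mathbb{Q}$, i.e. $q(\rho)=\inf\{x\ge0:\mathbb{Q}([0,x])\ge1-\rho^{-d}\}$ (only $\rho>1$, where $q(\rho)>0$, is relevant). For a collection $\varphi$ of points of $\mathbb{R}^d\times[0,\infty)$ and $\mathbf{x}=(x,s)\in\varphi$, the Laguerre cell is $L(\mathbf{x},\varphi):=\{z\in\mathbb{R}^d:\|z-x\|^2-s^2\le\|z-y\|^2-t^2\text{ for all }(y,t)\in\varphi\}$, and the inradius is $r(\mathbf{x},\varphi):=\sup\{r\ge0:B^d(x,r)\subseteq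 L(\mathbf{x},\varphi)\}$ if $x\in L(\mathbf{x},\varphi)$ and $r(\mathbf{x},\varphi):=0$ otherwise. $W\times(0,\infty]^2$ carries the product metric, with the Euclidean metric on $W$ and on $(0,\infty]$ the metric induced by $x\mapsto1/x$ (with $1/\infty=0$), so that sets $W\times[b,\infty]^2$, $b>0$, are compact. $\Xi_\rho$ is regarded as a point process on this space, so points $\mathbf{x}$ with $r(\mathbf{x},\eta)=0$ do not contribute. For a complete separable locally compact metric space $\mathcal{E}$, $\mathcal{M}_p(\mathcal{E})$ is the space of locally finite counting measures on $\mathcal{E}$ with the topology of vague convergence (the smallest topology making $\nu\mapsto\int f\,d\nu$ continuous for all continuous bounded $f:\mathcal{E}\to[0,\infty)$ with compact support); $\overset{d}{\longrightarrow}$ is convergence in distribution with respect to this topology. *)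

theory Defs
  imports "HOL-Probability.Probability"
begin

section \<open>Random elements of topological spaces and convergence in distribution\<close>

definition borel_of :: "'x topology \<Rightarrow> 'x measure" where
  "borel_of T = sigma (topspace T) {U. openin T U}"

text \<open>A random element is only required to be defined up to null sets: \<open>X\<close> may leave
  \<open>topspace T\<close> on a null set. Its law is that of an arbitrary version; see \<open>law_eq\<close> below.\<close>

definition is_version :: "'w measure \<Rightarrow> 'x topology \<Rightarrow> ('w \<Rightarrow> 'x) \<Rightarrow> ('w \<Rightarrow> 'x) \<Rightarrow> bool" where
  "is_version P T X Y \<longleftrightarrow> Y \<in> P \<rightarrow>\<^sub>M borel_of T \<and> (AE \<omega> in P. X \<omega> = Y \<omega>)"

definition random_element :: "'w measure \<Rightarrow> 'x topology \<Rightarrow> ('w \<Rightarrow> 'x) \<Rightarrow> bool" where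
  "random_element P T X \<longleftrightarrow> (\<exists>Y. is_version P T X Y)"

definition law :: "'w measure \<Rightarrow> 'x topology \<Rightarrow> ('w \<Rightarrow> 'x) \<Rightarrow> 'x measure" where
  "law P T X = distr P (borel_of T) (SOME Y. is_version P T X Y)"

lemma law_eq:
  assumes "is_version P T X Y"
  shows "law P T X = distr P (borel_of T) Y"
proof -
  let ?Z = "SOME Y. is_version P T X Y"
  have Z: "is_version P T X ?Z" using assms by (rule someI[of "is_version P T X"])
  have "AE \<omega> in P. ?Z \<omega> = Y \<omega>"
    using Z assms unfolding is_version_def by (auto elim: AE_mp)
  then show ?thesis
    using Z assms unfolding law_def is_version_def by (intro distr_cong_AE) auto
qed

definition converges_in_distribution ::
  "'x topology \<Rightarrow> 'w measure \<Rightarrow> ('i \<Rightarrow> 'w \<Rightarrow> 'x) \<Rightarrow> 'i filter \<Rightarrow> 'v measure \<Rightarrow> ('v \<Rightarrow> 'x) \<Rightarrow> bool" where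
  "converges_in_distribution T P X F P' Y \<longleftrightarrow>
     (\<forall>\<^sub>F i in F. random_element P T (X i)) \<and> random_element P' T Y \<and>
     (\<forall>f. continuous_map T euclideanreal f \<and> bounded (f ` topspace T) \<longrightarrow>
        ((\<lambda>i. \<integral>\<nu>. f \<nu> \<partial>law P T (X i)) \<longlongrightarrow> (\<integral>\<nu>. f \<nu> \<partial>law P' T Y)) F)"

section \<open>Counting measures, the vague topology and Poisson processes\<close>

text \<open>All state spaces used below are locally compact, separable and completely metrizable;
  there local finiteness means finiteness on compact sets.\<close>

definition locally_finite_counting_measures :: "'e topology \<Rightarrow> 'e measure set" where
  "locally_finite_counting_measures E =
     {\<nu>. space \<nu> = topspace E \<and> sets \<nu> = sets (borel_of E) \<and>
         (\<forall>A\<in>sets \<nu>. emeasure \<nu> A \<in> insert \<infinity> (range of_nat)) \<and>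
         (\<forall>K. compactin E K \<longrightarrow> emeasure \<nu> K < \<infinity>)}"

definition vague_test_functions :: "'e topology \<Rightarrow> ('e \<Rightarrow> real) set" where
  "vague_test_functions E =
     {f. continuous_map E euclideanreal f \<and> (\<forall>x\<in>topspace E. 0 \<le> f x) \<and>
         bounded (f ` topspace E) \<and>
         (\<exists>K. compactin E K \<and> (\<forall>x\<in>topspace E - K. f x = 0))}"

definition vague_topology :: "'e topology \<Rightarrow> 'e measure topology" where
  "vague_topology E = topology_generated_by
     {{\<nu> \<in> locally_finite_counting_measures E. (\<integral>x. f x \<partial>\<nu>) \<in> U} | f U.
        f \<in> vague_test_functions E \<and> open U}"

lemma topspace_vague_topology: "topspace (vague_topology E) = locally_finite_counting_measures E"
proof -
  have "(\<lambda>_. 0) \<in> vague_test_functions E"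
    by (auto simp: vague_test_functions_def bounded_iff intro: exI[of _ "{}"])
  then show ?thesis
    unfolding vague_topology_def topology_generated_by_topspace by blast
qed

text \<open>The Poisson law with parameter \<open>\<infinity>\<close> is the point mass at \<open>\<infinity>\<close>.
  (The library's \<open>poisson_pmf\<close> excludes the parameter 0.)\<close>

definition poisson_process ::
  "'w measure \<Rightarrow> 'e topology \<Rightarrow> 'e measure \<Rightarrow> ('w \<Rightarrow> 'e measure) \<Rightarrow> bool" where
  "poisson_process P E \<mu> X \<longleftrightarrow>
     prob_space P \<and> X \<in> P \<rightarrow>\<^sub>M borel_of (vague_topology E) \<and>
     (\<forall>A\<in>sets (borel_of E).
        (if emeasure \<mu> A = \<infinity> then AE \<omega> in P. emeasure (X \<omega>) A = \<infinity>
         else \<forall>k::nat. measure P {\<omega>\<in>space P. emeasure (X \<omega>) A = of_nat k} =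
                measure \<mu> A ^ k / fact k * exp (- measure \<mu> A))) \<and>
     (\<forall>(I::nat set) A. finite I \<and> disjoint_family_on A I \<and> A ` I \<subseteq> sets (borel_of E) \<longrightarrow>
        prob_space.indep_vars P (\<lambda>_. borel) (\<lambda>i \<omega>. emeasure (X \<omega>) (A i)) I)"

section \<open>The mark distribution\<close>

definition slowly_varying :: "(real \<Rightarrow> real) \<Rightarrow> bool" where
  "slowly_varying l \<longleftrightarrow> (\<forall>t>0. ((\<lambda>v. l (t * v) / l v) \<longlongrightarrow> 1) at_top)"

definition regularly_varying_tail :: "real measure \<Rightarrow> real \<Rightarrow> bool" where
  "regularly_varying_tail Q \<alpha> \<longleftrightarrow>
     (\<exists>l. (\<forall>u>0. 0 \<le> l u) \<and> slowly_varying l \<and>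
          (\<forall>u>0. measure Q {u<..} = l u * u powr (- \<alpha>)))"

definition quantile :: "real measure \<Rightarrow> real \<Rightarrow> real" where
  "quantile Q p = Inf {x. 0 \<le> x \<and> p \<le> measure Q {0..x}}"

definition q_scale :: "real \<Rightarrow> real \<Rightarrow> real measure \<Rightarrow> nat \<Rightarrow> real \<Rightarrow> real" where
  "q_scale \<gamma> \<alpha> Q d \<rho> = \<gamma> powr (1 / \<alpha>) * quantile Q (1 - 1 / \<rho> ^ d)"

section \<open>Laguerre cells\<close>

definition laguerre_cell ::
  "'a::euclidean_space \<times> real \<Rightarrow> ('a \<times> real) set \<Rightarrow> 'a set" where
  "laguerre_cell p \<phi> =
     {z. \<forall>(y, t)\<in>\<phi>. (norm (z - fst p))\<^sup>2 - (snd p)\<^sup>2 \<le> (norm (z - y))\<^sup>2 - t\<^sup>2}"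

text \<open>The inradius is infinite if the cell is the whole space.\<close>

definition inradius ::
  "'a::euclidean_space \<times> real \<Rightarrow> ('a \<times> real) set \<Rightarrow> ennreal" where
  "inradius p \<phi> =
     (if fst p \<in> laguerre_cell p \<phi>
      then (SUP r\<in>{r. 0 \<le> r \<and> cball (fst p) r \<subseteq> laguerre_cell p \<phi>}. ennreal r)
      else 0)"

section \<open>The state spaces and the point process of rescaled inradii\<close>

definition marked_space :: "('a::euclidean_space \<times> real) topology" where
  "marked_space = subtopology euclidean (UNIV \<times> {0..})"

definition recip_dist :: "ennreal \<Rightarrow> ennreal \<Rightarrow> real" where
  "recip_dist s t = \<bar>enn2real (inverse s) - enn2real (inverse t)\<bar>"

definition recip_metric :: "ennreal metric" where
  "recip_metric = metric ({0<..}, recip_dist)"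

lemma Metric_space_recip: "Metric_space {0<..} recip_dist"
proof
  fix s t :: ennreal assume st: "s \<in> {0<..}" "t \<in> {0<..}"
  then have fin: "inverse s \<noteq> \<infinity>" "inverse t \<noteq> \<infinity>" by (auto simp: ennreal_inverse_eq_top_iff)
  have "recip_dist s t = 0 \<longleftrightarrow> inverse s = inverse t"
    unfolding recip_dist_def using fin
    by (metis abs_eq_0_iff eq_iff_diff_eq_0 ennreal_enn2real_if infinity_ennreal_def)
  also have "\<dots> \<longleftrightarrow> s = t"
    by (metis divide_ennreal_def one_divide_one_divide_ennreal)
  finally show "recip_dist s t = 0 \<longleftrightarrow> s = t" .
qed (auto simp: recip_dist_def)

lemma mspace_recip_metric [simp]: "mspace recip_metric = {0<..}"
  and mdist_recip_metric [simp]: "mdist recip_metric = recip_dist"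
  by (simp_all add: recip_metric_def Metric_space.mspace_metric Metric_space.mdist_metric
      Metric_space_recip)

definition limit_space :: "'a::euclidean_space set \<Rightarrow> ('a \<times> ennreal \<times> ennreal) topology" where
  "limit_space W = mtopology_of
     (prod_metric (submetric euclidean_metric W) (prod_metric recip_metric recip_metric))"

text \<open>Counting measures as sets of points.\<close>

definition points :: "'e measure \<Rightarrow> 'e set" where
  "points \<nu> = {x \<in> space \<nu>. emeasure \<nu> {x} \<noteq> 0}"

text \<open>\<open>distr (count_space A) N T\<close> is the sum of the Dirac measures at \<open>T x\<close> for \<open>x \<in> A\<close>. As the
  state space only allows positive third components, points with inradius 0 are left out.\<close>

definition Xi ::
  "real \<Rightarrow> real \<Rightarrow> real measure \<Rightarrow> 'a::euclidean_space set \<Rightarrow> real \<Rightarrow> ('a \<times> real) measure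
     \<Rightarrow> ('a \<times> ennreal \<times> ennreal) measure" where
  "Xi \<gamma> \<alpha> Q W \<rho> \<eta> =
     (let q = q_scale \<gamma> \<alpha> Q DIM('a) \<rho> in
      distr (count_space {p \<in> points \<eta> \<inter> ((\<lambda>x. \<rho> *\<^sub>R x) ` W \<times> {0<..}). 0 < inradius p (points \<eta>)})
        (borel_of (limit_space W))
        (\<lambda>p. ((1 / \<rho>) *\<^sub>R fst p, ennreal (snd p / q), inradius p (points \<eta>) / ennreal q)))"

text \<open>The defining properties of the measure \<open>K\<^sub>\<alpha>\<close> on \<open>(0,\<infinity>]\<^sup>2\<close>.\<close>

definition is_diag_power_measure :: "real \<Rightarrow> (ennreal \<times> ennreal) measure \<Rightarrow> bool" where
  "is_diag_power_measure \<alpha> K \<longleftrightarrow>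
     sets K = sets (borel_of (mtopology_of (prod_metric recip_metric recip_metric))) \<and>
     (\<forall>a b. 0 < a \<and> a < b \<longrightarrow>
        emeasure K {(x, x) | x. ennreal a < x \<and> x \<le> ennreal b} =
          ennreal (a powr (- \<alpha>) - b powr (- \<alpha>))) \<and>
     emeasure K (space K - {(x, x) | x. 0 < x \<and> x < \<infinity>}) = 0"

end

theory Submission
  imports Defs "HOL-Real_Asymp.Real_Asymp"
begin

text \<open>
  A point \<open>(x, m)\<close> has inradius at least \<open>a > 0\<close> iff \<open>t\<^sup>2 - m\<^sup>2 \<le> D\<^sup>2 - 2 a D\<close> for all points \<open>(y, t)\<close>,
  where \<open>D = norm (y - x)\<close>. For \<open>m\<close> of the order of the scale \<open>q\<close>, points with marks \<open>t \<lless> q\<close> allow every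
  \<open>a\<close> slightly below \<open>m\<close>, and a point at distance about \<open>m\<close> forces \<open>a\<close> to be at most slightly above \<open>m\<close>.
  Since \<open>\<alpha> > d\<close>, one has \<open>q = o(\<rho>)\<close>, so two marks of order \<open>q\<close> at distance of order \<open>q\<close> do not occur in the window
  with high probability, and larger marks further away are harmless. Hence the inradius of every point that
  matters is close to its mark, and the process is close to the diagonal image of a Poisson process whose
  intensity converges.

  No tightness is needed to pass to bounded continuous functionals \<open>F\<close>: on a grid of mesh \<open>h\<close>, \<open>F\<close> is bounded above by
  its supremum over all near-diagonal configurations with the same cell counts. This bound depends only on
  finitely many counts, whose laws converge because they are independent Poisson variables, and it converges to
  \<open>F\<close> along the limiting process as \<open>h \<rightarrow> 0\<close>. The same for \<open>- F\<close> gives the lower bound.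
\<close>

text \<open>Two measurability obstacles shape the proof. The inradius of a point depends on the
  whole configuration, and finiteness on strips \<open>cball 0 n \<times> {0..}\<close> and absence
  of multiple points hold only almost surely: compact subsets of \<open>marked_space\<close> bound
  the marks, so local finiteness says nothing about strips. \<open>Xi\<close> is therefore shown
  measurable for a modification of \<open>\<eta>\<close> that is good everywhere, and its law is
  computed from there. The suprema over configurations with given counts are measurable for a
  discrete reason: a vector of finitely many counts takes countably many values, so every function
  of it is measurable.

  The mark axis is compactified at \<infinity>, so arbitrarily large marks are counted too. Their
  reciprocals fill the first grid interval, which starts at 0; the limit measure of [u, v) is
  v^\<alpha> - u^\<alpha>, finite down to u = 0. At mesh h = 1/(n+1) the reciprocal marks below 1/h
  are gridded. There a relative inradius error h^2/2 becomes an error of at most h in reciprocal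
  coordinates, which fixes the accuracy demanded of the inradius.\<close>

text \<open>In reciprocal coordinates the state space becomes \<open>W \<times> [0,\<infinity>)\<^sup>2\<close> with the Euclidean topology.\<close>

definition recip :: "ennreal \<Rightarrow> real" where
  "recip s = enn2real (inverse s)"

definition recip_map :: "'a \<times> ennreal \<times> ennreal \<Rightarrow> 'a \<times> real \<times> real" where
  "recip_map p = (fst p, recip (fst (snd p)), recip (snd (snd p)))"

definition recip_map_inv :: "'a \<times> real \<times> real \<Rightarrow> 'a \<times> ennreal \<times> ennreal" where
  "recip_map_inv p = (fst p, inverse (ennreal (fst (snd p))), inverse (ennreal (snd (snd p))))"

lemma ennreal_inverse_inverse [simp]: "inverse (inverse s) = (s :: ennreal)"
  by (metis divide_ennreal_def one_divide_one_divide_ennreal mult_1)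

lemma recip_nonneg [simp]: "0 \<le> recip s"
  by (simp add: recip_def)

lemma inverse_recip: "0 < s \<Longrightarrow> inverse (ennreal (recip s)) = s"
  by (simp add: recip_def ennreal_inverse_eq_top_iff flip: less_top)

lemma recip_inverse: "0 \<le> r \<Longrightarrow> recip (inverse (ennreal r)) = r"
  by (simp add: recip_def)

lemma recip_top [simp]: "recip \<infinity> = 0" "recip top = 0"
  by (simp_all add: recip_def)

lemma recip_ennreal: "0 < r \<Longrightarrow> recip (ennreal r) = 1 / r"
  by (simp add: recip_def inverse_ennreal inverse_eq_divide)

lemma inverse_ennreal_pos: "0 < inverse (ennreal r)"
  by (simp add: ennreal_inverse_positive)

lemma mtopology_of_submetric_euclidean:
  "Metric_space.mtopology S dist = top_of_set (S :: 'a :: metric_space set)"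
proof -
  have "Metric_space.mtopology S dist = mtopology_of (submetric euclidean_metric S)"
    by (simp add: mtopology_of_def)
  then show ?thesis by (simp add: mtopology_of_submetric)
qed

text \<open>\<open>recip_dist\<close> is by definition the distance of the reciprocals, so
  \<open>recip\<close> is an isometry onto \<open>{0..}\<close>, and continuity in both directions
  follows from surjectivity alone.\<close>

lemma homeomorphic_map_recip: "homeomorphic_map (mtopology_of recip_metric) (top_of_set {0..}) recip"
proof -
  interpret R: Metric_space "{0<..}" recip_dist by (rule Metric_space_recip)
  have sub: "Metric_space {0..} (dist :: real \<Rightarrow> real \<Rightarrow> real)"
    by unfold_locales (auto simp: dist_commute dist_triangle)
  interpret R12: Metric_space12 "{0<..}" recip_dist "{0..}" "dist :: real \<Rightarrow> real \<Rightarrow> real"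
    unfolding Metric_space12_def using sub R.Metric_space_axioms by auto
  have surj: "recip ` {0<..} = {0..}"
  proof safe
    fix r :: real assume "0 \<le> r"
    then show "r \<in> recip ` {0<..}"
      by (intro image_eqI[of _ _ "inverse (ennreal r)"]) (auto simp: recip_inverse inverse_ennreal_pos)
  qed simp
  have "homeomorphic_map R.mtopology R12.M2.mtopology recip"
    by (rule R12.isometry_imp_homeomorphic_map[OF surj]) (simp add: recip_dist_def recip_def dist_real_def)
  then show ?thesis
    by (simp add: mtopology_of_submetric_euclidean mtopology_of_def)
qed

lemma topspace_limit_space: "topspace (limit_space W) = W \<times> {0<..} \<times> {0<..}"
  by (simp add: limit_space_def)

lemma limit_space_eq: "limit_space W =
   prod_topology (top_of_set W) (prod_topology (mtopology_of recip_metric) (mtopology_of recip_metric))"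
  by (simp add: limit_space_def mtopology_of_submetric)

lemma top_of_set_Times: "top_of_set (A \<times> B) = prod_topology (top_of_set A) (top_of_set B)"
  by (simp add: subtopology_Times)

lemma homeomorphic_map_recip_map:
  "homeomorphic_map (limit_space W) (top_of_set (W \<times> {0..} \<times> {0..})) recip_map"
proof -
  have recip: "continuous_map (mtopology_of recip_metric) (top_of_set {0..}) recip"
    using homeomorphic_map_recip homeomorphic_imp_continuous_map by blast
  have inv: "continuous_map (top_of_set {0..}) (mtopology_of recip_metric) (\<lambda>r. inverse (ennreal r))"
  proof -
    obtain g where g: "homeomorphic_maps (mtopology_of recip_metric) (top_of_set {0..}) recip g"
      using homeomorphic_map_recip homeomorphic_map_maps by blast
    then have c: "continuous_map (top_of_set {0..}) (mtopology_of recip_metric) g"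
      by (simp add: homeomorphic_maps_def)
    \<comment> \<open>The homeomorphism only supplies some inverse \<open>g\<close>; evaluating
      \<open>g\<close> at \<open>recip\<close> of \<open>inverse (ennreal r)\<close> identifies it
      with the explicit formula.\<close>
    have "g r = inverse (ennreal r)" if "r \<in> {0..}" for r
      using g that by (auto simp: homeomorphic_maps_def recip_inverse inverse_ennreal_pos
          dest!: bspec[of _ _ "inverse (ennreal r)"])
    then show ?thesis using c by (rule_tac continuous_map_eq[OF c]) simp
  qed
  have "homeomorphic_maps (limit_space W) (top_of_set (W \<times> {0..} \<times> {0..})) recip_map recip_map_inv"
    unfolding homeomorphic_maps_def
  proof (intro conjI ballI)
    show "continuous_map (limit_space W) (top_of_set (W \<times> {0..} \<times> {0..})) recip_map"
      unfolding limit_space_eq top_of_set_Times recip_map_def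
      by (intro continuous_map_pairedI continuous_map_compose[OF _ recip, unfolded o_def]
          continuous_map_fst continuous_map_snd continuous_map_fst_of continuous_map_snd_of
           continuous_map_compose[OF continuous_map_snd continuous_map_fst, unfolded o_def]
           continuous_map_compose[OF continuous_map_snd continuous_map_snd, unfolded o_def])
    show "continuous_map (top_of_set (W \<times> {0..} \<times> {0..})) (limit_space W) recip_map_inv"
      unfolding limit_space_eq top_of_set_Times recip_map_inv_def
      by (intro continuous_map_pairedI continuous_map_compose[OF _ inv, unfolded o_def]
          continuous_map_fst continuous_map_snd continuous_map_fst_of continuous_map_snd_of
           continuous_map_compose[OF continuous_map_snd continuous_map_fst, unfolded o_def]
           continuous_map_compose[OF continuous_map_snd continuous_map_snd, unfolded o_def])
  qed (auto simp: topspace_limit_space recip_map_def recip_map_inv_def inverse_recip recip_inverse)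
  then show ?thesis using homeomorphic_map_maps by blast
qed

lemma continuous_map_recip_map: "continuous_map (limit_space W) euclidean recip_map"
  using homeomorphic_imp_continuous_map[OF homeomorphic_map_recip_map, of W]
  by (simp add: continuous_map_in_subtopology)

lemma recip_map_inv_recip_map: "p \<in> topspace (limit_space W) \<Longrightarrow> recip_map_inv (recip_map p) = p"
  by (auto simp: topspace_limit_space recip_map_def recip_map_inv_def inverse_recip)

lemma recip_map_recip_map_inv: "v \<in> W \<times> {0..} \<times> {0..} \<Longrightarrow> recip_map (recip_map_inv v) = v"
  by (auto simp: recip_map_def recip_map_inv_def recip_inverse)

lemma continuous_map_recip_map_inv: "continuous_map (top_of_set (W \<times> {0..} \<times> {0..})) (limit_space W) recip_map_inv"
proof -
  obtain g where g: "homeomorphic_maps (limit_space W) (top_of_set (W \<times> {0..} \<times> {0..})) recip_map g"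
    using homeomorphic_map_recip_map homeomorphic_map_maps by blast
  then have c: "continuous_map (top_of_set (W \<times> {0..} \<times> {0..})) (limit_space W) g"
    by (simp add: homeomorphic_maps_def)
  have "g v = recip_map_inv v" if v: "v \<in> W \<times> {0..} \<times> {0..}" for v
  proof -
    have "recip_map_inv v \<in> topspace (limit_space W)"
      using v by (auto simp: topspace_limit_space recip_map_inv_def inverse_ennreal_pos)
    then have "g (recip_map (recip_map_inv v)) = recip_map_inv v" using g by (simp add: homeomorphic_maps_def)
    then show ?thesis using v by (simp add: recip_map_recip_map_inv)
  qed
  then show ?thesis using c by (rule_tac continuous_map_eq[OF c]) simp
qed

section \<open>Borel sets of a topology\<close>

lemma space_borel_of [simp]: "space (borel_of T) = topspace T"
  by (simp add: borel_of_def space_measure_of_conv)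

lemma sets_borel_of: "sets (borel_of T) = sigma_sets (topspace T) {U. openin T U}"
  unfolding borel_of_def by (rule sets_measure_of) (use openin_subset in auto)

lemma openin_sets_borel_of: "openin T U \<Longrightarrow> U \<in> sets (borel_of T)"
  by (simp add: sets_borel_of)

lemma measurable_borel_ofI:
  assumes "\<And>x. x \<in> space M \<Longrightarrow> f x \<in> topspace T"
    and "\<And>U. openin T U \<Longrightarrow> f -` U \<inter> space M \<in> sets M"
  shows "f \<in> M \<rightarrow>\<^sub>M borel_of T"
  unfolding borel_of_def
  using assms by (intro measurable_measure_of) (auto dest: openin_subset)

lemma continuous_map_measurable_borel_of:
  assumes "continuous_map S T f"
  shows "f \<in> borel_of S \<rightarrow>\<^sub>M borel_of T"
proof (rule measurable_borel_ofI)
  fix U assume "openin T U"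
  then have "openin S {x \<in> topspace S. f x \<in> U}"
    using assms by (rule_tac openin_continuous_map_preimage)
  moreover have "{x \<in> topspace S. f x \<in> U} = f -` U \<inter> space (borel_of S)" by auto
  ultimately show "f -` U \<inter> space (borel_of S) \<in> sets (borel_of S)"
    by (metis openin_sets_borel_of)
qed (use assms in \<open>auto simp: continuous_map_def\<close>)

lemma borel_of_euclidean: "sets (borel_of euclidean) = sets borel"
  by (simp add: sets_borel_of borel_def)

lemma continuous_map_borel_measurable:
  assumes "continuous_map S euclidean f"
  shows "f \<in> borel_measurable (borel_of S)"
  using continuous_map_measurable_borel_of[OF assms] measurable_cong_sets[OF refl borel_of_euclidean]
  by blast

lemma recip_map_measurable: "recip_map \<in> borel_measurable (borel_of (limit_space W))"
  by (rule continuous_map_borel_measurable[OF continuous_map_recip_map])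

section \<open>Vague convergence\<close>

text \<open>Induction over finite intersections and unions. It reduces vague convergence to the
  convergence of integrals of single test functions.\<close>

lemma eventually_in_generated_topology:
  assumes "generate_topology_on S U" "x \<in> U"
    and "\<And>s. s \<in> S \<Longrightarrow> x \<in> s \<Longrightarrow> eventually (\<lambda>n. f n \<in> s) F"
  shows "eventually (\<lambda>n. f n \<in> U) F"
  using assms(1,2)
proof (induction rule: generate_topology_on.induct)
  case (Int a b)
  then show ?case by (auto intro: eventually_conj)
next
  case (UN K)
  then obtain k where k: "k \<in> K" "x \<in> k" by auto
  from UN.IH[OF this] show ?case by eventually_elim (use k in auto)
qed (use assms(3) in auto)

lemma limitin_vague_topology:
  assumes "\<nu> \<in> locally_finite_counting_measures E"
    and "\<And>n. \<mu> n \<in> locally_finite_counting_measures E"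
    and "\<And>f. f \<in> vague_test_functions E \<Longrightarrow> (\<lambda>n. \<integral>x. f x \<partial>\<mu> n) \<longlonglongrightarrow> (\<integral>x. f x \<partial>\<nu>)"
  shows "limitin (vague_topology E) \<mu> \<nu> sequentially"
  unfolding limitin_def topspace_vague_topology
proof (intro conjI allI impI assms(1))
  fix U assume U: "openin (vague_topology E) U \<and> \<nu> \<in> U"
  then have "generate_topology_on {{\<nu> \<in> locally_finite_counting_measures E. (\<integral>x. f x \<partial>\<nu>) \<in> U} | f U.
        f \<in> vague_test_functions E \<and> open U} U"
    by (simp add: vague_topology_def openin_topology_generated_by_iff)
  then show "\<forall>\<^sub>F n in sequentially. \<mu> n \<in> U"
  proof (rule eventually_in_generated_topology[of _ _ \<nu>])
    fix s assume "s \<in> {{\<nu> \<in> locally_finite_counting_measures E. (\<integral>x. f x \<partial>\<nu>) \<in> U} | f U.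
        f \<in> vague_test_functions E \<and> open U}" "\<nu> \<in> s"
    then obtain f V where f: "f \<in> vague_test_functions E" "open V" "(\<integral>x. f x \<partial>\<nu>) \<in> V"
       and s: "s = {\<nu> \<in> locally_finite_counting_measures E. (\<integral>x. f x \<partial>\<nu>) \<in> V}" by blast
    have "\<forall>\<^sub>F n in sequentially. (\<integral>x. f x \<partial>\<mu> n) \<in> V"
      by (rule topological_tendstoD[OF assms(3)[OF f(1)] f(2,3)])
    then show "\<forall>\<^sub>F n in sequentially. \<mu> n \<in> s"
      by eventually_elim (use assms(2) s in auto)
  qed (use U in auto)
qed

lemma counting_measureD:
  assumes "\<nu> \<in> locally_finite_counting_measures E"
  shows "space \<nu> = topspace E" "sets \<nu> = sets (borel_of E)"
    "\<And>A. emeasure \<nu> A \<in> insert \<infinity> (range of_nat)"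
    "\<And>K. compactin E K \<Longrightarrow> emeasure \<nu> K < \<infinity>"
proof -
  show "emeasure \<nu> A \<in> insert \<infinity> (range of_nat)" for A
  proof (cases "A \<in> sets \<nu>")
    case False
    then have "emeasure \<nu> A = of_nat 0" by (simp add: emeasure_notin_sets)
    then show ?thesis by blast
  qed (use assms in \<open>auto simp: locally_finite_counting_measures_def\<close>)
qed (use assms in \<open>auto simp: locally_finite_counting_measures_def\<close>)

text \<open>For \<open>B > 0\<close> this is W x [1/B, \<infinity>]^2 in the original coordinates.
  These sets are compact and absorb every compact set, so they take the role of closed
  balls.\<close>

definition level_set :: "'a::euclidean_space set \<Rightarrow> real \<Rightarrow> ('a \<times> ennreal \<times> ennreal) set" where
  "level_set W B = {p \<in> topspace (limit_space W). recip (fst (snd p)) \<le> B \<and> recip (snd (snd p)) \<le> B}"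

lemma compactin_level_set:
  assumes "compact W"
  shows "compactin (limit_space W) (level_set W B)"
proof -
  have "compactin (top_of_set (W \<times> {0..} \<times> {0..})) (W \<times> {0..B} \<times> {0..B})"
    using assms by (auto simp: compactin_subtopology intro!: compact_Times)
  then have "compactin (limit_space W) (recip_map_inv ` (W \<times> {0..B} \<times> {0..B}))"
    by (rule image_compactin) (rule continuous_map_recip_map_inv)
  moreover have "recip_map_inv ` (W \<times> {0..B} \<times> {0..B}) = level_set W B"
  proof safe
    fix p assume p: "p \<in> level_set W B"
    then have "recip_map p \<in> W \<times> {0..B} \<times> {0..B}" "p = recip_map_inv (recip_map p)"
      by (auto simp: level_set_def topspace_limit_space recip_map_def recip_map_inv_recip_map[of p W])
        (auto simp: recip_map_inv_def inverse_recip)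
    then show "p \<in> recip_map_inv ` (W \<times> {0..B} \<times> {0..B})" by (metis image_eqI)
  qed (auto simp: level_set_def recip_map_inv_def topspace_limit_space inverse_ennreal_pos recip_inverse)
  ultimately show ?thesis by simp
qed

lemma level_set_borel: "level_set W B \<in> sets (borel_of (limit_space W))"
proof -
  have "recip_map -` {v. fst (snd v) \<le> B \<and> snd (snd v) \<le> B} \<inter> space (borel_of (limit_space W))
    \<in> sets (borel_of (limit_space W))"
    by (rule measurable_sets[OF recip_map_measurable]) (auto intro!: borel_closed closed_Collect_conj closed_Collect_le continuous_intros)
  also have "recip_map -` {v. fst (snd v) \<le> B \<and> snd (snd v) \<le> B} \<inter> space (borel_of (limit_space W)) = level_set W B"
    by (auto simp: level_set_def recip_map_def)
  finally show ?thesis .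
qed

lemma compactin_subset_level_set:
  assumes "compactin (limit_space W) K"
  obtains B where "0 \<le> B" "K \<subseteq> level_set W B"
proof -
  have "compact (recip_map ` K)"
    using image_compactin[OF assms continuous_map_recip_map] by simp
  then obtain B where B: "\<And>v. v \<in> recip_map ` K \<Longrightarrow> norm v \<le> B"
    by (meson bounded_iff compact_imp_bounded)
  have "p \<in> level_set W (max B 0)" if p: "p \<in> K" for p
  proof -
    have "norm (recip_map p) \<le> B" using B p by blast
    moreover have "norm (fst (snd (recip_map p))) \<le> norm (recip_map p)" "norm (snd (snd (recip_map p))) \<le> norm (recip_map p)"
      by (metis norm_fst_le norm_snd_le order_trans prod.collapse)+
    ultimately have "recip (fst (snd p)) \<le> B" "recip (snd (snd p)) \<le> B" by (auto simp: recip_map_def)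
    then show ?thesis
      using p compactin_subset_topspace[OF assms] by (auto simp: level_set_def)
  qed
  then show ?thesis by (intro that[of "max B 0"]) auto
qed

text \<open>Applied to two measures with equal masses on the cells, it puts both integrals close to
  the same sum. The right side of \<open>le\<close> vanishes outside the cells, so \<open>f\<close>
  is almost everywhere 0 there; this also yields the integrability of \<open>f\<close>.\<close>

lemma integral_step_approx:
  fixes f :: "'e \<Rightarrow> real"
  assumes I: "finite I" and C: "\<And>i. i \<in> I \<Longrightarrow> C i \<in> sets M" "\<And>i. i \<in> I \<Longrightarrow> emeasure M (C i) < \<infinity>"
    and f: "f \<in> borel_measurable M"
    and le: "AE x in M. \<bar>f x - (\<Sum>i\<in>I. a i * indicator (C i) x)\<bar> \<le> e * (\<Sum>i\<in>I. indicator (C i) x)"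
  shows "\<bar>(\<integral>x. f x \<partial>M) - (\<Sum>i\<in>I. a i * measure M (C i))\<bar> \<le> e * (\<Sum>i\<in>I. measure M (C i))"
proof -
  define g where "g x = (\<Sum>i\<in>I. a i * indicator (C i) x)" for x
  define k where "k x = e * (\<Sum>i\<in>I. indicator (C i) x)" for x :: 'e
  have ind: "integrable M (indicator (C i) :: _ \<Rightarrow> real)" if "i \<in> I" for i
    using C[OF that] by (simp add: integrable_indicator_iff)
  have g: "integrable M g" "(\<integral>x. g x \<partial>M) = (\<Sum>i\<in>I. a i * measure M (C i))"
    using ind C unfolding g_def
    by (auto intro!: Bochner_Integration.integrable_sum integrable_mult_right sum.cong
        simp: Bochner_Integration.integral_sum)
  have k: "integrable M k" "(\<integral>x. k x \<partial>M) = e * (\<Sum>i\<in>I. measure M (C i))"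
    using ind C unfolding k_def
    by (auto intro!: Bochner_Integration.integrable_sum integrable_mult_right
        simp: Bochner_Integration.integral_sum)
  have le': "AE x in M. norm (f x - g x) \<le> k x" using le by (simp add: g_def k_def)
  have "AE x in M. norm (f x - g x) \<le> norm (k x)" using le' by eventually_elim auto
  then have fg: "integrable M (\<lambda>x. f x - g x)"
    using f g by (intro Bochner_Integration.integrable_bound[OF k(1)]) auto
  have "integrable M (\<lambda>x. (f x - g x) + g x)" by (intro Bochner_Integration.integrable_add fg g)
  then have fi: "integrable M f" by simp
  have "\<bar>(\<integral>x. f x \<partial>M) - (\<integral>x. g x \<partial>M)\<bar> = norm (\<integral>x. f x - g x \<partial>M)"
    using fi g by simp
  also have "\<dots> \<le> (\<integral>x. norm (f x - g x) \<partial>M)" by (rule integral_norm_bound)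
  also have "\<dots> \<le> (\<integral>x. k x \<partial>M)"
    by (intro integral_mono_AE k integrable_norm fg le')
  finally show ?thesis using g k by simp
qed

lemma vague_test_function_uniformly_continuous:
  assumes W: "compact W" and f: "f \<in> vague_test_functions (limit_space W)" and "0 < e"
  obtains d where "0 < d" "\<And>x y. x \<in> level_set W B \<Longrightarrow> y \<in> level_set W B \<Longrightarrow>
    dist (recip_map x) (recip_map y) < d \<Longrightarrow> \<bar>f x - f y\<bar> < e"
proof -
  have "continuous_map (top_of_set (W \<times> {0..} \<times> {0..})) euclidean (f \<circ> recip_map_inv)"
    by (rule continuous_map_compose[OF continuous_map_recip_map_inv]) (use f in \<open>simp add: vague_test_functions_def\<close>)
  then have "continuous_on (W \<times> {0..} \<times> {0..}) (f \<circ> recip_map_inv)" by simp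
  then have "continuous_on (W \<times> {0..B} \<times> {0..B}) (f \<circ> recip_map_inv)"
    by (rule continuous_on_subset) auto
  moreover have "compact (W \<times> {0..B} \<times> {0..B})" using W by (intro compact_Times) auto
  ultimately have "uniformly_continuous_on (W \<times> {0..B} \<times> {0..B}) (f \<circ> recip_map_inv)"
    by (rule compact_uniformly_continuous)
  then obtain d where d: "d > 0" "\<And>u v. u \<in> W \<times> {0..B} \<times> {0..B} \<Longrightarrow> v \<in> W \<times> {0..B} \<times> {0..B} \<Longrightarrow>
     dist v u < d \<Longrightarrow> dist ((f \<circ> recip_map_inv) v) ((f \<circ> recip_map_inv) u) < e"
    using \<open>0 < e\<close> unfolding uniformly_continuous_on_def by blast
  have *: "recip_map x \<in> W \<times> {0..B} \<times> {0..B} \<and> recip_map_inv (recip_map x) = x" if "x \<in> level_set W B" for x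
  proof -
    have "x \<in> topspace (limit_space W)" using that by (simp add: level_set_def)
    from recip_map_inv_recip_map[OF this] show ?thesis
      using that by (auto simp: level_set_def topspace_limit_space recip_map_def)
  qed
  show ?thesis
  proof (rule that[OF d(1)])
    fix x y assume xy: "x \<in> level_set W B" "y \<in> level_set W B" "dist (recip_map x) (recip_map y) < d"
    then show "\<bar>f x - f y\<bar> < e"
      using d(2)[of "recip_map y" "recip_map x"] *[OF xy(1)] *[OF xy(2)] by (simp add: dist_real_def)
  qed
qed

text \<open>A test function is uniformly continuous on a level set and hence nearly constant on each
  small cell, so equal cell masses force nearly equal integrals. The lemma is deterministic and used
  twice: with a full grid for measurability, and with near-diagonal cells for the limit
  theorem.\<close>

lemma vague_convergence_cells:
  fixes W :: "'a::euclidean_space set" and C :: "nat \<Rightarrow> 'i \<Rightarrow> ('a \<times> ennreal \<times> ennreal) set"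
  assumes W: "compact W"
    and \<nu>: "\<nu> \<in> locally_finite_counting_measures (limit_space W)"
    and \<mu>: "\<And>n. \<mu> n \<in> locally_finite_counting_measures (limit_space W)"
    and fin: "\<And>n. finite (I n)" and disj: "\<And>n. disjoint_family_on (C n) (I n)"
    and C: "\<And>n i. i \<in> I n \<Longrightarrow> C n i \<in> sets (borel_of (limit_space W))"
    and diam: "\<And>n i x y. i \<in> I n \<Longrightarrow> x \<in> C n i \<Longrightarrow> y \<in> C n i \<Longrightarrow> dist (recip_map x) (recip_map y) \<le> e n"
    and e: "e \<longlonglongrightarrow> 0"
    and eqm: "\<And>n i. i \<in> I n \<Longrightarrow> emeasure (\<mu> n) (C n i) = emeasure \<nu> (C n i)"
    and null: "\<And>B. \<forall>\<^sub>F n in sequentially. emeasure (\<mu> n) (level_set W B - (\<Union>i\<in>I n. C n i)) = 0 \<and>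
        emeasure \<nu> (level_set W B - (\<Union>i\<in>I n. C n i)) = 0"
  shows "limitin (vague_topology (limit_space W)) \<mu> \<nu> sequentially"
proof (rule limitin_vague_topology[OF \<nu> \<mu>])
  fix f assume f: "f \<in> vague_test_functions (limit_space W)"
  then have fm: "f \<in> borel_measurable (borel_of (limit_space W))"
    by (intro continuous_map_borel_measurable) (simp add: vague_test_functions_def)
  obtain L where L: "compactin (limit_space W) L" "\<And>x. x \<in> topspace (limit_space W) \<Longrightarrow> x \<notin> L \<Longrightarrow> f x = 0"
    using f by (auto simp: vague_test_functions_def)
  obtain B where B: "0 \<le> B" "L \<subseteq> level_set W B" by (rule compactin_subset_level_set[OF L(1)])
  define m where "m = measure \<nu> (level_set W (B + 1))"
  have finB: "emeasure \<nu> (level_set W (B + 1)) < \<infinity>"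
    using counting_measureD(4)[OF \<nu> compactin_level_set[OF W]] .
  show "(\<lambda>n. \<integral>x. f x \<partial>\<mu> n) \<longlonglongrightarrow> (\<integral>x. f x \<partial>\<nu>)"
  proof (rule LIMSEQ_I)
    fix r :: real assume r: "0 < r"
    \<comment> \<open>Both integrals differ from the common sum by at most
      \<open>\<epsilon> * m\<close>, and twice this is below \<open>r\<close>; the summand 1 covers
      \<open>m = 0\<close>.\<close>
    define \<epsilon> where "\<epsilon> = r / (2 * m + 1) / 2"
    have m0: "0 \<le> m" by (simp add: m_def)
    have \<epsilon>: "0 < \<epsilon>" using r m0 by (auto simp: \<epsilon>_def)
    obtain d where d: "0 < d" "\<And>x y. x \<in> level_set W (B + 1) \<Longrightarrow> y \<in> level_set W (B + 1) \<Longrightarrow>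
        dist (recip_map x) (recip_map y) < d \<Longrightarrow> \<bar>f x - f y\<bar> < \<epsilon>"
      by (rule vague_test_function_uniformly_continuous[OF W f \<epsilon>, where B = "B + 1"]) blast
    have "\<forall>\<^sub>F n in sequentially. e n < min d 1"
      using d(1) by (intro order_tendstoD(2)[OF e]) auto
    then have "\<forall>\<^sub>F n in sequentially. \<bar>(\<integral>x. f x \<partial>\<mu> n) - (\<integral>x. f x \<partial>\<nu>)\<bar> < r"
      using null[of B]
    proof eventually_elim
      case (elim n)
      \<comment> \<open>Only cells meeting the support matter. As their diameter is below 1, they
        lie in \<open>level_set W (B + 1)\<close>, whose mass under \<open>\<nu>\<close> is finite;
        this is why \<open>m\<close> is taken at \<open>B + 1\<close>.\<close>
      define J where "J = {i \<in> I n. C n i \<inter> L \<noteq> {}}"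
      have J: "finite J" "J \<subseteq> I n" using fin by (auto simp: J_def)
      have "\<exists>a. \<forall>i\<in>J. a i \<in> C n i \<inter> L" by (intro bchoice) (auto simp: J_def)
      then obtain a where "\<forall>i\<in>J. a i \<in> C n i \<inter> L" ..
      then have a: "\<And>i. i \<in> J \<Longrightarrow> a i \<in> C n i" "\<And>i. i \<in> J \<Longrightarrow> a i \<in> L" by simp_all
      have Csub: "C n i \<subseteq> level_set W (B + 1)" if i: "i \<in> J" for i
      proof
        have iI: "i \<in> I n" using i J by blast
        fix x assume x: "x \<in> C n i"
        have top: "x \<in> topspace (limit_space W)"
          using sets.sets_into_space[OF C[OF iI]] x by auto
        have "dist (recip_map x) (recip_map (a i)) \<le> 1" using diam[OF iI x a(1)[OF i]] elim(1) by simp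
        moreover have "dist (fst (snd (recip_map x))) (fst (snd (recip_map (a i)))) \<le> dist (recip_map x) (recip_map (a i))"
            "dist (snd (snd (recip_map x))) (snd (snd (recip_map (a i)))) \<le> dist (recip_map x) (recip_map (a i))"
          by (rule order_trans[OF dist_fst_le dist_snd_le] order_trans[OF dist_snd_le dist_snd_le])+
        moreover have "recip (fst (snd (a i))) \<le> B" "recip (snd (snd (a i))) \<le> B"
          using a(2)[OF i] B(2) by (auto simp: level_set_def)
        ultimately have "recip (fst (snd x)) \<le> B + 1" "recip (snd (snd x)) \<le> B + 1"
          by (auto simp: recip_map_def dist_real_def)
        then show "x \<in> level_set W (B + 1)" using top by (auto simp: level_set_def)
      qed
      have Cfin: "emeasure \<nu> (C n i) < \<infinity>" if i: "i \<in> J" for i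
      proof (rule order_le_less_trans[OF _ finB], rule emeasure_mono[OF Csub[OF i]])
        show "level_set W (B + 1) \<in> sets \<nu>" using level_set_borel counting_measureD(2)[OF \<nu>] by blast
      qed
      have unique: "i = j" if "i \<in> I n" "j \<in> I n" "x \<in> C n i" "x \<in> C n j" for i j x
        using disj[of n] that by (auto simp: disjoint_family_on_def)
      have approx: "\<bar>(\<integral>x. f x \<partial>M) - (\<Sum>i\<in>J. f (a i) * measure M (C n i))\<bar>
              \<le> \<epsilon> * (\<Sum>i\<in>J. measure M (C n i))"
        if M: "sets M = sets (borel_of (limit_space W))"
          and Ceq: "\<And>i. i \<in> J \<Longrightarrow> emeasure M (C n i) = emeasure \<nu> (C n i)"
          and nul: "emeasure M (level_set W B - (\<Union>i\<in>I n. C n i)) = 0" for M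
      proof (rule integral_step_approx[OF J(1)])
        show "C n i \<in> sets M" if "i \<in> J" for i using that C J M by auto
        show "emeasure M (C n i) < \<infinity>" if i: "i \<in> J" for i
          using Ceq[OF i] Cfin[OF i] by simp
        show "f \<in> borel_measurable M" using fm measurable_cong_sets[OF M refl] by blast
        have meas: "level_set W B - (\<Union>i\<in>I n. C n i) \<in> sets M"
          unfolding M by (intro sets.Diff level_set_borel sets.finite_UN fin C)
        have "AE x in M. x \<notin> level_set W B - (\<Union>i\<in>I n. C n i)"
          by (rule AE_not_in) (use meas nul in \<open>simp add: null_sets_def\<close>)
        then show "AE x in M. \<bar>f x - (\<Sum>i\<in>J. f (a i) * indicator (C n i) x)\<bar>
           \<le> \<epsilon> * (\<Sum>i\<in>J. indicator (C n i) x)"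
        proof (rule AE_mp, intro AE_I2 impI)
          fix x assume x: "x \<in> space M" "x \<notin> level_set W B - (\<Union>i\<in>I n. C n i)"
          have top: "x \<in> topspace (limit_space W)"
            using x(1) sets_eq_imp_space_eq[OF M] by simp
          show "\<bar>f x - (\<Sum>i\<in>J. f (a i) * indicator (C n i) x)\<bar> \<le> \<epsilon> * (\<Sum>i\<in>J. indicator (C n i) x)"
          proof (cases "\<exists>i\<in>J. x \<in> C n i")
            case True
            then obtain i where i: "i \<in> J" "x \<in> C n i" by blast
            have ind: "indicator (C n j) x = (if j = i then 1 else (0::real))" if "j \<in> J" for j
              using unique[of i j x] i that J by (auto simp: indicator_def)
            have "(\<Sum>j\<in>J. f (a j) * indicator (C n j) x) = (\<Sum>j\<in>J. if j = i then f (a j) else 0)"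
              by (intro sum.cong) (auto simp: ind)
            then have s1: "(\<Sum>j\<in>J. f (a j) * indicator (C n j) x) = f (a i)"
              using i J(1) by simp
            have s2: "(\<Sum>i\<in>J. indicator (C n i) x) = (1::real)"
              using i J(1) by (simp add: ind sum.delta cong: sum.cong)
            have iI: "i \<in> I n" using i J by blast
            have "dist (recip_map x) (recip_map (a i)) < d" using diam[OF iI i(2) a(1)[OF i(1)]] elim(1) by simp
            then have "\<bar>f x - f (a i)\<bar> < \<epsilon>"
              using d(2)[of x "a i"] Csub[OF i(1)] i(2) a(1)[OF i(1)] by auto
            then show ?thesis by (simp add: s1 s2)
          next
            case False
            \<comment> \<open>A point of \<open>L\<close> lies in \<open>level_set W B\<close>,
              hence outside the null set only if some cell contains it, and that cell would then
              belong to \<open>J\<close>.\<close>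
            have "x \<notin> L" using False x B(2) by (auto simp: J_def)
            then have "f x = 0" using L(2) top by blast
            then show ?thesis using False by (auto simp: indicator_def intro!: sum_nonneg)
          qed
        qed
      qed
      have meq: "measure (\<mu> n) (C n i) = measure \<nu> (C n i)" if "i \<in> J" for i
        using eqm[of i n] J that by (auto simp: measure_def)
      have a1: "\<bar>(\<integral>x. f x \<partial>\<nu>) - (\<Sum>i\<in>J. f (a i) * measure \<nu> (C n i))\<bar>
              \<le> \<epsilon> * (\<Sum>i\<in>J. measure \<nu> (C n i))"
        by (rule approx) (use elim counting_measureD(2)[OF \<nu>] in auto)
      have a2: "\<bar>(\<integral>x. f x \<partial>\<mu> n) - (\<Sum>i\<in>J. f (a i) * measure \<nu> (C n i))\<bar>
              \<le> \<epsilon> * (\<Sum>i\<in>J. measure \<nu> (C n i))"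
        using approx[of "\<mu> n"] elim counting_measureD(2)[OF \<mu>] eqm J meq by (auto cong: sum.cong simp: subset_iff)
      have "(\<Sum>i\<in>J. measure \<nu> (C n i)) = measure \<nu> (\<Union>i\<in>J. C n i)"
      proof (rule measure_finite_Union[symmetric, OF J(1)])
        show "C n ` J \<subseteq> sets \<nu>" using C J counting_measureD(2)[OF \<nu>] by auto
        show "disjoint_family_on (C n) J" using disj J by (rule_tac disjoint_family_on_mono)
        fix i assume i: "i \<in> J"
        show "emeasure \<nu> (C n i) \<noteq> \<infinity>"
          using Cfin[OF i] by simp
      qed
      also have "\<dots> \<le> m" unfolding m_def
        using Csub finB level_set_borel counting_measureD(2)[OF \<nu>]
        by (intro measure_mono_fmeasurable) (auto simp: fmeasurable_def intro!: sets.finite_UN J C subsetD[OF J(2)])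
      finally have "\<epsilon> * (\<Sum>i\<in>J. measure \<nu> (C n i)) \<le> \<epsilon> * m"
        using \<epsilon> by (intro mult_left_mono) auto
      then have "\<bar>(\<integral>x. f x \<partial>\<mu> n) - (\<integral>x. f x \<partial>\<nu>)\<bar> \<le> 2 * (\<epsilon> * m)"
        using a1 a2 by linarith
      also have "\<dots> < r" using r m0 unfolding \<epsilon>_def by (simp add: field_simps add_pos_nonneg)
      finally show ?case .
    qed
    then show "\<exists>no. \<forall>n\<ge>no. norm ((\<integral>x. f x \<partial>\<mu> n) - (\<integral>x. f x \<partial>\<nu>)) < r"
      by (simp add: eventually_sequentially)
  qed
qed

section \<open>Lattice quantisation\<close>

text \<open>Rounds every coordinate down to a multiple of \<open>h\<close>. The fibres are half-open
  cubes of side \<open>h\<close>, labelled by their lower corners.\<close>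

definition quant :: "real \<Rightarrow> 'a::euclidean_space \<Rightarrow> 'a" where
  "quant h x = (\<Sum>b\<in>Basis. (h * of_int \<lfloor>(x \<bullet> b) / h\<rfloor>) *\<^sub>R b)"

lemma quant_inner: "b \<in> Basis \<Longrightarrow> quant h x \<bullet> b = h * of_int \<lfloor>(x \<bullet> b) / h\<rfloor>"
  by (simp add: quant_def inner_sum_left_Basis)

lemma mult_floor_divide:
  fixes x h :: real
  assumes "0 < h"
  shows "h * of_int \<lfloor>x / h\<rfloor> \<le> x" "x < h * of_int \<lfloor>x / h\<rfloor> + h"
proof -
  have a: "of_int \<lfloor>x / h\<rfloor> \<le> x / h" and b: "x / h < of_int \<lfloor>x / h\<rfloor> + 1" by linarith+
  show "h * of_int \<lfloor>x / h\<rfloor> \<le> x" using iffD1[OF pos_le_divide_eq[OF assms] a] by (simp add: mult.commute)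
  show "x < h * of_int \<lfloor>x / h\<rfloor> + h" using iffD1[OF pos_divide_less_eq[OF assms] b] by (simp add: algebra_simps)
qed

lemma norm_diff_quant:
  fixes x :: "'a::euclidean_space" and h :: real
  assumes "0 < h"
  shows "norm (x - quant h x) \<le> DIM('a) * h"
proof -
  have "norm (x - quant h x) \<le> (\<Sum>b\<in>Basis. \<bar>(x - quant h x) \<bullet> b\<bar>)" by (rule norm_le_l1)
  also have "\<dots> \<le> (\<Sum>b\<in>(Basis :: 'a set). h :: real)"
  proof (rule sum_mono)
    fix b :: 'a assume "b \<in> Basis"
    then show "\<bar>(x - quant h x) \<bullet> b\<bar> \<le> h"
      using mult_floor_divide[OF assms, of "x \<bullet> b"] by (simp add: inner_diff_left quant_inner)
  qed
  finally show ?thesis by simp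
qed

lemma quant_measurable [measurable]: "quant h \<in> borel_measurable borel"
  unfolding quant_def by measurable

text \<open>The open and the closed box have the same volume, so this sandwich determines the volume
  of the half-open cube between them.\<close>

lemma quant_cell_sandwich:
  fixes z :: "'a::euclidean_space"
  assumes "0 < h" and z: "z = quant h y"
  shows "box z (z + (\<Sum>b\<in>Basis. h *\<^sub>R b)) \<subseteq> {x. quant h x = z}"
    and "{x. quant h x = z} \<subseteq> cbox z (z + (\<Sum>b\<in>Basis. h *\<^sub>R b))"
proof safe
  fix x assume x: "x \<in> box z (z + (\<Sum>b\<in>Basis. h *\<^sub>R b))"
  have "\<lfloor>(x \<bullet> b) / h\<rfloor> = \<lfloor>(y \<bullet> b) / h\<rfloor>" if b: "b \<in> Basis" for b
  proof -
    have "h * of_int \<lfloor>(y \<bullet> b) / h\<rfloor> < x \<bullet> b" "x \<bullet> b < h * of_int \<lfloor>(y \<bullet> b) / h\<rfloor> + h"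
      using x b by (auto simp: mem_box z quant_inner inner_add_left inner_sum_left_Basis)
    then show ?thesis using assms(1) by (intro floor_unique) (auto simp: field_simps)
  qed
  then show "quant h x = z" unfolding z quant_def by (intro sum.cong) auto
next
  fix x
  show "x \<in> cbox (quant h x) (quant h x + (\<Sum>b\<in>Basis. h *\<^sub>R b))"
    using mult_floor_divide[OF assms(1)]
    by (auto simp: mem_box quant_inner inner_add_left inner_sum_left_Basis intro: less_imp_le)
qed

lemma quant_cell_sets [measurable]: "{x. quant h x = z} \<in> sets borel"
  by measurable

lemma emeasure_quant_cell:
  fixes z :: "'a::euclidean_space" and h :: real
  assumes "0 < h" and z: "z \<in> range (quant h)"
  shows "emeasure lborel {x. quant h x = z} = ennreal (h ^ DIM('a))"
proof -
  obtain y where y: "z = quant h y" using z by auto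
  let ?u = "z + (\<Sum>b\<in>Basis. h *\<^sub>R b)"
  have ub: "\<And>b. b \<in> Basis \<Longrightarrow> z \<bullet> b \<le> ?u \<bullet> b" and "\<And>b. b \<in> Basis \<Longrightarrow> (?u - z) \<bullet> b = h"
    using assms(1) by (auto simp: inner_add_left inner_sum_left_Basis)
  then have "emeasure lborel (box z ?u) = ennreal (h ^ DIM('a))" "emeasure lborel (cbox z ?u) = ennreal (h ^ DIM('a))"
    by (auto simp: emeasure_lborel_box_eq emeasure_lborel_cbox_eq)
  moreover have "emeasure lborel (box z ?u) \<le> emeasure lborel {x. quant h x = z}"
    by (rule emeasure_mono[OF quant_cell_sandwich(1)[OF assms(1) y]]) simp
  moreover have "emeasure lborel {x. quant h x = z} \<le> emeasure lborel (cbox z ?u)"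
    by (rule emeasure_mono[OF quant_cell_sandwich(2)[OF assms(1) y]]) simp
  ultimately show ?thesis by (intro antisym) auto
qed

lemma finite_quant_image:
  fixes S :: "'a::euclidean_space set"
  assumes "bounded S"
  shows "finite (quant h ` S)"
proof -
  obtain R where R: "\<And>x. x \<in> S \<Longrightarrow> norm x \<le> R" using assms by (auto simp: bounded_iff)
  define N where "N = \<lceil>R / \<bar>h\<bar>\<rceil> + 1"
  have "quant h ` S \<subseteq> (\<lambda>k. \<Sum>b\<in>Basis. (h * of_int (k b)) *\<^sub>R b) ` (Basis \<rightarrow>\<^sub>E {-N..N})"
  proof safe
    fix x assume x: "x \<in> S"
    have "\<lfloor>(x \<bullet> b) / h\<rfloor> \<in> {-N..N}" if b: "b \<in> Basis" for b
    proof -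
      have "\<bar>(x \<bullet> b) / h\<bar> \<le> R / \<bar>h\<bar>"
        using Basis_le_norm[OF b, of x] R[OF x] by (auto simp: abs_divide intro!: divide_right_mono)
      then have "- (R / \<bar>h\<bar>) \<le> (x \<bullet> b) / h" "(x \<bullet> b) / h \<le> R / \<bar>h\<bar>" by linarith+
      then show ?thesis unfolding N_def by (simp add: le_floor_iff) linarith
    qed
    then show "quant h x \<in> (\<lambda>k. \<Sum>b\<in>Basis. (h * of_int (k b)) *\<^sub>R b) ` (Basis \<rightarrow>\<^sub>E {-N..N})"
      by (intro image_eqI[of _ _ "\<lambda>b\<in>Basis. \<lfloor>(x \<bullet> b) / h\<rfloor>"]) (auto simp: quant_def)
  qed
  moreover have "finite (Basis \<rightarrow>\<^sub>E {-N..N} :: ('a \<Rightarrow> int) set)" by (intro finite_PiE) auto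
  ultimately show ?thesis by (meson finite_imageI finite_subset)
qed

text \<open>A volume comparison: the cubes are disjoint, each has volume \<open>h ^ DIM('a)\<close>,
  and all lie in the ball enlarged by \<open>2 * DIM('a) * h\<close>, since both a point of the cube
  and the point of the ball are within \<open>DIM('a) * h\<close> of the common corner.\<close>

lemma card_quant_image_le:
  fixes h R :: real
  assumes "0 < h" "0 \<le> R"
  shows "real (card (quant h ` cball (0::'a::euclidean_space) R)) * h ^ DIM('a)
     \<le> unit_ball_vol DIM('a) * (R + 2 * DIM('a) * h) ^ DIM('a)"
proof -
  let ?Z = "quant h ` cball (0::'a) R"
  let ?R = "R + 2 * DIM('a) * h"
  have fin: "finite ?Z" by (rule finite_quant_image) simp
  have sub: "(\<Union>z\<in>?Z. {x. quant h x = z}) \<subseteq> cball 0 ?R"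
  proof safe
    fix x y :: 'a assume y: "y \<in> cball 0 R" and q: "quant h x = quant h y"
    have "norm x \<le> norm (x - quant h x) + norm (quant h x - y) + norm y"
      using norm_triangle_ineq[of "x - quant h x + (quant h x - y)" y]
        norm_triangle_ineq[of "x - quant h x" "quant h x - y"] by simp
    then show "x \<in> cball 0 ?R"
      using norm_diff_quant[OF assms(1), of x] norm_diff_quant[OF assms(1), of y] y q
      by (simp add: norm_minus_commute)
  qed
  have "ennreal (real (card ?Z) * h ^ DIM('a)) = (\<Sum>z\<in>?Z. ennreal (h ^ DIM('a)))"
    using assms by (simp add: ennreal_mult ennreal_of_nat_eq_real_of_nat)
  also have "\<dots> = (\<Sum>z\<in>?Z. emeasure lborel {x. quant h x = z})"
    by (intro sum.cong) (auto simp: emeasure_quant_cell assms)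
  also have "\<dots> = emeasure lborel (\<Union>z\<in>?Z. {x. quant h x = z})"
    by (intro sum_emeasure fin) (auto simp: disjoint_family_on_def)
  also have "\<dots> \<le> emeasure lborel (cball (0::'a) ?R)"
    by (intro emeasure_mono sub) simp
  also have "\<dots> = ennreal (unit_ball_vol DIM('a) * ?R ^ DIM('a))"
    using assms by (intro emeasure_cball) auto
  finally have "ennreal (real (card ?Z) * h ^ DIM('a)) \<le> ennreal (unit_ball_vol DIM('a) * ?R ^ DIM('a))" .
  moreover have "0 \<le> unit_ball_vol DIM('a) * ?R ^ DIM('a)"
    using assms by (intro mult_nonneg_nonneg zero_le_power add_nonneg_nonneg) auto
  ultimately show ?thesis using ennreal_le_iff by blast
qed

section \<open>Integer-valued measures\<close>

text \<open>The masses of balls shrinking to a point tend to the mass of that point, which is 0;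
  being integers, they are eventually 0. Lindelof's theorem then covers \<open>A\<close> by
  countably many null pieces. The hypotheses speak of \<open>A \<inter> U\<close> because the
  configurations live on \<open>marked_space\<close> and not on the whole type.\<close>

lemma integer_valued_atoms:
  fixes M :: "'b::{second_countable_topology, metric_space} measure"
  assumes int: "\<And>A. emeasure M A \<in> insert \<infinity> (range of_nat)"
    and sets: "\<And>U. open U \<Longrightarrow> A \<inter> U \<in> sets M"
    and fin: "emeasure M A < \<infinity>"
    and null: "\<And>x. x \<in> A \<Longrightarrow> emeasure M {x} = 0"
  shows "emeasure M A = 0"
proof -
  have "\<exists>U. open U \<and> x \<in> U \<and> emeasure M (A \<inter> U) = 0" if x: "x \<in> A" for x
  proof -
    let ?U = "\<lambda>n. A \<inter> ball x (1 / Suc n)"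
    have "(\<lambda>n. emeasure M (?U n)) \<longlonglongrightarrow> emeasure M (\<Inter>n. ?U n)"
    proof (rule Lim_emeasure_decseq)
      show "decseq ?U"
      proof (rule decseq_SucI)
        fix n
        have "ball x (1 / Suc (Suc n)) \<subseteq> ball x (1 / Suc n)" by (intro subset_ball) (simp add: frac_le)
        then show "?U (Suc n) \<subseteq> ?U n" by blast
      qed
      show "emeasure M (?U n) \<noteq> \<infinity>" for n
        using emeasure_mono[of "?U n" A M] fin sets[of UNIV] by (auto simp: top_unique)
    qed (use sets in auto)
    also have "(\<Inter>n. ?U n) = {x}"
    proof -
      have "y = x" if "\<forall>n. dist x y < 1 / Suc n" for y
      proof (rule ccontr)
        assume "y \<noteq> x"
        then have "0 < dist x y" by simp
        then obtain n where "1 / real (Suc n) < dist x y" by (rule nat_approx_posE)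
        then show False using that[rule_format, of n] by linarith
      qed
      then show ?thesis using x by (auto simp: in_mono)
    qed
    finally have "(\<lambda>n. emeasure M (?U n)) \<longlonglongrightarrow> 0" using null[OF x] by simp
    then have "\<forall>\<^sub>F n in sequentially. emeasure M (?U n) < 1" by (rule order_tendstoD) simp
    then obtain n where n: "emeasure M (?U n) < 1" by (auto simp: eventually_sequentially)
    obtain k :: nat where k: "emeasure M (?U n) = of_nat k" using int[of "?U n"] n by auto
    then have "k = 0" using n by simp
    then have "emeasure M (?U n) = 0" using k by simp
    then show ?thesis by (intro exI[of _ "ball x (1 / Suc n)"]) auto
  qed
  then have "\<forall>x\<in>A. \<exists>U. open U \<and> x \<in> U \<and> emeasure M (A \<inter> U) = 0" by blast
  then have "\<exists>U. \<forall>x\<in>A. open (U x) \<and> x \<in> U x \<and> emeasure M (A \<inter> U x) = 0" by (rule bchoice)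
  then obtain U where "\<forall>x\<in>A. open (U x) \<and> x \<in> U x \<and> emeasure M (A \<inter> U x) = 0" ..
  then have U: "\<And>x. x \<in> A \<Longrightarrow> open (U x)" "\<And>x. x \<in> A \<Longrightarrow> x \<in> U x"
     "\<And>x. x \<in> A \<Longrightarrow> emeasure M (A \<inter> U x) = 0" by simp_all
  obtain F where F: "F \<subseteq> U ` A" "countable F" "\<Union>F = \<Union>(U ` A)"
    using Lindelof[of "U ` A"] U(1) by auto
  have "A = (\<Union>V\<in>F. A \<inter> V)" using F U(2) by auto
  moreover have "emeasure M (\<Union>V\<in>F. A \<inter> V) = 0"
  proof -
    have "(\<Union>V\<in>F. A \<inter> V) \<in> null_sets M"
      by (rule null_sets_UN'[OF F(2)]) (use F(1) U sets in \<open>auto simp: null_sets_def\<close>)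
    then show ?thesis by auto
  qed
  ultimately show ?thesis by simp
qed

lemma finite_atoms:
  assumes int: "\<And>A. emeasure M A \<in> insert \<infinity> (range of_nat)"
    and A: "A \<in> sets M" and fin: "emeasure M A < \<infinity>"
  shows "finite {x \<in> A. emeasure M {x} \<noteq> 0}"
proof (rule ccontr)
  let ?P = "{x \<in> A. emeasure M {x} \<noteq> 0}"
  assume inf: "infinite ?P"
  obtain N where N: "emeasure M A = of_nat N" using int[of A] fin by auto
  obtain S where S: "S \<subseteq> ?P" "finite S" "card S = Suc N"
    using infinite_arbitrarily_large[OF inf] by metis
  have one: "1 \<le> emeasure M {x}" if "x \<in> S" for x
  proof -
    have "emeasure M {x} \<noteq> 0" using that S by auto
    then show ?thesis using int[of "{x}"] by (auto simp: Suc_le_eq)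
  qed
  have "of_nat (Suc N) = (\<Sum>x\<in>S. 1 :: ennreal)" using S by simp
  also have "\<dots> \<le> (\<Sum>x\<in>S. emeasure M {x})" by (intro sum_mono one)
  also have "\<dots> = emeasure M S"
  proof (rule emeasure_eq_sum_singleton[symmetric, OF S(2)])
    fix x assume "x \<in> S"
    then have "emeasure M {x} \<noteq> 0" using S by auto
    then show "{x} \<in> sets M" using emeasure_notin_sets by blast
  qed
  also have "\<dots> \<le> emeasure M A" using S A by (intro emeasure_mono) auto
  finally show False unfolding N by (simp del: of_nat_Suc)
qed

text \<open>There are finitely many atoms, each of mass exactly 1. What remains after their removal
  has no atoms and is null by \<open>integer_valued_atoms\<close>. This is the bridge between
  counting measures and their sets of points.\<close>

lemma integer_valued_eq_card:
  fixes M :: "'b::{second_countable_topology, metric_space} measure"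
  assumes int: "\<And>A. emeasure M A \<in> insert \<infinity> (range of_nat)"
    and sets: "\<And>U. open U \<Longrightarrow> A \<inter> U \<in> sets M"
    and single: "\<And>x. x \<in> A \<Longrightarrow> {x} \<in> sets M"
    and fin: "emeasure M A < \<infinity>"
    and simp: "\<And>x. x \<in> A \<Longrightarrow> emeasure M {x} \<le> 1"
  shows "emeasure M A = of_nat (card {x \<in> A. emeasure M {x} \<noteq> 0})"
proof -
  let ?P = "{x \<in> A. emeasure M {x} \<noteq> 0}"
  have A: "A \<in> sets M" using sets[of UNIV] by simp
  have finP: "finite ?P" by (rule finite_atoms[OF int A fin])
  have Ps: "?P \<in> sets M"
  proof -
    have "?P = (\<Union>x\<in>?P. {x})" by auto
    also have "\<dots> \<in> sets M" by (rule sets.finite_UN[OF finP]) (use single in auto)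
    finally show ?thesis .
  qed
  have one: "emeasure M {x} = 1" if "x \<in> ?P" for x
  proof -
    have "emeasure M {x} \<noteq> 0" "emeasure M {x} \<le> 1" using that simp by auto
    then show ?thesis using int[of "{x}"] by (auto simp: le_Suc_eq top_unique)
  qed
  have "emeasure M (A - ?P) = 0"
  proof (rule integer_valued_atoms[OF int])
    show "(A - ?P) \<inter> U \<in> sets M" if "open U" for U
    proof -
      have "(A - ?P) \<inter> U = (A \<inter> U) - ?P" by auto
      then show ?thesis using sets[OF that] Ps by auto
    qed
    show "emeasure M (A - ?P) < \<infinity>"
      using emeasure_mono[of "A - ?P" A M] A fin by (auto intro: order_le_less_trans)
  qed auto
  then have "A - ?P \<in> null_sets M" using A Ps by auto
  then have "emeasure M (?P \<union> (A - ?P)) = emeasure M ?P"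
    by (rule emeasure_Un_null_set[OF Ps])
  moreover have "?P \<union> (A - ?P) = A" by auto
  ultimately have "emeasure M A = emeasure M ?P" by simp
  also have "\<dots> = (\<Sum>x\<in>?P. emeasure M {x})"
    by (rule emeasure_eq_sum_singleton[OF finP]) (use single in auto)
  also have "\<dots> = (\<Sum>x\<in>?P. 1)" by (intro sum.cong one refl)
  finally show ?thesis by simp
qed

section \<open>Discrete random variables\<close>

lemma discrete_expectation_approx:
  fixes g :: "'k \<Rightarrow> real"
  assumes "prob_space P" and N: "N \<in> P \<rightarrow>\<^sub>M count_space V" and S: "finite S" "S \<subseteq> V"
    and g: "\<And>k. \<bar>g k\<bar> \<le> B"
  shows "\<bar>(\<integral>\<omega>. g (N \<omega>) \<partial>P) - (\<Sum>k\<in>S. g k * measure P {\<omega>\<in>space P. N \<omega> = k})\<bar>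
     \<le> B * (1 - (\<Sum>k\<in>S. measure P {\<omega>\<in>space P. N \<omega> = k}))"
proof -
  interpret prob_space P by fact
  let ?C = "\<lambda>k. {\<omega>\<in>space P. N \<omega> = k}"
  have C: "?C k \<in> sets P" if "k \<in> S" for k
  proof -
    have "N -` {k} \<inter> space P \<in> sets P"
      by (rule measurable_sets[OF N]) (use that S in auto)
    also have "N -` {k} \<inter> space P = ?C k" by auto
    finally show ?thesis .
  qed
  have gN: "(\<lambda>\<omega>. g (N \<omega>)) \<in> borel_measurable P"
    by (rule measurable_compose[OF N]) simp
  have gi: "integrable P (\<lambda>\<omega>. g (N \<omega>))"
    by (rule integrable_const_bound[of _ B]) (use gN g in auto)
  have ind: "integrable P (indicator (?C k) :: _ \<Rightarrow> real)" if "k \<in> S" for k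
    using C[OF that] by (simp add: integrable_indicator_iff emeasure_eq_measure)
  let ?s = "\<lambda>\<omega>. \<Sum>k\<in>S. g k * indicator (?C k) \<omega>"
  let ?t = "\<lambda>\<omega>. \<Sum>k\<in>S. indicator (?C k) \<omega> :: real"
  have si: "integrable P ?s" by (intro Bochner_Integration.integrable_sum integrable_mult_right ind)
  have ti: "integrable P ?t" by (intro Bochner_Integration.integrable_sum ind)
  have s: "(\<integral>\<omega>. ?s \<omega> \<partial>P) = (\<Sum>k\<in>S. g k * measure P (?C k))"
    using ind C by (subst Bochner_Integration.integral_sum) auto
  have t: "(\<integral>\<omega>. ?t \<omega> \<partial>P) = (\<Sum>k\<in>S. measure P (?C k))"
    using ind C by (subst Bochner_Integration.integral_sum) auto
  have "\<bar>(\<integral>\<omega>. g (N \<omega>) \<partial>P) - (\<integral>\<omega>. ?s \<omega> \<partial>P)\<bar> = norm (\<integral>\<omega>. g (N \<omega>) - ?s \<omega> \<partial>P)"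
    using gi si by simp
  also have "\<dots> \<le> (\<integral>\<omega>. norm (g (N \<omega>) - ?s \<omega>) \<partial>P)" by (rule integral_norm_bound)
  also have "\<dots> \<le> (\<integral>\<omega>. B * (1 - ?t \<omega>) \<partial>P)"
  proof (rule integral_mono)
    fix \<omega> assume w: "\<omega> \<in> space P"
    have i: "indicator (?C k) \<omega> = (if k = N \<omega> then 1 else 0 :: real)" for k
      using w by (auto simp: indicator_def)
    have "?s \<omega> = (\<Sum>k\<in>S. if k = N \<omega> then g k else 0)" by (intro sum.cong) (auto simp: i)
    then have "?s \<omega> = (if N \<omega> \<in> S then g (N \<omega>) else 0)" using S by simp
    moreover have "?t \<omega> = (if N \<omega> \<in> S then 1 else 0)" using S by (simp add: i)
    ultimately show "norm (g (N \<omega>) - ?s \<omega>) \<le> B * (1 - ?t \<omega>)" using g[of "N \<omega>"] by simp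
  qed (use gi si ti in \<open>auto intro!: integrable_norm integrable_mult_right Bochner_Integration.integrable_diff\<close>)
  also have "\<dots> = B * (1 - (\<Sum>k\<in>S. measure P (?C k)))"
    using ti t by (simp add: prob_space)
  finally show ?thesis by (simp only: s)
qed

lemma discrete_finite_mass:
  assumes "prob_space P" and N: "N \<in> P \<rightarrow>\<^sub>M count_space V" and V: "countable V" and "0 < e"
  obtains S where "finite S" "S \<subseteq> V" "1 - e < (\<Sum>k\<in>S. measure P {\<omega>\<in>space P. N \<omega> = k})"
proof -
  interpret prob_space P by fact
  obtain w where w: "w \<in> space P" using not_empty by blast
  have V0: "V \<noteq> {}" using measurable_space[OF N w] by auto
  let ?S = "\<lambda>n. from_nat_into V ` {..n::nat}"
  have SV: "?S n \<subseteq> V" for n using V0 by (auto intro: from_nat_into)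
  have meas: "N -` A \<inter> space P \<in> sets P" if "A \<subseteq> V" for A
    by (rule measurable_sets[OF N]) (use that in auto)
  have "(\<lambda>n. measure P (N -` ?S n \<inter> space P)) \<longlonglongrightarrow> measure P (\<Union>n. N -` ?S n \<inter> space P)"
  proof (rule finite_Lim_measure_incseq)
    show "range (\<lambda>n. N -` ?S n \<inter> space P) \<subseteq> sets P" using meas SV by auto
    show "incseq (\<lambda>n. N -` ?S n \<inter> space P)" by (auto simp: incseq_def)
  qed
  also have "(\<Union>n. N -` ?S n \<inter> space P) = space P"
  proof safe
    fix x assume x: "x \<in> space P"
    then have "N x \<in> V" using N by (auto dest: measurable_space)
    then obtain n where "N x = from_nat_into V n" using from_nat_into_surj[OF V] by metis
    then show "x \<in> (\<Union>n. N -` ?S n \<inter> space P)" using x by auto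
  qed
  finally have "(\<lambda>n. measure P (N -` ?S n \<inter> space P)) \<longlonglongrightarrow> 1" by (simp add: prob_space)
  then have "\<forall>\<^sub>F n in sequentially. 1 - e < measure P (N -` ?S n \<inter> space P)"
    by (rule order_tendstoD) (use \<open>0 < e\<close> in simp)
  then obtain n where n: "1 - e < measure P (N -` ?S n \<inter> space P)"
    by (auto simp: eventually_sequentially)
  have "N -` ?S n \<inter> space P = (\<Union>k\<in>?S n. {\<omega>\<in>space P. N \<omega> = k})" by auto
  also have "measure P \<dots> = (\<Sum>k\<in>?S n. measure P {\<omega>\<in>space P. N \<omega> = k})"
  proof (rule finite_measure_finite_Union)
    have "{\<omega>\<in>space P. N \<omega> = k} = N -` {k} \<inter> space P" for k by auto
    then show "(\<lambda>k. {\<omega>\<in>space P. N \<omega> = k}) ` ?S n \<subseteq> sets P" using meas SV[of n] by auto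
    show "disjoint_family_on (\<lambda>k. {\<omega>\<in>space P. N \<omega> = k}) (?S n)" by (auto simp: disjoint_family_on_def)
  qed simp
  finally show ?thesis using that[of "?S n"] SV n by auto
qed

text \<open>Tightness comes for free, as in Scheffe's lemma: the limit law has total mass 1, so a
  finite set carrying nearly all of it eventually carries nearly all the mass of \<open>N i\<close>.
  Pointwise convergence on that set finishes the argument for every bounded
  \<open>g\<close>.\<close>

lemma discrete_convergence:
  fixes g :: "'k \<Rightarrow> real"
  assumes P: "prob_space P" and P': "prob_space P'" and V: "countable V"
    and N': "N' \<in> P' \<rightarrow>\<^sub>M count_space V" and N: "\<forall>\<^sub>F i in F. N i \<in> P \<rightarrow>\<^sub>M count_space V"
    and lim: "\<And>k. k \<in> V \<Longrightarrow> ((\<lambda>i. measure P {\<omega>\<in>space P. N i \<omega> = k}) \<longlongrightarrow>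
        measure P' {\<omega>\<in>space P'. N' \<omega> = k}) F"
    and g: "\<And>k. \<bar>g k\<bar> \<le> B"
  shows "((\<lambda>i. \<integral>\<omega>. g (N i \<omega>) \<partial>P) \<longlongrightarrow> (\<integral>\<omega>. g (N' \<omega>) \<partial>P')) F"
proof (rule tendstoI)
  fix e :: real assume e: "0 < e"
  have B: "0 \<le> B" using g[of undefined] by linarith
  \<comment> \<open>Each truncation error is at most \<open>B * d\<close>, hence at most
    \<open>e / 4\<close>; the finite sums contribute the remaining \<open>e / 2\<close>. The summand
    1 covers \<open>B = 0\<close>.\<close>
  define d where "d = e / (4 * (B + 1))"
  have d: "0 < d" using e B by (simp add: d_def)
  obtain S where S: "finite S" "S \<subseteq> V" "1 - d < (\<Sum>k\<in>S. measure P' {\<omega>\<in>space P'. N' \<omega> = k})"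
    by (rule discrete_finite_mass[OF P' N' V d])
  let ?p = "\<lambda>i k. measure P {\<omega>\<in>space P. N i \<omega> = k}"
  let ?q = "\<lambda>k. measure P' {\<omega>\<in>space P'. N' \<omega> = k}"
  have "((\<lambda>i. \<Sum>k\<in>S. ?p i k) \<longlongrightarrow> (\<Sum>k\<in>S. ?q k)) F"
    by (intro tendsto_sum lim) (use S in auto)
  then have e1: "\<forall>\<^sub>F i in F. 1 - d < (\<Sum>k\<in>S. ?p i k)" by (rule order_tendstoD) (use S in simp)
  have "((\<lambda>i. \<Sum>k\<in>S. g k * ?p i k) \<longlongrightarrow> (\<Sum>k\<in>S. g k * ?q k)) F"
    by (intro tendsto_sum tendsto_mult tendsto_const lim) (use S in auto)
  then have e2: "\<forall>\<^sub>F i in F. dist (\<Sum>k\<in>S. g k * ?p i k) (\<Sum>k\<in>S. g k * ?q k) < e / 2"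
    by (rule tendstoD) (use e in simp)
  from N e1 e2 show "\<forall>\<^sub>F i in F. dist (\<integral>\<omega>. g (N i \<omega>) \<partial>P) (\<integral>\<omega>. g (N' \<omega>) \<partial>P') < e"
  proof eventually_elim
    case (elim i)
    have a: "\<bar>(\<integral>\<omega>. g (N i \<omega>) \<partial>P) - (\<Sum>k\<in>S. g k * ?p i k)\<bar> \<le> B * (1 - (\<Sum>k\<in>S. ?p i k))"
      by (rule discrete_expectation_approx[OF P elim(1) S(1,2) g])
    have b: "\<bar>(\<integral>\<omega>. g (N' \<omega>) \<partial>P') - (\<Sum>k\<in>S. g k * ?q k)\<bar> \<le> B * (1 - (\<Sum>k\<in>S. ?q k))"
      by (rule discrete_expectation_approx[OF P' N' S(1,2) g])
    have "B * (1 - (\<Sum>k\<in>S. ?p i k)) \<le> B * d" "B * (1 - (\<Sum>k\<in>S. ?q k)) \<le> B * d"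
      using elim S B by (auto intro!: mult_left_mono)
    moreover have "B * d \<le> e / 4" using e B by (simp add: d_def field_simps)
    ultimately show ?case using a b elim(3) unfolding dist_real_def by linarith
  qed
qed

lemma restrict_eq_iff:
  "k \<in> Z \<rightarrow>\<^sub>E V \<Longrightarrow> (\<lambda>z\<in>Z. f z) = k \<longleftrightarrow> (\<forall>z\<in>Z. f z = k z)"
  by (auto simp: fun_eq_iff restrict_def PiE_iff extensional_def)

lemma counts_vector_measurable:
  assumes Z: "finite Z" and f: "\<And>z. z \<in> Z \<Longrightarrow> f z \<in> borel_measurable P"
    and range: "\<And>z \<omega>. z \<in> Z \<Longrightarrow> \<omega> \<in> space P \<Longrightarrow> f z \<omega> \<in> insert \<infinity> (range (of_nat :: nat \<Rightarrow> ennreal))"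
  shows "(\<lambda>\<omega>. \<lambda>z\<in>Z. f z \<omega>) \<in> P \<rightarrow>\<^sub>M count_space (Z \<rightarrow>\<^sub>E insert \<infinity> (range of_nat))"
proof -
  let ?V = "Z \<rightarrow>\<^sub>E insert \<infinity> (range (of_nat :: nat \<Rightarrow> ennreal))"
  have V: "countable ?V" using Z by (intro countable_PiE) auto
  have "(\<lambda>\<omega>. \<lambda>z\<in>Z. f z \<omega>) \<in> space P \<rightarrow> ?V"
    using range by (simp add: PiE_iff Pi_iff)
  moreover have "(\<lambda>\<omega>. \<lambda>z\<in>Z. f z \<omega>) -` {k} \<inter> space P \<in> sets P" if k: "k \<in> ?V" for k
  proof -
    have "{\<omega>\<in>space P. f z \<omega> = k z} \<in> sets P" if "z \<in> Z" for z
      using measurable_sets[OF f[OF that], of "{k z}"] by (simp add: vimage_def Int_def conj_commute)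
    then have "{\<omega>\<in>space P. \<forall>z\<in>Z. f z \<omega> = k z} \<in> sets P"
      by (rule sets.sets_Collect_finite_All[OF _ Z])
    moreover have "(\<lambda>\<omega>. \<lambda>z\<in>Z. f z \<omega>) -` {k} \<inter> space P = {\<omega>\<in>space P. \<forall>z\<in>Z. f z \<omega> = k z}"
      using restrict_eq_iff[OF k] by auto
    ultimately show ?thesis by simp
  qed
  ultimately show ?thesis
    unfolding measurable_count_space_eq_countable[OF V] by blast
qed

section \<open>Counts of a Poisson process\<close>

locale poisson =
  fixes P :: "'w measure" and E :: "'e topology" and \<mu> :: "'e measure" and X :: "'w \<Rightarrow> 'e measure"
  assumes poisson: "poisson_process P E \<mu> X"
begin

sublocale prob_space P using poisson by (simp add: poisson_process_def)

lemma counting_measure: "\<omega> \<in> space P \<Longrightarrow> X \<omega> \<in> locally_finite_counting_measures E"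
  using poisson measurable_space[of X P "borel_of (vague_topology E)"]
  by (simp add: poisson_process_def topspace_vague_topology)

lemma indep_counts:
  assumes "finite (I :: nat set)" "disjoint_family_on A I" "A ` I \<subseteq> sets (borel_of E)"
  shows "indep_vars (\<lambda>_. borel) (\<lambda>i \<omega>. emeasure (X \<omega>) (A i)) I"
proof -
  have "\<forall>(I::nat set) A. finite I \<and> disjoint_family_on A I \<and> A ` I \<subseteq> sets (borel_of E) \<longrightarrow>
        indep_vars (\<lambda>_. borel) (\<lambda>i \<omega>. emeasure (X \<omega>) (A i)) I"
    using poisson unfolding poisson_process_def by (elim conjE)
  from this[rule_format, of I A] show ?thesis using assms by blast
qed

lemma count_measurable:
  assumes A: "A \<in> sets (borel_of E)"
  shows "(\<lambda>\<omega>. emeasure (X \<omega>) A) \<in> borel_measurable P"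
proof -
  \<comment> \<open>Measurability of a single count is read off from the independence clause for a
    one-element family.\<close>
  have "indep_vars (\<lambda>_. borel) (\<lambda>i \<omega>. emeasure (X \<omega>) A) {0::nat}"
    by (rule indep_counts) (use A in \<open>auto simp: disjoint_family_on_def\<close>)
  then show ?thesis by (auto simp: indep_vars_def2)
qed

lemma count_event [measurable]:
  assumes "A \<in> sets (borel_of E)"
  shows "{\<omega>\<in>space P. emeasure (X \<omega>) A = c} \<in> sets P"
  using measurable_sets[OF count_measurable[OF assms], of "{c}"]
  by (simp add: vimage_def Int_def conj_commute)

lemma count_eq:
  assumes "A \<in> sets (borel_of E)" "emeasure \<mu> A < \<infinity>"
  shows "prob {\<omega>\<in>space P. emeasure (X \<omega>) A = of_nat k} = measure \<mu> A ^ k / fact k * exp (- measure \<mu> A)"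
proof -
  have *: "\<forall>A\<in>sets (borel_of E).
        (if emeasure \<mu> A = \<infinity> then AE \<omega> in P. emeasure (X \<omega>) A = \<infinity>
         else \<forall>k::nat. prob {\<omega>\<in>space P. emeasure (X \<omega>) A = of_nat k} =
                measure \<mu> A ^ k / fact k * exp (- measure \<mu> A))"
    using poisson unfolding poisson_process_def by (elim conjE)
  show ?thesis using bspec[OF * assms(1)] assms(2) by (simp split: if_split_asm)
qed

text \<open>The Poisson weights already sum to 1, which leaves no mass for the value
  \<infinity>.\<close>

lemma count_finite:
  assumes A: "A \<in> sets (borel_of E)" "emeasure \<mu> A < \<infinity>"
  shows "AE \<omega> in P. emeasure (X \<omega>) A < \<infinity>"
proof -
  let ?C = "\<lambda>k::nat. {\<omega>\<in>space P. emeasure (X \<omega>) A = of_nat k}"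
  have "(\<lambda>k. prob (?C k)) sums prob (\<Union>k. ?C k)"
    by (rule finite_measure_UNION) (use count_event[OF A(1)] in \<open>auto simp: disjoint_family_on_def\<close>)
  moreover have "(\<lambda>k. prob (?C k)) sums (exp (measure \<mu> A) * exp (- measure \<mu> A))"
    unfolding count_eq[OF A]
    using sums_mult2[OF exp_converges[of "measure \<mu> A"], of "exp (- measure \<mu> A)"]
    by (simp add: divide_inverse mult.commute)
  ultimately have "prob (\<Union>k. ?C k) = exp (measure \<mu> A) * exp (- measure \<mu> A)" by (rule sums_unique2)
  then have "prob (\<Union>k. ?C k) = 1" by (simp add: exp_minus)
  then have "AE \<omega> in P. \<omega> \<in> (\<Union>k. ?C k)" by (rule AE_prob_1)
  then show ?thesis by eventually_elim (auto simp: of_nat_less_top)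
qed

lemma count_zero:
  assumes "A \<in> sets (borel_of E)" "emeasure \<mu> A < \<infinity>"
  shows "prob {\<omega>\<in>space P. emeasure (X \<omega>) A = 0} = exp (- measure \<mu> A)"
  using count_eq[OF assms, of 0] by simp

lemma count_nonzero_le:
  assumes A: "A \<in> sets (borel_of E)" "emeasure \<mu> A < \<infinity>"
  shows "prob {\<omega>\<in>space P. emeasure (X \<omega>) A \<noteq> 0} \<le> measure \<mu> A"
proof -
  have "{\<omega>\<in>space P. emeasure (X \<omega>) A \<noteq> 0} = space P - {\<omega>\<in>space P. emeasure (X \<omega>) A = 0}" by auto
  then have "prob {\<omega>\<in>space P. emeasure (X \<omega>) A \<noteq> 0} = 1 - exp (- measure \<mu> A)"
    using prob_compl[OF count_event[OF A(1), of 0]] count_zero[OF A] by simp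
  then show ?thesis using exp_ge_add_one_self[of "- measure \<mu> A"] by simp
qed

lemma count_null:
  assumes A: "A \<in> sets (borel_of E)" "emeasure \<mu> A = 0"
  shows "AE \<omega> in P. emeasure (X \<omega>) A = 0"
proof -
  have "prob {\<omega>\<in>space P. emeasure (X \<omega>) A = 0} = 1"
    using count_zero[OF A(1)] A(2) by (simp add: measure_def)
  then have "AE \<omega> in P. \<omega> \<in> {\<omega>\<in>space P. emeasure (X \<omega>) A = 0}" by (rule AE_prob_1)
  then show ?thesis by eventually_elim auto
qed

text \<open>The square is what matters: a union bound over about h^(-d) cells of mass of order h^d
  still leaves a factor h^d. It yields simplicity of the process and the absence of close pairs of
  large marks.\<close>

lemma count_multiple_le:
  assumes A: "A \<in> sets (borel_of E)" "emeasure \<mu> A < \<infinity>"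
  shows "prob {\<omega>\<in>space P. emeasure (X \<omega>) A \<notin> {0, 1}} \<le> (measure \<mu> A)\<^sup>2"
proof -
  let ?m = "measure \<mu> A"
  have "{\<omega>\<in>space P. emeasure (X \<omega>) A \<notin> {0, 1}} = space P -
     ({\<omega>\<in>space P. emeasure (X \<omega>) A = 0} \<union> {\<omega>\<in>space P. emeasure (X \<omega>) A = 1})" by auto
  also have "prob \<dots> = 1 - prob ({\<omega>\<in>space P. emeasure (X \<omega>) A = 0} \<union> {\<omega>\<in>space P. emeasure (X \<omega>) A = 1})"
    by (intro prob_compl sets.Un count_event A)
  also have "prob ({\<omega>\<in>space P. emeasure (X \<omega>) A = 0} \<union> {\<omega>\<in>space P. emeasure (X \<omega>) A = 1}) =
     prob {\<omega>\<in>space P. emeasure (X \<omega>) A = 0} + prob {\<omega>\<in>space P. emeasure (X \<omega>) A = 1}"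
    by (intro finite_measure_Union count_event A) auto
  also have "\<dots> = exp (- ?m) + ?m * exp (- ?m)"
    using count_eq[OF A, of 0] count_eq[OF A, of 1] by simp
  also have "1 - (exp (- ?m) + ?m * exp (- ?m)) = 1 - (1 + ?m) * exp (- ?m)" by (simp add: algebra_simps)
  also have "\<dots> \<le> 1 - (1 + ?m) * (1 - ?m)"
    using exp_ge_add_one_self[of "- ?m"] by (auto intro!: mult_left_mono)
  also have "\<dots> = ?m\<^sup>2" by (simp add: power2_eq_square algebra_simps)
  finally show ?thesis .
qed

lemma count_vector_event:
  assumes "finite Z" "\<And>z. z \<in> Z \<Longrightarrow> A z \<in> sets (borel_of E)"
  shows "{\<omega>\<in>space P. \<forall>z\<in>Z. emeasure (X \<omega>) (A z) = k z} \<in> sets P"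
  by (rule sets.sets_Collect_finite_All'[OF _ assms(1)] sets.sets_Collect_finite_All[OF _ assms(1)])
    (use assms(2) in \<open>auto intro: count_event\<close>)

lemma count_vector_measurable:
  assumes "finite Z" "\<And>z. z \<in> Z \<Longrightarrow> A z \<in> sets (borel_of E)"
  shows "(\<lambda>\<omega>. \<lambda>z\<in>Z. emeasure (X \<omega>) (A z)) \<in> P \<rightarrow>\<^sub>M count_space (Z \<rightarrow>\<^sub>E insert \<infinity> (range of_nat))"
  by (rule counts_vector_measurable[OF assms(1) count_measurable[OF assms(2)] counting_measureD(3)[OF counting_measure]])

lemma count_vector_eq:
  assumes Z: "finite Z" and A: "\<And>z. z \<in> Z \<Longrightarrow> A z \<in> sets (borel_of E)"
    "\<And>z. z \<in> Z \<Longrightarrow> emeasure \<mu> (A z) < \<infinity>" and disj: "disjoint_family_on A Z"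
  shows "prob {\<omega>\<in>space P. \<forall>z\<in>Z. emeasure (X \<omega>) (A z) = of_nat (k z)} =
      (\<Prod>z\<in>Z. measure \<mu> (A z) ^ k z / fact (k z) * exp (- measure \<mu> (A z)))"
proof (cases "Z = {}")
  case True
  then show ?thesis by (simp add: prob_space)
next
  case False
  \<comment> \<open>The independence clause is stated for families indexed by natural numbers, so
    \<open>Z\<close> is enumerated.\<close>
  obtain h where h: "bij_betw h {0..<card Z} Z" using ex_bij_betw_nat_finite[OF Z] by blast
  let ?I = "{0..<card Z}"
  have hZ: "h i \<in> Z" if "i \<in> ?I" for i using h that by (auto simp: bij_betw_def)
  have "disjoint_family_on (\<lambda>i. A (h i)) ?I"
    unfolding disjoint_family_on_def
  proof (intro ballI impI)
    fix i j assume ij: "i \<in> ?I" "j \<in> ?I" "i \<noteq> j"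
    then have "h i \<noteq> h j" using h by (auto simp: bij_betw_def inj_on_def)
    then show "A (h i) \<inter> A (h j) = {}" using disj hZ ij by (auto simp: disjoint_family_on_def)
  qed
  then have "indep_vars (\<lambda>_. borel) (\<lambda>i \<omega>. emeasure (X \<omega>) (A (h i))) ?I"
    by (intro indep_counts) (use A(1) hZ in auto)
  then have "prob (\<Inter>i\<in>?I. (\<lambda>\<omega>. emeasure (X \<omega>) (A (h i))) -` {of_nat (k (h i))} \<inter> space P) =
     (\<Prod>i\<in>?I. prob ((\<lambda>\<omega>. emeasure (X \<omega>) (A (h i))) -` {of_nat (k (h i))} \<inter> space P))"
    by (rule indep_varsD_finite) (use False Z in \<open>auto simp: card_gt_0_iff\<close>)
  also have "(\<Inter>i\<in>?I. (\<lambda>\<omega>. emeasure (X \<omega>) (A (h i))) -` {of_nat (k (h i))} \<inter> space P) =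
     {\<omega>\<in>space P. \<forall>z\<in>h ` ?I. emeasure (X \<omega>) (A z) = of_nat (k z)}"
    using False Z by (auto simp: card_gt_0_iff)
  also have "h ` ?I = Z" using h by (auto simp: bij_betw_def)
  also have "(\<Prod>i\<in>?I. prob ((\<lambda>\<omega>. emeasure (X \<omega>) (A (h i))) -` {of_nat (k (h i))} \<inter> space P)) =
     (\<Prod>i\<in>?I. measure \<mu> (A (h i)) ^ k (h i) / fact (k (h i)) * exp (- measure \<mu> (A (h i))))"
  proof (intro prod.cong refl)
    fix i assume i: "i \<in> ?I"
    have "(\<lambda>\<omega>. emeasure (X \<omega>) (A (h i))) -` {of_nat (k (h i))} \<inter> space P =
      {\<omega>\<in>space P. emeasure (X \<omega>) (A (h i)) = of_nat (k (h i))}" by auto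
    then show "prob ((\<lambda>\<omega>. emeasure (X \<omega>) (A (h i))) -` {of_nat (k (h i))} \<inter> space P) =
       measure \<mu> (A (h i)) ^ k (h i) / fact (k (h i)) * exp (- measure \<mu> (A (h i)))"
      using count_eq A hZ[OF i] by simp
  qed
  also have "\<dots> = (\<Prod>z\<in>Z. measure \<mu> (A z) ^ k z / fact (k z) * exp (- measure \<mu> (A z)))"
    by (rule prod.reindex_bij_betw[OF h])
  finally show ?thesis .
qed

lemma count_vector_infinite:
  assumes Z: "finite Z" and A: "\<And>z. z \<in> Z \<Longrightarrow> A z \<in> sets (borel_of E)"
    "\<And>z. z \<in> Z \<Longrightarrow> emeasure \<mu> (A z) < \<infinity>" and z: "z \<in> Z" "k z = \<infinity>"
  shows "prob {\<omega>\<in>space P. \<forall>z\<in>Z. emeasure (X \<omega>) (A z) = k z} = 0"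
proof -
  have "AE \<omega> in P. \<omega> \<notin> {\<omega>\<in>space P. \<forall>z\<in>Z. emeasure (X \<omega>) (A z) = k z}"
    using count_finite[OF A(1,2)[OF z(1)]] by eventually_elim (use z in force)
  moreover have "{\<omega>\<in>space P. \<forall>z\<in>Z. emeasure (X \<omega>) (A z) = k z} \<in> sets P"
    by (rule count_vector_event[OF Z, where A = A, OF A(1)])
  ultimately show ?thesis by (simp only: prob_eq_0)
qed

end

text \<open>Independence over disjoint cells makes the law of the count vector a product of Poisson
  weights, which is continuous in the cell intensities. Vectors with an infinite entry have
  probability 0 on both sides.\<close>

lemma poisson_count_vector_convergence:
  fixes g :: "('z \<Rightarrow> ennreal) \<Rightarrow> real"
  assumes "poisson_process P E \<mu> X" "poisson_process P' E' \<mu>' X'"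
    and Z: "finite Z"
    and A: "\<And>i z. z \<in> Z \<Longrightarrow> A i z \<in> sets (borel_of E)" "\<And>i z. z \<in> Z \<Longrightarrow> emeasure \<mu> (A i z) < \<infinity>"
      "\<And>i. disjoint_family_on (A i) Z"
    and C: "\<And>z. z \<in> Z \<Longrightarrow> C z \<in> sets (borel_of E')" "\<And>z. z \<in> Z \<Longrightarrow> emeasure \<mu>' (C z) < \<infinity>"
      "disjoint_family_on C Z"
    and lim: "\<And>z. z \<in> Z \<Longrightarrow> ((\<lambda>i. measure \<mu> (A i z)) \<longlongrightarrow> measure \<mu>' (C z)) F"
    and g: "\<And>k. \<bar>g k\<bar> \<le> B"
  shows "((\<lambda>i. \<integral>\<omega>. g (\<lambda>z\<in>Z. emeasure (X \<omega>) (A i z)) \<partial>P) \<longlongrightarrow>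
     (\<integral>\<omega>. g (\<lambda>z\<in>Z. emeasure (X' \<omega>) (C z)) \<partial>P')) F"
proof -
  interpret X: poisson P E \<mu> X by unfold_locales fact
  interpret X': poisson P' E' \<mu>' X' by unfold_locales fact
  let ?V = "Z \<rightarrow>\<^sub>E insert \<infinity> (range (of_nat :: nat \<Rightarrow> ennreal))"
  show ?thesis
  proof (rule discrete_convergence[OF X.prob_space_axioms X'.prob_space_axioms, where V = ?V and g = g
        and N = "\<lambda>i \<omega>. \<lambda>z\<in>Z. emeasure (X \<omega>) (A i z)" and N' = "\<lambda>\<omega>. \<lambda>z\<in>Z. emeasure (X' \<omega>) (C z)"])
    show "countable ?V" using Z by (intro countable_PiE) auto
    show "(\<lambda>\<omega>. \<lambda>z\<in>Z. emeasure (X' \<omega>) (C z)) \<in> P' \<rightarrow>\<^sub>M count_space ?V"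
      by (rule X'.count_vector_measurable[OF Z C(1)])
    show "\<forall>\<^sub>F i in F. (\<lambda>\<omega>. \<lambda>z\<in>Z. emeasure (X \<omega>) (A i z)) \<in> P \<rightarrow>\<^sub>M count_space ?V"
      by (intro always_eventually allI X.count_vector_measurable[OF Z A(1)])
    fix k assume k: "k \<in> ?V"
    note eq = restrict_eq_iff[OF k]
    show "((\<lambda>i. X.prob {\<omega>\<in>space P. (\<lambda>z\<in>Z. emeasure (X \<omega>) (A i z)) = k}) \<longlongrightarrow>
       X'.prob {\<omega>\<in>space P'. (\<lambda>z\<in>Z. emeasure (X' \<omega>) (C z)) = k}) F"
    proof (cases "\<exists>z\<in>Z. k z = \<infinity>")
      case True
      then obtain z where z: "z \<in> Z" "k z = \<infinity>" by blast
      show ?thesis unfolding eq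
        by (simp only: X'.count_vector_infinite[where k = k and A = C and Z = Z and z = z, OF Z C(1,2) z]
            X.count_vector_infinite[where k = k and Z = Z and z = z and A = "A i" for i, OF Z A(1,2) z] tendsto_const)
    next
      case False
      have "\<exists>l. \<forall>z\<in>Z. k z = of_nat (l z)"
        by (rule bchoice) (use False k in \<open>auto simp: PiE_iff\<close>)
      then obtain l where l: "\<And>z. z \<in> Z \<Longrightarrow> k z = of_nat (l z)" by blast
      have eq2: "(\<forall>z\<in>Z. f z = k z) \<longleftrightarrow> (\<forall>z\<in>Z. f z = of_nat (l z))" for f :: "'z \<Rightarrow> ennreal"
        using l by auto
      have p1: "X.prob {\<omega>\<in>space P. \<forall>z\<in>Z. emeasure (X \<omega>) (A i z) = of_nat (l z)} =
          (\<Prod>z\<in>Z. measure \<mu> (A i z) ^ l z / fact (l z) * exp (- measure \<mu> (A i z)))" for i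
        by (rule X.count_vector_eq[OF Z A])
      have p2: "X'.prob {\<omega>\<in>space P'. \<forall>z\<in>Z. emeasure (X' \<omega>) (C z) = of_nat (l z)} =
          (\<Prod>z\<in>Z. measure \<mu>' (C z) ^ l z / fact (l z) * exp (- measure \<mu>' (C z)))"
        by (rule X'.count_vector_eq[OF Z C])
      show ?thesis
        unfolding eq eq2 p1 p2
        by (intro tendsto_prod tendsto_mult tendsto_divide tendsto_power tendsto_exp tendsto_minus
            tendsto_const lim) auto
    qed
  qed (rule g)
qed

section \<open>Regularly varying tails\<close>

locale regular_tail = prob_space Q for Q :: "real measure" +
  fixes \<alpha> :: real
  assumes sets_Q: "sets Q = sets (restrict_space borel {0..})"
    and regular: "regularly_varying_tail Q \<alpha>" and alpha_pos: "0 < \<alpha>"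
begin

definition tail :: "real \<Rightarrow> real" where
  "tail u = measure Q {u<..}"

lemma space_Q: "space Q = {0..}"
  using sets_eq_imp_space_eq[OF sets_Q] by (simp add: space_restrict_space)

lemma sets_QI: "A \<in> sets borel \<Longrightarrow> A \<subseteq> {0..} \<Longrightarrow> A \<in> sets Q"
  unfolding sets_Q by (auto simp: sets_restrict_space intro!: image_eqI[of _ _ A])

lemma tail_sets: "0 \<le> u \<Longrightarrow> {u<..} \<in> sets Q"
  by (rule sets_QI) auto

lemma tail_antimono: "0 \<le> u \<Longrightarrow> u \<le> v \<Longrightarrow> tail v \<le> tail u"
  unfolding tail_def by (intro finite_measure_mono tail_sets) auto

text \<open>Slow variation with factor 1 says that \<open>l v / l v\<close> tends to 1. Since
  division by 0 gives 0, this forces \<open>l v\<close> to be nonzero for arbitrarily large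
  \<open>v\<close>, and monotonicity carries positivity down to \<open>u\<close>.\<close>

lemma tail_pos:
  assumes "0 < u"
  shows "0 < tail u"
proof -
  obtain l where l: "slowly_varying l" "\<And>u. u > 0 \<Longrightarrow> tail u = l u * u powr (- \<alpha>)" "\<And>u. u > 0 \<Longrightarrow> 0 \<le> l u"
    using regular unfolding regularly_varying_tail_def tail_def by blast
  have "((\<lambda>v. l (1 * v) / l v) \<longlongrightarrow> 1) at_top"
    using l(1) unfolding slowly_varying_def by (elim allE[of _ 1]) simp
  then have "\<forall>\<^sub>F v in at_top. l (1 * v) / l v > 0" by (rule order_tendstoD) simp
  moreover have "\<forall>\<^sub>F v in at_top. u \<le> v" by (rule eventually_ge_at_top)
  ultimately have "\<forall>\<^sub>F v in at_top. u \<le> v \<and> l v \<noteq> 0" by eventually_elim auto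
  then obtain v where v: "u \<le> v" "l v \<noteq> 0" by (auto simp: eventually_at_top_linorder)
  then have "0 < tail v" using l(2)[of v] l(3)[of v] assms by simp
  also have "tail v \<le> tail u" by (rule tail_antimono) (use v assms in auto)
  finally show ?thesis .
qed

lemma tail_ratio:
  assumes "0 < c"
  shows "((\<lambda>v. tail (c * v) / tail v) \<longlongrightarrow> c powr (- \<alpha>)) at_top"
proof -
  obtain l where l: "slowly_varying l" "\<And>u. u > 0 \<Longrightarrow> tail u = l u * u powr (- \<alpha>)"
    using regular unfolding regularly_varying_tail_def tail_def by blast
  have "((\<lambda>v. l (c * v) / l v * c powr (- \<alpha>)) \<longlongrightarrow> 1 * c powr (- \<alpha>)) at_top"
    using l(1) assms unfolding slowly_varying_def by (intro tendsto_mult tendsto_const) auto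
  moreover have "\<forall>\<^sub>F v in at_top. l (c * v) / l v * c powr (- \<alpha>) = tail (c * v) / tail v"
    using eventually_gt_at_top[of 0]
    by eventually_elim (use assms in \<open>simp add: l(2) powr_mult\<close>)
  ultimately show ?thesis by (simp add: tendsto_cong)
qed

section \<open>Power bounds for the tail by iterated doubling\<close>

lemma dyadic_interval:
  fixes u :: real
  assumes "0 < v" "v \<le> u"
  obtains k :: nat where "2 ^ k * v \<le> u" "u \<le> 2 ^ Suc k * v"
proof -
  define k where "k = nat \<lfloor>log 2 (u / v)\<rfloor>"
  have ge: "0 \<le> log 2 (u / v)" using assms by (simp add: zero_le_log_cancel_iff)
  have "real k \<le> log 2 (u / v)" "log 2 (u / v) \<le> real (Suc k)"
    unfolding k_def using ge by linarith+
  then have "2 powr k \<le> u / v" "u / v \<le> 2 powr (Suc k)"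
    using assms by (simp_all add: le_log_iff log_le_iff)
  then have "2 ^ k * v \<le> u" "u \<le> 2 ^ Suc k * v"
    using assms by (simp_all only: powr_realpow pos_le_divide_eq pos_divide_le_eq zero_less_numeral)
  then show ?thesis by (rule that)
qed

text \<open>A one-sided Potter bound. Doubling the argument eventually multiplies the tail by less
  than 2^(-\<beta>), because the limiting factor 2^(-\<alpha>) is smaller; iteration handles one
  dyadic interval after the other. The \<open>2 * v\<close> in \<open>C\<close> absorbs the
  variation within the first interval by monotonicity.\<close>

lemma tail_upper_bound:
  assumes "0 < \<beta>" "\<beta> < \<alpha>"
  obtains C v where "0 < C" "0 < v" "\<And>u. v \<le> u \<Longrightarrow> tail u \<le> C * u powr (- \<beta>)"
proof -
  have "\<forall>\<^sub>F v in at_top. tail (2 * v) / tail v < 2 powr (- \<beta>)"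
    by (rule order_tendstoD(2)[OF tail_ratio]) (use assms in auto)
  then obtain v0 where v0: "\<And>v. v0 \<le> v \<Longrightarrow> tail (2 * v) / tail v < 2 powr (- \<beta>)"
    by (auto simp: eventually_at_top_linorder)
  define v where "v = max v0 1"
  have v: "0 < v" "v0 \<le> v" by (auto simp: v_def)
  define C where "C = tail v * (2 * v) powr \<beta>"
  have C: "0 < C" using tail_pos v by (simp add: C_def)
  have step: "tail (2 * u) \<le> 2 powr (- \<beta>) * tail u" if "v \<le> u" for u
    using v0[of u] that v tail_pos[of u] by (simp add: field_simps)
  have "\<forall>u. 2 ^ k * v \<le> u \<and> u \<le> 2 ^ Suc k * v \<longrightarrow> tail u \<le> C * u powr (- \<beta>)" for k :: nat
  proof (induction k)
    case 0
    show ?case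
    proof (intro allI impI)
      fix u assume "2 ^ 0 * v \<le> u \<and> u \<le> 2 ^ Suc 0 * v"
      then have u: "v \<le> u" "u \<le> 2 * v" by auto
      have "tail u \<le> tail v * 1" using tail_antimono[of v u] u v by simp
      also have "1 \<le> (2 * v / u) powr \<beta>" using u v assms by (intro ge_one_powr_ge_zero) auto
      then have "tail v * 1 \<le> tail v * (2 * v / u) powr \<beta>"
        using tail_pos[of v] v by (intro mult_left_mono) auto
      also have "\<dots> = C * u powr (- \<beta>)" using u v by (simp add: C_def powr_divide powr_minus_divide)
      finally show "tail u \<le> C * u powr (- \<beta>)" .
    qed
  next
    case (Suc k)
    show ?case
    proof (intro allI impI)
      fix u assume u: "2 ^ Suc k * v \<le> u \<and> u \<le> 2 ^ Suc (Suc k) * v"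
      then have IH: "tail (u / 2) \<le> C * (u / 2) powr (- \<beta>)" by (intro Suc.IH[rule_format]) auto
      have "v \<le> 2 ^ k * v" using v by simp
      then have vu: "v \<le> u / 2" using u by simp
      have "tail u \<le> 2 powr (- \<beta>) * tail (u / 2)" using step[OF vu] by simp
      also have "\<dots> \<le> 2 powr (- \<beta>) * (C * (u / 2) powr (- \<beta>))" using IH by (intro mult_left_mono) auto
      also have "\<dots> = C * u powr (- \<beta>)" using vu v by (simp add: powr_divide)
      finally show "tail u \<le> C * u powr (- \<beta>)" .
    qed
  qed
  then show ?thesis using that[OF C v(1)] dyadic_interval[OF v(1)] by metis
qed

text \<open>The mirror image of \<open>tail_upper_bound\<close>. The crude exponent
  \<open>\<alpha> + 1\<close> suffices because the bound is only played off against an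
  exponential.\<close>

lemma tail_lower_bound:
  obtains C v where "0 < C" "0 < v" "\<And>u. v \<le> u \<Longrightarrow> C * u powr (- (\<alpha> + 1)) \<le> tail u"
proof -
  define \<beta> where "\<beta> = \<alpha> + 1"
  have \<beta>: "0 < \<beta>" using alpha_pos by (simp add: \<beta>_def)
  have "\<forall>\<^sub>F v in at_top. 2 powr (- \<beta>) < tail (2 * v) / tail v"
    by (rule order_tendstoD(1)[OF tail_ratio]) (auto simp: \<beta>_def)
  then obtain v0 where v0: "\<And>v. v0 \<le> v \<Longrightarrow> 2 powr (- \<beta>) < tail (2 * v) / tail v"
    by (auto simp: eventually_at_top_linorder)
  define v where "v = max v0 1"
  have v: "0 < v" "v0 \<le> v" by (auto simp: v_def)
  define C where "C = tail (2 * v) * v powr \<beta>"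
  have C: "0 < C" using tail_pos v by (simp add: C_def)
  have step: "2 powr (- \<beta>) * tail u \<le> tail (2 * u)" if "v \<le> u" for u
    using v0[of u] that v tail_pos[of u] by (simp add: field_simps)
  have "\<forall>u. 2 ^ k * v \<le> u \<and> u \<le> 2 ^ Suc k * v \<longrightarrow> C * u powr (- \<beta>) \<le> tail u" for k :: nat
  proof (induction k)
    case 0
    show ?case
    proof (intro allI impI)
      fix u assume "2 ^ 0 * v \<le> u \<and> u \<le> 2 ^ Suc 0 * v"
      then have u: "v \<le> u" "u \<le> 2 * v" by auto
      have "C * u powr (- \<beta>) = tail (2 * v) * (v / u) powr \<beta>"
        using u v by (simp add: C_def powr_divide powr_minus_divide)
      also have "\<dots> \<le> tail (2 * v) * 1"
        using tail_pos[of "2 * v"] u v \<beta> by (intro mult_left_mono powr_le1) auto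
      also have "\<dots> \<le> tail u" using tail_antimono[of u "2 * v"] u v by simp
      finally show "C * u powr (- \<beta>) \<le> tail u" .
    qed
  next
    case (Suc k)
    show ?case
    proof (intro allI impI)
      fix u assume u: "2 ^ Suc k * v \<le> u \<and> u \<le> 2 ^ Suc (Suc k) * v"
      then have IH: "C * (u / 2) powr (- \<beta>) \<le> tail (u / 2)" by (intro Suc.IH[rule_format]) auto
      have "v \<le> 2 ^ k * v" using v by simp
      then have vu: "v \<le> u / 2" using u by simp
      have "C * u powr (- \<beta>) = 2 powr (- \<beta>) * (C * (u / 2) powr (- \<beta>))" using vu v by (simp add: powr_divide)
      also have "\<dots> \<le> 2 powr (- \<beta>) * tail (u / 2)" using IH by (intro mult_left_mono) auto
      also have "\<dots> \<le> tail u" using step[OF vu] by simp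
      finally show "C * u powr (- \<beta>) \<le> tail u" .
    qed
  qed
  then show ?thesis using that[OF C v(1)] dyadic_interval[OF v(1)] unfolding \<beta>_def by metis
qed

subsection \<open>The quantile scale\<close>

definition qq :: "nat \<Rightarrow> real \<Rightarrow> real" where
  "qq d \<rho> = quantile Q (1 - 1 / \<rho> ^ d)"

lemma measure_initial: "0 \<le> x \<Longrightarrow> measure Q {0..x} = 1 - tail x"
proof -
  assume x: "0 \<le> x"
  have "{0..x} = space Q - {x<..}" using x by (auto simp: space_Q)
  then show ?thesis using prob_compl[OF tail_sets[OF x]] by (simp add: tail_def)
qed

lemma tail_tendsto_0: "(tail \<longlongrightarrow> 0) at_top"
proof -
  obtain C v where C: "0 < C" "0 < v" "\<And>u. v \<le> u \<Longrightarrow> tail u \<le> C * u powr (- (\<alpha> / 2))"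
    using tail_upper_bound[of "\<alpha> / 2"] alpha_pos by auto
  have "((\<lambda>u. C * u powr (- (\<alpha> / 2))) \<longlongrightarrow> C * 0) at_top"
    using alpha_pos by (intro tendsto_mult tendsto_const tendsto_neg_powr filterlim_ident) auto
  then have lim: "((\<lambda>u. C * u powr (- (\<alpha> / 2))) \<longlongrightarrow> 0) at_top" by simp
  show ?thesis
    by (rule tendsto_sandwich[OF _ _ tendsto_const lim])
      (use C in \<open>auto simp: tail_def eventually_at_top_linorder\<close>)
qed

context
  fixes d :: nat and \<rho> :: real
  assumes rho: "1 < \<rho>" and d: "0 < d"
begin

lemma quantile_set_nonempty: "\<exists>x\<ge>0. 1 - 1 / \<rho> ^ d \<le> measure Q {0..x}"
proof -
  have "\<forall>\<^sub>F u in at_top. tail u < 1 / \<rho> ^ d"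
    by (rule order_tendstoD(2)[OF tail_tendsto_0]) (use rho in simp)
  then have "\<forall>\<^sub>F u in at_top. tail u < 1 / \<rho> ^ d \<and> 0 \<le> u"
    using eventually_ge_at_top[of 0] by eventually_elim auto
  then obtain u where "tail u < 1 / \<rho> ^ d" "0 \<le> u" by (auto simp: eventually_at_top_linorder)
  then show ?thesis by (intro exI[of _ u]) (simp add: measure_initial)
qed

lemma qq_nonneg: "0 \<le> qq d \<rho>"
  unfolding qq_def quantile_def using quantile_set_nonempty by (intro cInf_greatest) auto

text \<open>\<open>Q\<close> may have atoms, so the tail at the quantile itself need not equal
  1/\<rho>^d. Strict comparison points on either side are the usable form of the definition.\<close>

lemma tail_above_qq:
  assumes "qq d \<rho> < u"
  shows "tail u \<le> 1 / \<rho> ^ d"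
proof -
  have "Inf {x. 0 \<le> x \<and> 1 - 1 / \<rho> ^ d \<le> measure Q {0..x}} < u"
    using assms by (simp add: qq_def quantile_def)
  then obtain x where x: "0 \<le> x" "1 - 1 / \<rho> ^ d \<le> measure Q {0..x}" "x < u"
    using quantile_set_nonempty by (subst (asm) cInf_less_iff) (auto intro: bdd_belowI[of _ 0])
  then show ?thesis using tail_antimono[of x u] by (simp add: measure_initial)
qed

lemma tail_below_qq:
  assumes "0 \<le> u" "u < qq d \<rho>"
  shows "1 / \<rho> ^ d < tail u"
proof (rule ccontr)
  assume "\<not> ?thesis"
  then have "1 - 1 / \<rho> ^ d \<le> measure Q {0..u}" using assms by (simp add: measure_initial)
  then have "qq d \<rho> \<le> u"
    unfolding qq_def quantile_def using assms by (intro cInf_lower) (auto intro: bdd_belowI[of _ 0])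
  then show False using assms by simp
qed

end

context
  fixes d :: nat
  assumes d: "0 < d"
begin

lemma qq_at_top: "filterlim (qq d) at_top at_top"
  unfolding filterlim_at_top
proof
  fix Z :: real
  define u where "u = max Z 1"
  have u: "0 < tail u" by (rule tail_pos) (simp add: u_def)
  have "((\<lambda>\<rho>::real. 1 / \<rho> ^ d) \<longlongrightarrow> 0) at_top" using d by real_asymp
  then have "\<forall>\<^sub>F \<rho> in at_top. 1 / \<rho> ^ d < tail u" by (rule order_tendstoD) (use u in simp)
  with eventually_gt_at_top[of 1] show "\<forall>\<^sub>F \<rho> in at_top. Z \<le> qq d \<rho>"
  proof eventually_elim
    case (elim \<rho>)
    then have "\<not> qq d \<rho> < u" using tail_above_qq[of \<rho> d u] d by force
    then show ?case by (simp add: u_def)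
  qed
qed

text \<open>\<rho>^d is compared with the reciprocal of the tail at \<open>s * qq d \<rho>\<close>,
  from below for s < 1 and from above for s > 1. The resulting ratio of tails tends to
  (c/s)^(-\<alpha>), and s is taken close enough to 1.\<close>

lemma tail_qq_asymp:
  assumes c: "0 < c"
  shows "((\<lambda>\<rho>. \<rho> ^ d * tail (c * qq d \<rho>)) \<longlongrightarrow> c powr (- \<alpha>)) at_top"
proof -
  have ratio: "((\<lambda>\<rho>. tail (c * qq d \<rho>) / tail (s * qq d \<rho>)) \<longlongrightarrow> (c / s) powr (- \<alpha>)) at_top" if s: "0 < s" for s
  proof -
    have "filterlim (\<lambda>\<rho>. s * qq d \<rho>) at_top at_top"
      by (rule filterlim_tendsto_pos_mult_at_top[OF tendsto_const s qq_at_top])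
    from filterlim_compose[OF tail_ratio[of "c / s"] this] show ?thesis
      using c s by simp
  qed
  have cont: "((\<lambda>s. (c / s) powr (- \<alpha>)) \<longlongrightarrow> c powr (- \<alpha>)) (at 1 within S)" for S :: "real set"
  proof -
    have "((\<lambda>s. (c / s) powr (- \<alpha>)) \<longlongrightarrow> (c / 1) powr (- \<alpha>)) (at 1 within S)"
      using c by (intro tendsto_powr tendsto_divide tendsto_const tendsto_ident_at) auto
    then show ?thesis by simp
  qed
  have qpos: "\<forall>\<^sub>F \<rho> in at_top. 0 < qq d \<rho>"
    using qq_at_top by (simp add: filterlim_at_top_dense)
  show ?thesis
  proof (rule order_tendstoI)
    fix a assume a: "a < c powr (- \<alpha>)"
    have "\<forall>\<^sub>F s in at_left 1. a < (c / s) powr (- \<alpha>)" by (rule order_tendstoD(1)[OF cont a])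
    moreover have "\<forall>\<^sub>F s in at_left 1. s \<in> {0<..<1::real}" by (rule eventually_at_left_real) simp
    ultimately have "\<forall>\<^sub>F s in at_left (1::real). a < (c / s) powr (- \<alpha>) \<and> 0 < s \<and> s < 1"
      by eventually_elim auto
    then obtain s where s: "a < (c / s) powr (- \<alpha>)" "0 < s" "s < 1"
      using eventually_happens[of _ "at_left (1::real)"] trivial_limit_at_left_real by blast
    have "\<forall>\<^sub>F \<rho> in at_top. a < tail (c * qq d \<rho>) / tail (s * qq d \<rho>)"
      by (rule order_tendstoD(1)[OF ratio s(1)]) (rule s)
    with qpos eventually_gt_at_top[of 1]
    show "\<forall>\<^sub>F \<rho> in at_top. a < \<rho> ^ d * tail (c * qq d \<rho>)"
    proof eventually_elim
      case (elim \<rho>)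
      have "1 / \<rho> ^ d < tail (s * qq d \<rho>)" by (rule tail_below_qq) (use elim d s in auto)
      then have "1 / tail (s * qq d \<rho>) \<le> \<rho> ^ d"
        using elim s tail_pos[of "s * qq d \<rho>"] by (simp add: field_simps)
      then have "tail (c * qq d \<rho>) * (1 / tail (s * qq d \<rho>)) \<le> tail (c * qq d \<rho>) * \<rho> ^ d"
        by (intro mult_left_mono) (auto simp: tail_def)
      then show ?case using elim by (simp add: mult.commute)
    qed
  next
    fix a assume a: "c powr (- \<alpha>) < a"
    have "\<forall>\<^sub>F s in at_right 1. (c / s) powr (- \<alpha>) < a" by (rule order_tendstoD(2)[OF cont a])
    moreover have "\<forall>\<^sub>F s in at_right 1. s \<in> {1<..<2::real}" by (rule eventually_at_right_real) simp
    ultimately have "\<forall>\<^sub>F s in at_right (1::real). (c / s) powr (- \<alpha>) < a \<and> 1 < s"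
      by eventually_elim auto
    then obtain s where s: "(c / s) powr (- \<alpha>) < a" "1 < s"
      using eventually_happens[of _ "at_right (1::real)"] trivial_limit_at_right_real by blast
    have "\<forall>\<^sub>F \<rho> in at_top. tail (c * qq d \<rho>) / tail (s * qq d \<rho>) < a"
      by (rule order_tendstoD(2)[OF ratio s(1)]) (use s in simp)
    with qpos eventually_gt_at_top[of 1]
    show "\<forall>\<^sub>F \<rho> in at_top. \<rho> ^ d * tail (c * qq d \<rho>) < a"
    proof eventually_elim
      case (elim \<rho>)
      have "tail (s * qq d \<rho>) \<le> 1 / \<rho> ^ d" by (rule tail_above_qq) (use elim d s in auto)
      then have "\<rho> ^ d \<le> 1 / tail (s * qq d \<rho>)"
        using elim s tail_pos[of "s * qq d \<rho>"] by (simp add: field_simps)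
      then have "tail (c * qq d \<rho>) * \<rho> ^ d \<le> tail (c * qq d \<rho>) * (1 / tail (s * qq d \<rho>))"
        by (intro mult_left_mono) (auto simp: tail_def)
      then show ?case using elim by (simp add: mult.commute)
    qed
  qed
qed

text \<open>With \<beta> strictly between d and \<alpha>, the tail at half the quantile exceeds
  1/\<rho>^d and is at most of order q^(-\<beta>). Solving for q gives q of order at most
  \<rho>^(d/\<beta>), and d/\<beta> < 1.\<close>

lemma qq_over_rho:
  assumes "real d < \<alpha>"
  shows "((\<lambda>\<rho>. qq d \<rho> / \<rho>) \<longlongrightarrow> 0) at_top"
proof -
  define \<beta> where "\<beta> = (d + \<alpha>) / 2"
  have \<beta>: "0 < \<beta>" "\<beta> < \<alpha>" "d < \<beta>" using assms d by (auto simp: \<beta>_def)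
  obtain C v where C: "0 < C" "0 < v" "\<And>u. v \<le> u \<Longrightarrow> tail u \<le> C * u powr (- \<beta>)"
    using tail_upper_bound[OF \<beta>(1,2)] by metis
  have "\<forall>\<^sub>F \<rho> in at_top. 2 * v < qq d \<rho>" using qq_at_top by (simp add: filterlim_at_top_dense)
  then have le: "\<forall>\<^sub>F \<rho> in at_top. qq d \<rho> / \<rho> \<le> 2 * C powr (1 / \<beta>) * \<rho> powr (d / \<beta> - 1)"
    using eventually_gt_at_top[of 1]
  proof eventually_elim
    case (elim \<rho>)
    let ?u = "qq d \<rho> / 2"
    have u: "v \<le> ?u" "0 < ?u" using elim C by auto
    have "1 / \<rho> ^ d < tail ?u" by (rule tail_below_qq) (use elim d C in auto)
    also have "\<dots> \<le> C * ?u powr (- \<beta>)" by (rule C(3)[OF u(1)])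
    finally have "?u powr \<beta> \<le> C * \<rho> ^ d"
      using u elim by (simp add: powr_minus field_simps)
    then have "(?u powr \<beta>) powr (1 / \<beta>) \<le> (C * \<rho> ^ d) powr (1 / \<beta>)"
      using \<beta> u by (intro powr_mono2) auto
    then have "?u \<le> C powr (1 / \<beta>) * \<rho> powr (d / \<beta>)"
      using \<beta> u C elim by (simp add: powr_powr powr_mult flip: powr_realpow)
    then have "qq d \<rho> / \<rho> \<le> 2 * (C powr (1 / \<beta>) * \<rho> powr (d / \<beta>)) / \<rho>"
      using elim by (intro divide_right_mono) auto
    then show ?case using elim by (simp add: powr_diff)
  qed
  have "((\<lambda>\<rho>. 2 * C powr (1 / \<beta>) * \<rho> powr (d / \<beta> - 1)) \<longlongrightarrow> 2 * C powr (1 / \<beta>) * 0) at_top"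
    using \<beta> by (intro tendsto_mult tendsto_const tendsto_neg_powr filterlim_ident) (simp add: field_simps)
  then have lim: "((\<lambda>\<rho>. 2 * C powr (1 / \<beta>) * \<rho> powr (d / \<beta> - 1)) \<longlongrightarrow> 0) at_top" by simp
  have ge: "\<forall>\<^sub>F \<rho> in at_top. 0 \<le> qq d \<rho> / \<rho>"
    using eventually_gt_at_top[of 1] by eventually_elim (use qq_nonneg d in auto)
  show ?thesis by (rule tendsto_sandwich[OF ge le tendsto_const lim])
qed

text \<open>The tail at twice the quantile is at most 1/\<rho>^d and at least a negative power of q,
  so \<rho>^d is bounded by a power of q, which the exponential beats. For q at least 1 the exponent
  q^d may be lowered to q.\<close>

lemma rho_exp_qq:
  assumes c: "0 < c"
  shows "((\<lambda>\<rho>. \<rho> ^ d * exp (- c * qq d \<rho> ^ d)) \<longlongrightarrow> 0) at_top"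
proof -
  obtain C v where C: "0 < C" "0 < v" "\<And>u. v \<le> u \<Longrightarrow> C * u powr (- (\<alpha> + 1)) \<le> tail u"
    using tail_lower_bound by metis
  let ?f = "\<lambda>q. (2 * q) powr (\<alpha> + 1) / C * exp (- c * q)"
  have "\<forall>\<^sub>F \<rho> in at_top. v + 1 < qq d \<rho>" using qq_at_top by (simp add: filterlim_at_top_dense)
  then have le: "\<forall>\<^sub>F \<rho> in at_top. \<rho> ^ d * exp (- c * qq d \<rho> ^ d) \<le> ?f (qq d \<rho>)"
    using eventually_gt_at_top[of 1]
  proof eventually_elim
    case (elim \<rho>)
    let ?u = "2 * qq d \<rho>"
    have q: "1 \<le> qq d \<rho>" "v \<le> ?u" using elim C by auto
    have "C * ?u powr (- (\<alpha> + 1)) \<le> tail ?u" by (rule C(3)) (rule q)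
    also have "\<dots> \<le> 1 / \<rho> ^ d" by (rule tail_above_qq) (use elim d q in auto)
    finally have "C / ?u powr (\<alpha> + 1) \<le> 1 / \<rho> ^ d" by (simp only: powr_minus_divide) simp
    then have a: "\<rho> ^ d \<le> ?u powr (\<alpha> + 1) / C"
      using elim C q by (simp add: field_simps)
    have "qq d \<rho> ^ 1 \<le> qq d \<rho> ^ d" using q d by (intro power_increasing) auto
    then have "exp (- c * qq d \<rho> ^ d) \<le> exp (- c * qq d \<rho>)" using c by simp
    then show ?case using a elim C by (intro mult_mono) auto
  qed
  have "((\<lambda>q. ?f q) \<longlongrightarrow> 0) at_top" using C c alpha_pos by real_asymp
  from filterlim_compose[OF this qq_at_top] have lim: "((\<lambda>\<rho>. ?f (qq d \<rho>)) \<longlongrightarrow> 0) at_top" .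
  have ge: "\<forall>\<^sub>F \<rho> in at_top. 0 \<le> \<rho> ^ d * exp (- c * qq d \<rho> ^ d)"
    using eventually_gt_at_top[of 1] by eventually_elim auto
  show ?thesis by (rule tendsto_sandwich[OF ge le tendsto_const lim])
qed

end

end

section \<open>The inradius of a Laguerre cell\<close>

lemma norm_diff_square:
  fixes a b :: "'a::real_inner"
  shows "(norm (a - b))\<^sup>2 = (norm a)\<^sup>2 - 2 * (a \<bullet> b) + (norm b)\<^sup>2"
  by (simp add: power2_norm_eq_inner inner_diff_left inner_diff_right inner_commute)

text \<open>The terms quadratic in z cancel, so each point (y, t) imposes a half-space condition on
  z - x. By Cauchy-Schwarz the worst z in the ball is the one in direction y - x.\<close>

lemma cball_subset_laguerre_cell_iff:
  fixes x :: "'a::euclidean_space"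
  assumes "0 \<le> r"
  shows "cball x r \<subseteq> laguerre_cell (x, m) \<phi> \<longleftrightarrow>
    (\<forall>(y, t)\<in>\<phi>. t\<^sup>2 - m\<^sup>2 \<le> (norm (y - x))\<^sup>2 - 2 * r * norm (y - x))"
proof safe
  fix y t assume sub: "cball x r \<subseteq> laguerre_cell (x, m) \<phi>" and y: "(y, t) \<in> \<phi>"
  let ?v = "y - x"
  \<comment> \<open>The point of the ball furthest in direction y. For y = x the division by zero
    makes it the centre, and the computation still holds.\<close>
  let ?u = "(r / norm ?v) *\<^sub>R ?v"
  have "norm ?u \<le> r" using assms by simp
  then have "x + ?u \<in> laguerre_cell (x, m) \<phi>" using sub by (auto simp: dist_norm)
  then have *: "(norm ?u)\<^sup>2 - m\<^sup>2 \<le> (norm (?u - ?v))\<^sup>2 - t\<^sup>2"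
    using y by (auto simp: laguerre_cell_def algebra_simps)
  have "?u \<bullet> ?v = r / norm ?v * (norm ?v)\<^sup>2"
    by (simp only: inner_scaleR_left power2_norm_eq_inner)
  also have "\<dots> = r * norm ?v" by (cases "norm ?v = 0") (simp_all add: power2_eq_square)
  finally have "?u \<bullet> ?v = r * norm ?v" .
  moreover note norm_diff_square[of ?u ?v]
  ultimately show "t\<^sup>2 - m\<^sup>2 \<le> (norm ?v)\<^sup>2 - 2 * r * norm ?v" using * by (simp only: mult.assoc)
next
  fix z assume H: "\<forall>(y, t)\<in>\<phi>. t\<^sup>2 - m\<^sup>2 \<le> (norm (y - x))\<^sup>2 - 2 * r * norm (y - x)"
    and z: "z \<in> cball x r"
  show "z \<in> laguerre_cell (x, m) \<phi>"
    unfolding laguerre_cell_def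
  proof (clarsimp)
    fix y t assume y: "(y, t) \<in> \<phi>"
    let ?u = "z - x" and ?v = "y - x"
    have "?u \<bullet> ?v \<le> norm ?u * norm ?v" by (rule norm_cauchy_schwarz)
    also have "\<dots> \<le> r * norm ?v" using z by (intro mult_right_mono) (auto simp: dist_norm norm_minus_commute)
    finally have "?u \<bullet> ?v \<le> r * norm ?v" .
    moreover have "(norm (z - y))\<^sup>2 = (norm ?u)\<^sup>2 - 2 * (?u \<bullet> ?v) + (norm ?v)\<^sup>2"
      using norm_diff_square[of ?u ?v] by simp
    moreover have "t\<^sup>2 - m\<^sup>2 \<le> (norm ?v)\<^sup>2 - 2 * (r * norm ?v)" using H y by fastforce
    ultimately show "(norm (z - x))\<^sup>2 - m\<^sup>2 \<le> (norm (z - y))\<^sup>2 - t\<^sup>2" by linarith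
  qed
qed

lemma inradius_ge_iff:
  fixes x :: "'a::euclidean_space"
  assumes a: "0 < a"
  shows "ennreal a \<le> inradius (x, m) \<phi> \<longleftrightarrow>
    (\<forall>(y, t)\<in>\<phi>. t\<^sup>2 - m\<^sup>2 \<le> (norm (y - x))\<^sup>2 - 2 * a * norm (y - x))"
proof
  assume H: "\<forall>(y, t)\<in>\<phi>. t\<^sup>2 - m\<^sup>2 \<le> (norm (y - x))\<^sup>2 - 2 * a * norm (y - x)"
  then have sub: "cball x a \<subseteq> laguerre_cell (x, m) \<phi>"
    using cball_subset_laguerre_cell_iff[of a x m \<phi>] a by simp
  then have "x \<in> laguerre_cell (x, m) \<phi>" using a by auto
  then show "ennreal a \<le> inradius (x, m) \<phi>"
    unfolding inradius_def using sub a by (auto intro!: SUP_upper)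
next
  assume ge: "ennreal a \<le> inradius (x, m) \<phi>"
  let ?S = "{r. 0 \<le> r \<and> cball x r \<subseteq> laguerre_cell (x, m) \<phi>}"
  have r: "inradius (x, m) \<phi> = (SUP r\<in>?S. ennreal r)"
    using ge a unfolding inradius_def by (auto split: if_split_asm)
  have "t\<^sup>2 - m\<^sup>2 \<le> (norm (y - x))\<^sup>2 - 2 * a * norm (y - x)" if y: "(y, t) \<in> \<phi>" for y t
  proof (rule field_le_epsilon)
    fix e :: real assume e: "0 < e"
    \<comment> \<open>The supremum need not be attained a priori, so the condition is first obtained
      for some radius above b < a. Replacing a by b costs at most \<open>e\<close>; the 1 in the
      denominator covers y = x, and \<open>a / 2\<close> keeps b positive.\<close>
    define b where "b = max (a - e / (2 * (norm (y - x) + 1))) (a / 2)"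
    have b: "0 < b" "b < a" using a e by (auto simp: b_def add_nonneg_pos)
    then have "ennreal b < inradius (x, m) \<phi>" using ge by (meson ennreal_lessI less_le_trans a)
    then obtain r where "r \<in> ?S" "ennreal b < ennreal r" unfolding r less_SUP_iff by blast
    then have rs: "0 \<le> r" "cball x r \<subseteq> laguerre_cell (x, m) \<phi>" "b < r"
      using b by (auto simp: ennreal_less_iff)
    then have "t\<^sup>2 - m\<^sup>2 \<le> (norm (y - x))\<^sup>2 - 2 * r * norm (y - x)"
      using cball_subset_laguerre_cell_iff[of r x m \<phi>] y by fastforce
    also have "\<dots> \<le> (norm (y - x))\<^sup>2 - 2 * b * norm (y - x)"
      using rs by (auto intro!: mult_right_mono)
    also have "\<dots> \<le> (norm (y - x))\<^sup>2 - 2 * (a - e / (2 * (norm (y - x) + 1))) * norm (y - x)"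
      by (intro diff_left_mono mult_right_mono mult_left_mono) (simp_all add: b_def)
    also have "\<dots> = (norm (y - x))\<^sup>2 - 2 * a * norm (y - x) + e * (norm (y - x) / (norm (y - x) + 1))"
    proof -
      have "2 * (a - e / (2 * k)) * n = 2 * a * n - e * (n / k)" if "0 < k" for k n :: real
        using that by (simp add: field_simps)
      note k = this[of "norm (y - x) + 1" "norm (y - x)"]
      have "0 < norm (y - x) + 1" by (simp add: add_nonneg_pos)
      from k[OF this] show ?thesis by linarith
    qed
    also have "\<dots> \<le> (norm (y - x))\<^sup>2 - 2 * a * norm (y - x) + e * 1"
      using e by (intro add_left_mono mult_left_mono) (auto simp: divide_le_eq_1 add_nonneg_pos)
    finally show "t\<^sup>2 - m\<^sup>2 \<le> (norm (y - x))\<^sup>2 - 2 * a * norm (y - x) + e" by simp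
  qed
  then show "\<forall>(y, t)\<in>\<phi>. t\<^sup>2 - m\<^sup>2 \<le> (norm (y - x))\<^sup>2 - 2 * a * norm (y - x)" by blast
qed

lemma inradius_le:
  fixes x y :: "'a::euclidean_space"
  assumes y: "(y, t) \<in> \<phi>" and D: "0 < norm (y - x)" "0 \<le> c"
    and c: "(norm (y - x))\<^sup>2 + m\<^sup>2 - t\<^sup>2 \<le> 2 * c * norm (y - x)"
  shows "inradius (x, m) \<phi> \<le> ennreal c"
proof (rule ccontr)
  assume "\<not> ?thesis"
  then have "ennreal c < inradius (x, m) \<phi>" by simp
  then obtain b where b: "ennreal c < b" "b < inradius (x, m) \<phi>" using dense by blast
  then obtain a where a: "b = ennreal a" "0 \<le> a" by (cases b) auto
  have ca: "c < a" using a b D by (simp add: ennreal_less_iff)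
  then have "t\<^sup>2 - m\<^sup>2 \<le> (norm (y - x))\<^sup>2 - 2 * a * norm (y - x)"
    using inradius_ge_iff[of a x m \<phi>] b(2) a D y by fastforce
  moreover have "2 * c * norm (y - x) < 2 * a * norm (y - x)" using ca D by simp
  ultimately show False using c by linarith
qed

text \<open>The deterministic heart of the approximation. Negligible marks and well separated points
  keep the inradius above (1 - \<delta>) m; any single point in the shell of radius about m,
  whatever its mark, keeps it below (1 + \<delta>) m.\<close>

lemma inradius_close_to_mark:
  fixes x :: "'a::euclidean_space"
  assumes \<delta>: "0 < \<delta>" "\<delta> \<le> 1/2" and m: "0 < m" and \<kappa>: "\<kappa>\<^sup>2 \<le> \<delta> * m\<^sup>2"
    and marks: "\<And>y t. (y, t) \<in> \<phi> \<Longrightarrow> 0 \<le> t"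
    and sep: "\<And>y t. (y, t) \<in> \<phi> \<Longrightarrow> (y, t) \<noteq> (x, m) \<Longrightarrow> t \<le> \<kappa> \<or> 3 * max m t \<le> norm (y - x)"
    and shell: "\<exists>(y, t)\<in>\<phi>. (1 - \<delta>) * m \<le> norm (y - x) \<and> norm (y - x) \<le> (1 + \<delta>) * m"
  shows "ennreal ((1 - \<delta>) * m) \<le> inradius (x, m) \<phi>" "inradius (x, m) \<phi> \<le> ennreal ((1 + \<delta>) * m)"
proof -
  have pos: "0 < (1 - \<delta>) * m" using \<delta> m by simp
  show "ennreal ((1 - \<delta>) * m) \<le> inradius (x, m) \<phi>"
    unfolding inradius_ge_iff[OF pos]
  proof safe
    fix y t assume y: "(y, t) \<in> \<phi>"
    let ?D = "norm (y - x)"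
    show "t\<^sup>2 - m\<^sup>2 \<le> ?D\<^sup>2 - 2 * ((1 - \<delta>) * m) * ?D"
    proof (cases "(y, t) = (x, m)")
      case False
      from sep[OF y False] show ?thesis
      proof
        assume "t \<le> \<kappa>"
        then have "t\<^sup>2 \<le> \<kappa>\<^sup>2" using marks[OF y] by (intro power_mono) auto
        then have t: "t\<^sup>2 \<le> \<delta> * m\<^sup>2" using \<kappa> by linarith
        \<comment> \<open>After this bound by squares, (1 - \<delta>)^2 \<le> 1 - \<delta> leaves a
          slack of \<delta> m^2, exactly the room that \<kappa> grants to t^2.\<close>
        have "2 * ((1 - \<delta>) * m) * ?D \<le> ((1 - \<delta>) * m)\<^sup>2 + ?D\<^sup>2" by (rule sum_squares_bound)
        then have "2 * ((1 - \<delta>) * m) * ?D \<le> ?D\<^sup>2 + ((1 - \<delta>) * m)\<^sup>2" by (simp only: add.commute)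
        also have "((1 - \<delta>) * m)\<^sup>2 \<le> (1 - \<delta>) * m\<^sup>2"
        proof -
          have "(1 - \<delta>)\<^sup>2 \<le> (1 - \<delta>) ^ 1" using \<delta> by (intro power_decreasing) auto
          then show ?thesis using m by (simp add: power_mult_distrib)
        qed
        finally show ?thesis using t by (simp add: algebra_simps)
      next
        \<comment> \<open>Here m and t are at most D/3, so t^2 + 2 (1 - \<delta>) m D is at most
          D^2/9 + 2 D^2/3, which is below D^2; hence the factor 3.\<close>
        assume D: "3 * max m t \<le> ?D"
        have "m \<le> ?D / 3" "t \<le> ?D / 3" using D by auto
        then have "t\<^sup>2 \<le> (?D / 3)\<^sup>2" using marks[OF y] by (intro power_mono) auto
        moreover have "(1 - \<delta>) * m \<le> 1 * m" using \<delta> m by (intro mult_right_mono) auto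
        then have D3: "(1 - \<delta>) * m \<le> ?D / 3" using \<open>m \<le> ?D / 3\<close> by linarith
        have "2 * ((1 - \<delta>) * m) * ?D \<le> 2 * (?D / 3) * ?D"
          by (rule mult_right_mono[OF mult_left_mono[OF D3]]) auto
        moreover have "0 \<le> m\<^sup>2" "0 \<le> ?D\<^sup>2" by auto
        moreover have "2 * (?D / 3) * ?D = 2/3 * ?D\<^sup>2" "(?D / 3)\<^sup>2 = ?D\<^sup>2 / 9"
          by (auto simp: power2_eq_square)
        ultimately show ?thesis by linarith
      qed
    qed simp
  qed
  obtain y t where y: "(y, t) \<in> \<phi>" "(1 - \<delta>) * m \<le> norm (y - x)" "norm (y - x) \<le> (1 + \<delta>) * m"
    using shell by blast
  let ?D = "norm (y - x)"
  show "inradius (x, m) \<phi> \<le> ennreal ((1 + \<delta>) * m)"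
  proof (rule inradius_le[OF y(1)])
    show D: "0 < ?D" using y(2) pos by linarith
    show "0 \<le> (1 + \<delta>) * m" using \<delta> m by simp
    \<comment> \<open>The goal amounts to (D - m)^2 \<le> 2 \<delta> m D, after dropping t^2. The
      left side is at most \<delta>^2 m^2, and \<delta> \<le> 2 (1 - \<delta>) together with D \<ge>
      (1 - \<delta>) m closes the gap.\<close>
    have "(?D - m) * (?D - m) \<le> \<delta> * m * (\<delta> * m)"
    proof -
      have "\<bar>?D - m\<bar> \<le> \<delta> * m" using y by (auto simp: algebra_simps abs_le_iff)
      then have "\<bar>?D - m\<bar> * \<bar>?D - m\<bar> \<le> \<delta> * m * (\<delta> * m)" by (intro mult_mono) (use \<delta> m in auto)
      then show ?thesis by simp
    qed
    also have "\<delta> * m * (\<delta> * m) \<le> 2 * \<delta> * m * ((1 - \<delta>) * m)"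
    proof -
      have "\<delta> * m * \<delta> * m \<le> \<delta> * m * (2 * (1 - \<delta>)) * m"
        using \<delta> m by (intro mult_right_mono mult_left_mono) auto
      then show ?thesis by (simp add: mult_ac)
    qed
    also have "\<dots> \<le> 2 * \<delta> * m * ?D" using y \<delta> m by (intro mult_left_mono) auto
    finally have "?D\<^sup>2 + m\<^sup>2 \<le> 2 * ((1 + \<delta>) * m) * ?D"
      by (simp add: power2_eq_square algebra_simps)
    moreover have "0 \<le> t\<^sup>2" by simp
    ultimately show "?D\<^sup>2 + m\<^sup>2 - t\<^sup>2 \<le> 2 * ((1 + \<delta>) * m) * ?D" by linarith
  qed
qed

lemma recip_inradius_close:
  fixes r :: ennreal
  assumes \<delta>: "0 < \<delta>" "\<delta> \<le> 1/2" and m: "0 < m" and q: "0 < q"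
    and r: "ennreal ((1 - \<delta>) * m) \<le> r" "r \<le> ennreal ((1 + \<delta>) * m)"
  shows "\<bar>recip (ennreal (m / q)) - recip (r / ennreal q)\<bar> \<le> 2 * \<delta> * (q / m)"
proof -
  obtain s where s: "r = ennreal s" "0 \<le> s" using r(2) by (cases r) (auto simp: top_unique)
  have s1: "(1 - \<delta>) * m \<le> s" "s \<le> (1 + \<delta>) * m"
    using r s \<delta> m by (auto simp: ennreal_le_iff2 split: if_split_asm)
  have "0 < (1 - \<delta>) * m" using \<delta> m by simp
  then have s0: "0 < s" using s1 by linarith
  have "\<bar>recip (ennreal (m / q)) - recip (r / ennreal q)\<bar> = \<bar>q / m - q / s\<bar>"
    using s s0 m q by (simp add: divide_ennreal recip_ennreal)
  also have "\<dots> = q / m * (\<bar>s - m\<bar> / s)" 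
  proof -
    have "q / m - q / s = q / m * ((s - m) / s)" using s0 m by (simp add: field_simps)
    then show ?thesis using s0 m q by (simp add: abs_mult)
  qed
  also have "\<dots> \<le> q / m * (2 * \<delta>)"
  proof (intro mult_left_mono)
    have "\<bar>s - m\<bar> / s \<le> \<delta> * m / ((1 - \<delta>) * m)"
      using s1 m \<delta> s0 by (intro frac_le) (auto simp: abs_le_iff algebra_simps)
    also have "\<dots> = \<delta> / (1 - \<delta>)" using m by simp
    also have "\<dots> \<le> \<delta> / (1/2)" using \<delta> by (intro divide_left_mono) auto
    finally show "\<bar>s - m\<bar> / s \<le> 2 * \<delta>" by simp
  qed (use q m in auto)
  finally show ?thesis by (simp add: mult_ac)
qed

section \<open>The marked Poisson process\<close>

lemma borel_of_marked_spaceI: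
  assumes "A \<in> sets borel" "A \<subseteq> UNIV \<times> {0..}"
  shows "A \<in> sets (borel_of (marked_space :: ('a::euclidean_space \<times> real) topology))"
proof -
  have "continuous_map marked_space euclidean (\<lambda>x :: 'a \<times> real. x)"
    unfolding marked_space_def by (rule continuous_map_from_subtopology) simp
  then have "(\<lambda>x :: 'a \<times> real. x) \<in> borel_measurable (borel_of marked_space)"
    by (rule continuous_map_borel_measurable)
  from measurable_sets[OF this assms(1)] have "A \<inter> space (borel_of marked_space) \<in> sets (borel_of marked_space)"
    by simp
  also have "A \<inter> space (borel_of marked_space) = A"
    using assms(2) by (auto simp: marked_space_def)
  finally show ?thesis .
qed

text \<open>Compact sets of \<open>marked_space\<close> bound the marks, so finiteness on full
  strips goes beyond local finiteness. With simplicity added, masses over bounded locations are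
  numbers of elements of \<open>points\<close>.\<close>

definition good_config :: "('a::euclidean_space \<times> real) measure \<Rightarrow> bool" where
  "good_config \<nu> \<longleftrightarrow> \<nu> \<in> locally_finite_counting_measures marked_space \<and>
     (\<forall>n::nat. emeasure \<nu> (cball 0 n \<times> {0..}) < \<infinity>) \<and> (\<forall>p. emeasure \<nu> {p} \<le> 1)"

lemma bounded_strip:
  fixes B :: "'a::real_normed_vector set"
  assumes "bounded B"
  obtains n :: nat where "B \<subseteq> cball 0 n"
proof -
  obtain R where R: "\<And>x. x \<in> B \<Longrightarrow> norm x \<le> R" using assms by (auto simp: bounded_iff)
  obtain n :: nat where "R \<le> n" using real_arch_simple by blast
  then have "B \<subseteq> cball 0 n" using R by force
  then show ?thesis by (rule that)
qed

lemma good_config_finite: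
  assumes "good_config \<nu>" "bounded B"
  shows "emeasure \<nu> (B \<times> {0..}) < \<infinity>"
proof -
  obtain n :: nat where n: "B \<subseteq> cball 0 n" by (rule bounded_strip[OF assms(2)])
  have "cball 0 (real n) \<times> {0..} \<in> sets (borel_of (marked_space :: ('a \<times> real) topology))"
    by (intro borel_of_marked_spaceI borel_closed closed_Times) auto
  then have "emeasure \<nu> (B \<times> {0..}) \<le> emeasure \<nu> (cball 0 n \<times> {0..})"
    using assms(1) counting_measureD(2) n unfolding good_config_def by (intro emeasure_mono) auto
  also have "\<dots> < \<infinity>" using assms(1) by (simp add: good_config_def)
  finally show ?thesis .
qed

lemma good_config_count:
  fixes \<nu> :: "('a::euclidean_space \<times> real) measure"
  assumes \<nu>: "good_config \<nu>" and A: "A \<in> sets borel" "A \<subseteq> B \<times> {0..}" and B: "bounded B"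
  shows "finite (points \<nu> \<inter> A)" "emeasure \<nu> A = of_nat (card (points \<nu> \<inter> A))"
proof -
  have l: "\<nu> \<in> locally_finite_counting_measures marked_space" using \<nu> by (simp add: good_config_def)
  have sets: "S \<in> sets \<nu>" if "S \<in> sets borel" "S \<subseteq> UNIV \<times> {0..}" for S
    using borel_of_marked_spaceI[OF that] counting_measureD(2)[OF l] by simp
  obtain n :: nat where n: "B \<subseteq> cball 0 n" by (rule bounded_strip[OF B])
  have fin: "emeasure \<nu> A < \<infinity>"
  proof -
    have "emeasure \<nu> A \<le> emeasure \<nu> (cball 0 n \<times> {0..})"
      using A n by (intro emeasure_mono sets borel_closed closed_Times) auto
    also have "\<dots> < \<infinity>" using \<nu> by (simp add: good_config_def)
    finally show ?thesis .
  qed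
  have eq: "points \<nu> \<inter> A = {x \<in> A. emeasure \<nu> {x} \<noteq> 0}"
    using A(2) counting_measureD(1)[OF l] by (auto simp: points_def marked_space_def)
  have AU: "A \<inter> U \<in> sets \<nu>" if "open U" for U
    by (rule sets) (use that A in auto)
  show "finite (points \<nu> \<inter> A)"
    unfolding eq by (rule finite_atoms[OF counting_measureD(3)[OF l] _ fin]) (use AU[of UNIV] in simp)
  show "emeasure \<nu> A = of_nat (card (points \<nu> \<inter> A))"
    unfolding eq
    by (rule integer_valued_eq_card[OF counting_measureD(3)[OF l] AU _ fin]) (use A \<nu> sets in \<open>auto simp: good_config_def\<close>)
qed

lemma points_emeasure_nonzero:
  assumes "\<nu> \<in> locally_finite_counting_measures marked_space"
    and "p \<in> points \<nu>" "p \<in> A" "A \<in> sets borel" "A \<subseteq> UNIV \<times> {0..}"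
  shows "emeasure \<nu> A \<noteq> 0"
proof -
  have "A \<in> sets \<nu>" using borel_of_marked_spaceI[OF assms(4,5)] counting_measureD(2)[OF assms(1)] by simp
  then have "emeasure \<nu> {p} \<le> emeasure \<nu> A" using assms by (intro emeasure_mono) auto
  then show ?thesis using assms by (auto simp: points_def)
qed

lemma points_emeasure_multiple:
  assumes \<nu>: "\<nu> \<in> locally_finite_counting_measures marked_space"
    and p: "p \<in> points \<nu>" "p \<in> A" and p': "p' \<in> points \<nu>" "p' \<in> A" "p \<noteq> p'"
    and A: "A \<in> sets borel" "A \<subseteq> UNIV \<times> {0..}"
  shows "emeasure \<nu> A \<notin> {0, 1}"
proof -
  have s: "A \<in> sets \<nu>" using borel_of_marked_spaceI[OF A] counting_measureD(2)[OF \<nu>] by simp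
  have one: "1 \<le> emeasure \<nu> {p}" if "p \<in> points \<nu>" for p
    using counting_measureD(3)[OF \<nu>, of "{p}"] that by (auto simp: points_def Suc_le_eq)
  have single: "{p} \<in> sets \<nu>" if "p \<in> points \<nu>" for p
    using that emeasure_notin_sets by (fastforce simp: points_def)
  have "2 = (1 + 1 :: ennreal)" by simp
  also have "\<dots> \<le> emeasure \<nu> {p} + emeasure \<nu> {p'}" by (intro add_mono one p p')
  also have "\<dots> = emeasure \<nu> ({p} \<union> {p'})"
    by (rule plus_emeasure) (use single p p' in auto)
  also have "\<dots> \<le> emeasure \<nu> A" using p p' s by (intro emeasure_mono) auto
  finally have "2 \<le> emeasure \<nu> A" .
  then show ?thesis by (auto simp: not_le)
qed

locale marked_poisson =
  Q: regular_tail Q \<alpha> +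
  poisson P marked_space "scale_measure (ennreal \<gamma>) (lborel \<Otimes>\<^sub>M Q)" \<eta>
  for Q :: "real measure" and \<alpha> \<gamma> :: real and d :: nat and P :: "'w measure" and \<eta> :: "'w \<Rightarrow> ('x::euclidean_space \<times> real) measure" +
  assumes gamma_pos: "0 < \<gamma>" and dim: "DIM('x) = d" and dim_less: "real d < \<alpha>"
begin

abbreviation "\<mu> \<equiv> scale_measure (ennreal \<gamma>) (lborel \<Otimes>\<^sub>M Q)"

lemma d_pos: "0 < d"
  using DIM_positive[where 'a = 'x] by (simp add: dim)

definition vol :: real where "vol = unit_ball_vol (real d)"

lemma vol_nonneg [simp]: "0 \<le> vol"
  by (simp add: vol_def)

lemma sets_Q_borel: "S \<in> sets Q \<Longrightarrow> S \<in> sets borel \<and> S \<subseteq> {0..}"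
  unfolding Q.sets_Q by (auto simp: sets_restrict_space)

lemma box_sets: "B \<in> sets borel \<Longrightarrow> S \<in> sets Q \<Longrightarrow> B \<times> S \<in> sets borel"
  using sets_Q_borel by (auto intro: borel_Times)

lemma box_marked: "B \<in> sets borel \<Longrightarrow> S \<in> sets Q \<Longrightarrow> B \<times> S \<in> sets (borel_of marked_space)"
  using box_sets sets_Q_borel by (intro borel_of_marked_spaceI) auto

lemma emeasure_box:
  assumes "B \<in> sets borel" "S \<in> sets Q" "emeasure lborel B = ennreal b" "0 \<le> b"
  shows "emeasure \<mu> (B \<times> S) = ennreal (\<gamma> * b * measure Q S)"
proof -
  have "emeasure (lborel \<Otimes>\<^sub>M Q) (B \<times> S) = emeasure lborel B * emeasure Q S"
    using assms by (intro Q.emeasure_pair_measure_Times) auto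
  then show ?thesis using assms gamma_pos
    by (simp add: Q.emeasure_eq_measure ennreal_mult mult.assoc)
qed

lemma measure_box:
  assumes "B \<in> sets borel" "S \<in> sets Q" "emeasure lborel B = ennreal b" "0 \<le> b"
  shows "measure \<mu> (B \<times> S) = \<gamma> * b * measure Q S" "emeasure \<mu> (B \<times> S) < \<infinity>"
proof -
  have "0 \<le> \<gamma> * b * measure Q S" using assms gamma_pos by (intro mult_nonneg_nonneg) auto
  then show "measure \<mu> (B \<times> S) = \<gamma> * b * measure Q S"
    using emeasure_box[OF assms] by (simp add: measure_def)
  show "emeasure \<mu> (B \<times> S) < \<infinity>" using emeasure_box[OF assms] by simp
qed

lemma emeasure_cball_vol:
  "0 \<le> r \<Longrightarrow> emeasure lborel (cball (c :: 'x) r) = ennreal (vol * r ^ d)"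
  by (simp add: emeasure_cball vol_def dim)

lemma half_line_sets: "{0..} \<in> sets Q"
  by (rule Q.sets_QI) auto

lemma measure_half_line: "measure Q {0..} = 1"
  using Q.prob_space by (simp add: Q.space_Q)

end

context marked_poisson
begin

definition q :: "real \<Rightarrow> real" where
  "q \<rho> = q_scale \<gamma> \<alpha> Q d \<rho>"

lemma alpha_pos: "0 < \<alpha>"
  using d_pos dim_less by simp

lemma q_eq: "q \<rho> = \<gamma> powr (1 / \<alpha>) * Q.qq d \<rho>"
  by (simp add: q_def q_scale_def Q.qq_def)

lemma gamma_powr_pos: "0 < \<gamma> powr (1 / \<alpha>)"
  using gamma_pos by simp

lemma q_at_top: "filterlim q at_top at_top"
  unfolding q_eq
  by (rule filterlim_tendsto_pos_mult_at_top[OF tendsto_const gamma_powr_pos Q.qq_at_top[OF d_pos]])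

lemma q_pos: "\<forall>\<^sub>F \<rho> in at_top. c < q \<rho>"
  using q_at_top by (simp add: filterlim_at_top_dense)

lemma tail_q_asymp:
  assumes "0 < c"
  shows "((\<lambda>\<rho>. \<gamma> * \<rho> ^ d * Q.tail (c * q \<rho>)) \<longlongrightarrow> c powr (- \<alpha>)) at_top"
proof -
  have "((\<lambda>\<rho>. \<gamma> * (\<rho> ^ d * Q.tail ((c * \<gamma> powr (1 / \<alpha>)) * Q.qq d \<rho>))) \<longlongrightarrow>
      \<gamma> * (c * \<gamma> powr (1 / \<alpha>)) powr (- \<alpha>)) at_top"
    using assms gamma_pos by (intro tendsto_mult tendsto_const Q.tail_qq_asymp d_pos) auto
  moreover have "\<gamma> * (c * \<gamma> powr (1 / \<alpha>)) powr (- \<alpha>) = c powr (- \<alpha>)"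
    using assms gamma_pos alpha_pos by (simp add: powr_mult powr_powr powr_minus)
  ultimately show ?thesis by (simp add: q_eq mult.assoc)
qed

lemma q_over_rho: "((\<lambda>\<rho>. q \<rho> / \<rho>) \<longlongrightarrow> 0) at_top"
  using tendsto_mult[OF tendsto_const[of "\<gamma> powr (1 / \<alpha>)"] Q.qq_over_rho[OF d_pos dim_less]]
  by (simp add: q_eq)

lemma rho_exp_q:
  assumes "0 < c"
  shows "((\<lambda>\<rho>. \<rho> ^ d * exp (- c * q \<rho> ^ d)) \<longlongrightarrow> 0) at_top"
  using Q.rho_exp_qq[OF d_pos, of "c * (\<gamma> powr (1 / \<alpha>)) ^ d"] assms gamma_pos
  by (simp add: q_eq power_mult_distrib mult.assoc)

subsection \<open>Simplicity\<close>

text \<open>There are at most of order R^d/h^d cubes, each holding two or more points with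
  probability at most (\<gamma> h^d)^2, so a factor h^d survives the union bound.\<close>

lemma multiple_points_le:
  fixes h R :: real
  assumes "0 < h" "0 \<le> R"
  shows "prob (\<Union>z\<in>quant h ` cball (0::'x) R. {\<omega>\<in>space P. emeasure (\<eta> \<omega>) ({x. quant h x = z} \<times> {0..}) \<notin> {0, 1}})
    \<le> \<gamma>\<^sup>2 * vol * (R + 2 * d * h) ^ d * h ^ d"
    and "(\<Union>z\<in>quant h ` cball (0::'x) R. {\<omega>\<in>space P. emeasure (\<eta> \<omega>) ({x. quant h x = z} \<times> {0..}) \<notin> {0, 1}}) \<in> sets P"
proof -
  let ?Z = "quant h ` cball (0::'x) R"
  let ?A = "\<lambda>z. {x::'x. quant h x = z} \<times> {0::real..}"
  have fin: "finite ?Z" by (rule finite_quant_image) simp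
  have A: "?A z \<in> sets (borel_of marked_space)" for z
    by (rule box_marked[OF quant_cell_sets half_line_sets])
  have ev: "{\<omega>\<in>space P. emeasure (\<eta> \<omega>) (?A z) \<notin> {0, 1}} \<in> sets P" for z
  proof -
    have "{\<omega>\<in>space P. emeasure (\<eta> \<omega>) (?A z) \<notin> {0, 1}} = space P -
       ({\<omega>\<in>space P. emeasure (\<eta> \<omega>) (?A z) = 0} \<union> {\<omega>\<in>space P. emeasure (\<eta> \<omega>) (?A z) = 1})" by auto
    then show ?thesis using count_event[OF A[of z]] by auto
  qed
  show "(\<Union>z\<in>?Z. {\<omega>\<in>space P. emeasure (\<eta> \<omega>) (?A z) \<notin> {0, 1}}) \<in> sets P"
    using fin ev by (intro sets.finite_UN) auto
  have le: "prob {\<omega>\<in>space P. emeasure (\<eta> \<omega>) (?A z) \<notin> {0, 1}} \<le> (\<gamma> * h ^ d)\<^sup>2" if "z \<in> ?Z" for z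
  proof -
    have e: "emeasure lborel {x::'x. quant h x = z} = ennreal (h ^ d)"
      using emeasure_quant_cell[of h z] assms that by (auto simp: dim)
    have "0 \<le> h ^ d" using assms by simp
    note m = measure_box[OF quant_cell_sets half_line_sets e this]
    show ?thesis using count_multiple_le[OF A m(2)] unfolding m(1) by (simp add: measure_half_line)
  qed
  have "prob (\<Union>z\<in>?Z. {\<omega>\<in>space P. emeasure (\<eta> \<omega>) (?A z) \<notin> {0, 1}}) \<le>
     (\<Sum>z\<in>?Z. prob {\<omega>\<in>space P. emeasure (\<eta> \<omega>) (?A z) \<notin> {0, 1}})"
    by (rule finite_measure_subadditive_finite[OF fin]) (use ev in auto)
  also have "\<dots> \<le> (\<Sum>z\<in>?Z. (\<gamma> * h ^ d)\<^sup>2)" by (intro sum_mono le)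
  also have "\<dots> = \<gamma>\<^sup>2 * (real (card ?Z) * h ^ d) * h ^ d"
    by (simp add: power_mult_distrib power2_eq_square mult_ac)
  also have "\<dots> \<le> \<gamma>\<^sup>2 * (vol * (R + 2 * d * h) ^ d) * h ^ d"
    using card_quant_image_le[where 'a = 'x, OF assms] assms
    by (intro mult_right_mono mult_left_mono) (auto simp: dim vol_def)
  finally show "prob (\<Union>z\<in>?Z. {\<omega>\<in>space P. emeasure (\<eta> \<omega>) (?A z) \<notin> {0, 1}})
    \<le> \<gamma>\<^sup>2 * vol * (R + 2 * d * h) ^ d * h ^ d" by (simp add: mult.assoc)
qed

text \<open>A double point makes its cube multiply occupied at every mesh, hence lies in all events
  \<open>T n\<close>; their probabilities are bounded by a sequence tending to 0.\<close>

lemma AE_simple: "AE \<omega> in P. \<forall>p\<in>cball (0::'x) R \<times> {0..}. emeasure (\<eta> \<omega>) {p} \<le> 1"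
proof -
  let ?R = "max R 0"
  define T where "T n = (\<Union>z\<in>quant (1 / Suc n) ` cball (0::'x) ?R.
      {\<omega>\<in>space P. emeasure (\<eta> \<omega>) ({x. quant (1 / Suc n) x = z} \<times> {0..}) \<notin> {0, 1}})" for n
  have T: "T n \<in> sets P" for n unfolding T_def by (rule multiple_points_le(2)) auto
  have le: "prob (\<Inter>n. T n) \<le> \<gamma>\<^sup>2 * vol * (?R + 2 * d * (1 / Suc n)) ^ d * (1 / Suc n) ^ d" for n
  proof -
    have "prob (\<Inter>n. T n) \<le> prob (T n)" by (intro finite_measure_mono T) auto
    also have "\<dots> \<le> \<gamma>\<^sup>2 * vol * (?R + 2 * d * (1 / Suc n)) ^ d * (1 / Suc n) ^ d"
      unfolding T_def by (rule multiple_points_le(1)) auto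
    finally show ?thesis .
  qed
  have inv: "(\<lambda>n. 1 / real (Suc n)) \<longlonglongrightarrow> 0" using LIMSEQ_inverse_real_of_nat by (simp add: inverse_eq_divide)
  have "(\<lambda>n. \<gamma>\<^sup>2 * vol * (?R + 2 * d * (1 / Suc n)) ^ d * (1 / Suc n) ^ d)
     \<longlonglongrightarrow> \<gamma>\<^sup>2 * vol * (?R + real (2 * d) * 0) ^ d * 0 ^ d"
    by (intro tendsto_intros inv)
  then have "prob (\<Inter>n. T n) \<le> \<gamma>\<^sup>2 * vol * (?R + real (2 * d) * 0) ^ d * 0 ^ d"
    by (rule LIMSEQ_le_const) (use le in blast)
  then have "prob (\<Inter>n. T n) \<le> 0" by (simp only: zero_power[OF d_pos] mult_zero_right)
  then have "prob (\<Inter>n. T n) = 0" by (simp add: measure_le_0_iff)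
  moreover have "(\<Inter>n. T n) \<in> sets P" by (intro sets.countable_INT) (use T in auto)
  ultimately have "AE \<omega> in P. \<omega> \<notin> (\<Inter>n. T n)" by (simp only: prob_eq_0)
  then show ?thesis
    using AE_space
  proof eventually_elim
    case (elim \<omega>)
    show ?case
    proof (safe, rule ccontr)
      fix x :: 'x and t :: real assume x: "x \<in> cball 0 R" and t: "0 \<le> t" and gt: "\<not> emeasure (\<eta> \<omega>) {(x, t)} \<le> 1"
      have "\<omega> \<in> T n" for n
      proof -
        let ?A = "{y. quant (1 / Suc n) y = quant (1 / Suc n) x} \<times> {0::real..}"
        have "?A \<in> sets (\<eta> \<omega>)"
          using box_marked[OF quant_cell_sets half_line_sets] counting_measureD(2)[OF counting_measure[OF elim(2)]] by simp
        then have "emeasure (\<eta> \<omega>) {(x, t)} \<le> emeasure (\<eta> \<omega>) ?A" using t by (intro emeasure_mono) auto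
        then have "emeasure (\<eta> \<omega>) ?A \<notin> {0, 1}" using gt by auto
        moreover have "x \<in> cball 0 ?R" using x by auto
        ultimately show ?thesis using elim(2) unfolding T_def by (intro UN_I[of "quant (1 / Suc n) x"]) auto
      qed
      then show False using elim(1) by blast
    qed
  qed
qed

lemma AE_good: "AE \<omega> in P. good_config (\<eta> \<omega>)"
proof -
  have "AE \<omega> in P. emeasure (\<eta> \<omega>) (cball (0::'x) (real n) \<times> {0..}) < \<infinity>" for n
  proof (rule count_finite)
    show "cball (0::'x) (real n) \<times> {0..} \<in> sets (borel_of marked_space)"
      by (intro box_marked half_line_sets) auto
    show "emeasure \<mu> (cball (0::'x) (real n) \<times> {0..}) < \<infinity>"
      by (rule measure_box(2)[OF _ half_line_sets emeasure_cball_vol]) auto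
  qed
  then have fin: "AE \<omega> in P. \<forall>n. emeasure (\<eta> \<omega>) (cball (0::'x) (real n) \<times> {0..}) < \<infinity>"
    by (simp add: AE_all_countable)
  have "AE \<omega> in P. \<forall>n. \<forall>p\<in>cball (0::'x) (real n) \<times> {0..}. emeasure (\<eta> \<omega>) {p} \<le> 1"
    unfolding AE_all_countable by (intro allI AE_simple)
  with fin show ?thesis using AE_space
  proof eventually_elim
    case (elim \<omega>)
    have "emeasure (\<eta> \<omega>) {p} \<le> 1" for p
    proof (cases "{p} \<in> sets (\<eta> \<omega>)")
      case True
      have "{p} \<subseteq> topspace marked_space"
        using sets.sets_into_space[OF True] counting_measureD(1)[OF counting_measure[OF elim(3)]] by simp
      then have "p \<in> UNIV \<times> {0..}" by (simp add: marked_space_def)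
      moreover obtain n :: nat where "norm (fst p) \<le> n" using real_arch_simple by blast
      ultimately have "p \<in> cball 0 n \<times> {0..}" by (auto simp: mem_Times_iff)
      then show ?thesis using elim(2) by blast
    qed (simp add: emeasure_notin_sets)
    then show ?case using elim counting_measure by (simp add: good_config_def)
  qed
qed

subsection \<open>Exceptional events\<close>

text \<open>Off \<open>huge_mark \<rho>\<close>, every point \<open>(y, t)\<close> satisfies \<open>t \<le> (norm y + \<rho>) / 6\<close>, so that points at
  distance of order \<open>\<rho>\<close> or more from the window cannot influence the cells of its points.\<close>

definition huge_mark :: "real \<Rightarrow> 'w set" where
  "huge_mark \<rho> = (\<Union>k::nat. {\<omega>\<in>space P. emeasure (\<eta> \<omega>) (cball 0 (2 ^ k * \<rho>) \<times> {2 ^ k * \<rho> / 12<..}) \<noteq> 0})"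

definition large_mark :: "real \<Rightarrow> real \<Rightarrow> real \<Rightarrow> 'w set" where
  "large_mark S T \<rho> = {\<omega>\<in>space P. emeasure (\<eta> \<omega>) (cball 0 (S * \<rho>) \<times> {T * q \<rho><..}) \<noteq> 0}"

text \<open>If two points are closer than h = g q, both lie within (d + 1) h of the lattice corner
  of the first: d h for the rounding and h for their distance. Balls around finitely many corners
  thus catch every such pair.\<close>

definition close_pair :: "real \<Rightarrow> real \<Rightarrow> real \<Rightarrow> real \<Rightarrow> 'w set" where
  "close_pair S g \<kappa> \<rho> = (\<Union>z\<in>quant (g * q \<rho>) ` cball 0 (S * \<rho>).
     {\<omega>\<in>space P. emeasure (\<eta> \<omega>) (cball z ((d + 1) * (g * q \<rho>)) \<times> {\<kappa> * q \<rho><..}) \<notin> {0, 1}})"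

definition empty_cell :: "real \<Rightarrow> real \<Rightarrow> real \<Rightarrow> 'w set" where
  "empty_cell S \<epsilon> \<rho> = (\<Union>z\<in>quant (\<epsilon> * q \<rho>) ` cball 0 (S * \<rho>).
     {\<omega>\<in>space P. emeasure (\<eta> \<omega>) ({x. quant (\<epsilon> * q \<rho>) x = z} \<times> {0..}) = 0})"

lemma count_events:
  assumes "A \<in> sets (borel_of marked_space)"
  shows "{\<omega>\<in>space P. emeasure (\<eta> \<omega>) A \<noteq> 0} \<in> sets P" "{\<omega>\<in>space P. emeasure (\<eta> \<omega>) A \<notin> {0, 1}} \<in> sets P"
proof -
  have "{\<omega>\<in>space P. emeasure (\<eta> \<omega>) A \<noteq> 0} = space P - {\<omega>\<in>space P. emeasure (\<eta> \<omega>) A = 0}" by auto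
  then show "{\<omega>\<in>space P. emeasure (\<eta> \<omega>) A \<noteq> 0} \<in> sets P" using count_event[OF assms] by simp
  have "{\<omega>\<in>space P. emeasure (\<eta> \<omega>) A \<notin> {0, 1}} = space P -
       ({\<omega>\<in>space P. emeasure (\<eta> \<omega>) A = 0} \<union> {\<omega>\<in>space P. emeasure (\<eta> \<omega>) A = 1})" by auto
  then show "{\<omega>\<in>space P. emeasure (\<eta> \<omega>) A \<notin> {0, 1}} \<in> sets P" using count_event[OF assms] by simp
qed

lemma ball_tail_sets:
  "0 \<le> u \<Longrightarrow> cball (c :: 'x) r \<times> {u<..} \<in> sets (borel_of marked_space)"
  by (intro box_marked Q.tail_sets) auto

lemma measure_ball_tail:
  assumes "0 \<le> r" "0 \<le> u"
  shows "measure \<mu> (cball (c :: 'x) r \<times> {u<..}) = \<gamma> * (vol * r ^ d) * Q.tail u"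
    "emeasure \<mu> (cball (c :: 'x) r \<times> {u<..}) < \<infinity>"
proof -
  have "0 \<le> vol * r ^ d" using assms by simp
  note m = measure_box[OF _ Q.tail_sets[OF assms(2)] emeasure_cball_vol[OF assms(1), of c] this]
  show "measure \<mu> (cball c r \<times> {u<..}) = \<gamma> * (vol * r ^ d) * Q.tail u" using m by (simp add: Q.tail_def)
  show "emeasure \<mu> (cball c r \<times> {u<..}) < \<infinity>" using m by simp
qed

text \<open>With d < \<beta> < \<alpha>, the k-th dyadic shell contributes at most of order (2^k
  \<rho>)^(d - \<beta>): a geometric series in k times a factor that vanishes as \<rho> grows.
  Taking \<rho> above \<open>12 * v\<close> makes the tail bound available already at k = 0.\<close>

lemma huge_mark_tendsto:
  shows "((\<lambda>\<rho>. prob (huge_mark \<rho>)) \<longlongrightarrow> 0) at_top"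
proof -
  define \<beta> where "\<beta> = (d + \<alpha>) / 2"
  have \<beta>: "0 < \<beta>" "\<beta> < \<alpha>" "d < \<beta>" using dim_less d_pos by (auto simp: \<beta>_def)
  obtain C v where C: "0 < C" "0 < v" "\<And>u. v \<le> u \<Longrightarrow> Q.tail u \<le> C * u powr (- \<beta>)"
    using Q.tail_upper_bound[OF \<beta>(1,2)] by metis
  define s where "s = 2 powr (d - \<beta>)"
  have s: "0 < s" "s < 1" using \<beta> powr_less_mono[of "d - \<beta>" 0 2] by (auto simp: s_def)
  define K where "K = \<gamma> * vol * C * 12 powr \<beta>"
  have K: "0 \<le> K" using gamma_pos C by (simp add: K_def)
  have le: "\<forall>\<^sub>F \<rho> in at_top. prob (huge_mark \<rho>) \<le> K * \<rho> powr (d - \<beta>) * (1 / (1 - s))"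
    using eventually_gt_at_top[of "12 * v"]
  proof eventually_elim
    case (elim \<rho>)
    have \<rho>: "0 < \<rho>" using elim C by auto
    let ?A = "\<lambda>k. cball (0::'x) (2 ^ k * \<rho>) \<times> {2 ^ k * \<rho> / 12<..}"
    let ?E = "\<lambda>k. {\<omega>\<in>space P. emeasure (\<eta> \<omega>) (?A k) \<noteq> 0}"
    have E: "?E k \<in> sets P" for k
      by (intro count_events ball_tail_sets) (use \<rho> in auto)
    have b: "prob (?E k) \<le> K * \<rho> powr (d - \<beta>) * s ^ k" for k
    proof -
      let ?r = "2 ^ k * \<rho>"
      have r: "0 < ?r" using \<rho> by simp
      have "\<rho> \<le> ?r" using \<rho> by simp
      then have v: "v \<le> ?r / 12" using elim by linarith
      have "prob (?E k) \<le> measure \<mu> (?A k)"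
        by (intro count_nonzero_le ball_tail_sets measure_ball_tail) (use \<rho> in auto)
      also have "\<dots> = \<gamma> * (vol * ?r ^ d) * Q.tail (?r / 12)"
        by (rule measure_ball_tail) (use \<rho> in auto)
      also have "\<dots> \<le> \<gamma> * (vol * ?r ^ d) * (C * (?r / 12) powr (- \<beta>))"
        using C(3)[OF v] gamma_pos \<rho> by (intro mult_left_mono) auto
      also have "\<dots> = K * (?r powr d * ?r powr (- \<beta>))"
        using r by (simp add: K_def powr_divide powr_minus powr_realpow divide_simps)
      also have "?r powr d * ?r powr (- \<beta>) = ?r powr (d - \<beta>)"
        using r by (simp flip: powr_add)
      also have "\<dots> = \<rho> powr (d - \<beta>) * s ^ k"
        using \<rho> by (simp add: powr_mult s_def powr_power mult.commute flip: powr_realpow)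
           (simp add: powr_powr mult.commute)
      finally show ?thesis by simp
    qed
    have sum: "(\<lambda>k. K * \<rho> powr (d - \<beta>) * s ^ k) sums (K * \<rho> powr (d - \<beta>) * (1 / (1 - s)))"
      by (intro sums_mult geometric_sums) (use s in auto)
    have summ: "summable (\<lambda>k. prob (?E k))"
      by (rule summable_comparison_test'[OF sums_summable[OF sum], of 0]) (use b in auto)
    have "prob (huge_mark \<rho>) \<le> (\<Sum>k. prob (?E k))"
      unfolding huge_mark_def by (rule finite_measure_subadditive_countably[OF _ summ]) (use E in auto)
    also have "\<dots> \<le> (\<Sum>k. K * \<rho> powr (d - \<beta>) * s ^ k)"
      by (rule suminf_le[OF b summ sums_summable[OF sum]])
    also have "\<dots> = K * \<rho> powr (d - \<beta>) * (1 / (1 - s))" using sum by (rule sums_unique[symmetric])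
    finally show ?case .
  qed
  have "((\<lambda>\<rho>. K * \<rho> powr (d - \<beta>) * (1 / (1 - s))) \<longlongrightarrow> K * 0 * (1 / (1 - s))) at_top"
    using \<beta> by (intro tendsto_mult tendsto_const tendsto_neg_powr filterlim_ident) auto
  then have "((\<lambda>\<rho>. K * \<rho> powr (d - \<beta>) * (1 / (1 - s))) \<longlongrightarrow> 0) at_top" by simp
  from tendsto_sandwich[OF _ le tendsto_const this] show ?thesis by simp
qed

text \<open>The expected number of these points tends to vol S^d T^(-\<alpha>), which is positive in
  general. Smallness comes from the choice of T and not from \<rho>, so the target \<open>e\<close>
  enters the hypothesis.\<close>

lemma large_mark_tendsto:
  assumes "0 \<le> S" "0 < T" and lt: "vol * S ^ d * T powr (- \<alpha>) < e"
  shows "\<forall>\<^sub>F \<rho> in at_top. prob (large_mark S T \<rho>) < e"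
proof -
  have "((\<lambda>\<rho>. vol * S ^ d * (\<gamma> * \<rho> ^ d * Q.tail (T * q \<rho>))) \<longlongrightarrow> vol * S ^ d * T powr (- \<alpha>)) at_top"
    by (intro tendsto_mult tendsto_const tail_q_asymp assms)
  then have "\<forall>\<^sub>F \<rho> in at_top. vol * S ^ d * (\<gamma> * \<rho> ^ d * Q.tail (T * q \<rho>)) < e"
    by (rule order_tendstoD(2)) (rule lt)
  with q_pos[of 0] eventually_gt_at_top[of 0] show ?thesis
  proof eventually_elim
    case (elim \<rho>)
    have "prob (large_mark S T \<rho>) \<le> measure \<mu> (cball (0::'x) (S * \<rho>) \<times> {T * q \<rho><..})"
      unfolding large_mark_def
      by (intro count_nonzero_le ball_tail_sets measure_ball_tail) (use assms elim in auto)
    also have "\<dots> = \<gamma> * (vol * (S * \<rho>) ^ d) * Q.tail (T * q \<rho>)"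
      by (rule measure_ball_tail) (use assms elim in auto)
    also have "\<dots> = vol * S ^ d * (\<gamma> * \<rho> ^ d * Q.tail (T * q \<rho>))" by (simp add: power_mult_distrib)
    also have "\<dots> < e" by (rule elim)
    finally show ?case .
  qed
qed

text \<open>About (\<rho>/h)^d corners, each with probability of order (h^d tail)^2, give (\<rho>^d
  tail)^2 (h/\<rho>)^d. The first factor converges and the second vanishes because q =
  o(\<rho>).\<close>

lemma close_pair_tendsto:
  assumes "0 \<le> S" "0 < g" "0 < \<kappa>"
  shows "((\<lambda>\<rho>. prob (close_pair S g \<kappa> \<rho>)) \<longlongrightarrow> 0) at_top"
proof -
  define K where "K = vol * (S + 2 * d) ^ d * vol\<^sup>2 * ((d + 1) ^ d)\<^sup>2"
  let ?f = "\<lambda>\<rho>. K * (\<gamma> * \<rho> ^ d * Q.tail (\<kappa> * q \<rho>))\<^sup>2 * (g * (q \<rho> / \<rho>)) ^ d"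
  have "\<forall>\<^sub>F \<rho> in at_top. q \<rho> / \<rho> < 1 / g"
    by (rule order_tendstoD(2)[OF q_over_rho]) (use assms in simp)
  then have le: "\<forall>\<^sub>F \<rho> in at_top. prob (close_pair S g \<kappa> \<rho>) \<le> ?f \<rho>"
    using q_pos[of 0] eventually_gt_at_top[of 0]
  proof eventually_elim
    case (elim \<rho>)
    define h where "h = g * q \<rho>"
    have h: "0 < h" "h \<le> \<rho>" using elim assms by (auto simp: h_def field_simps)
    let ?Z = "quant h ` cball (0::'x) (S * \<rho>)"
    let ?A = "\<lambda>z. cball (z::'x) ((d + 1) * h) \<times> {\<kappa> * q \<rho><..}"
    have fin: "finite ?Z" by (rule finite_quant_image) simp
    have A: "?A z \<in> sets (borel_of marked_space)" for z
      by (rule ball_tail_sets) (use assms elim in auto)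
    have m: "measure \<mu> (?A z) = \<gamma> * (vol * ((d + 1) * h) ^ d) * Q.tail (\<kappa> * q \<rho>)" "emeasure \<mu> (?A z) < \<infinity>" for z
      by (rule measure_ball_tail; use assms elim h in auto)+
    have "prob (close_pair S g \<kappa> \<rho>) \<le> (\<Sum>z\<in>?Z. prob {\<omega>\<in>space P. emeasure (\<eta> \<omega>) (?A z) \<notin> {0, 1}})"
      unfolding close_pair_def h_def[symmetric]
      by (rule finite_measure_subadditive_finite[OF fin]) (use count_events[OF A] in auto)
    also have "\<dots> \<le> (\<Sum>z\<in>?Z. (\<gamma> * (vol * ((d + 1) * h) ^ d) * Q.tail (\<kappa> * q \<rho>))\<^sup>2)"
      using count_multiple_le[OF A m(2)] unfolding m(1) by (intro sum_mono)
    also have "\<dots> = (real (card ?Z) * h ^ d) * (vol\<^sup>2 * ((d + 1) ^ d)\<^sup>2 * (\<gamma> * Q.tail (\<kappa> * q \<rho>))\<^sup>2 * h ^ d)"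
      by (simp add: power_mult_distrib power2_eq_square mult_ac)
    also have "\<dots> \<le> (vol * ((S + 2 * d) * \<rho>) ^ d) * (vol\<^sup>2 * ((d + 1) ^ d)\<^sup>2 * (\<gamma> * Q.tail (\<kappa> * q \<rho>))\<^sup>2 * h ^ d)"
    proof (rule mult_right_mono)
      have "real (card ?Z) * h ^ d \<le> vol * (S * \<rho> + 2 * d * h) ^ d"
        using card_quant_image_le[where 'a = 'x, OF h(1), of "S * \<rho>"] assms elim
        by (simp add: vol_def dim)
      also have "\<dots> \<le> vol * ((S + 2 * d) * \<rho>) ^ d"
      proof (intro mult_left_mono power_mono)
        have "2 * d * h \<le> 2 * d * \<rho>" using h by (intro mult_left_mono) auto
        then show "S * \<rho> + 2 * d * h \<le> (S + 2 * d) * \<rho>" by (simp add: algebra_simps)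
      qed (use assms elim h in auto)
      finally show "real (card ?Z) * h ^ d \<le> vol * ((S + 2 * d) * \<rho>) ^ d" .
    qed (use h in auto)
    also have "\<dots> = K * (\<gamma> * \<rho> ^ d * Q.tail (\<kappa> * q \<rho>))\<^sup>2 * (h / \<rho>) ^ d"
      using elim by (simp add: K_def power_mult_distrib power_divide power2_eq_square)
    finally show ?case by (simp add: h_def)
  qed
  have "(?f \<longlongrightarrow> K * (\<kappa> powr (- \<alpha>))\<^sup>2 * (g * 0) ^ d) at_top"
    by (intro tendsto_intros tail_q_asymp q_over_rho assms)
  then have "(?f \<longlongrightarrow> 0) at_top" using d_pos by (simp only: mult_zero_right zero_power)
  from tendsto_sandwich[OF _ le tendsto_const this] show ?thesis by simp
qed

text \<open>A cube of side h = \<epsilon> q is empty with probability exp(-\<gamma> h^d). Once h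
  \<ge> 1 there are at most of order \<rho>^d cubes, and \<open>rho_exp_q\<close> applies.\<close>

lemma empty_cell_tendsto:
  assumes "0 \<le> S" "0 < \<epsilon>"
  shows "((\<lambda>\<rho>. prob (empty_cell S \<epsilon> \<rho>)) \<longlongrightarrow> 0) at_top"
proof -
  define K where "K = vol * (S + 2 * d) ^ d"
  let ?f = "\<lambda>\<rho>. K * (\<rho> ^ d * exp (- (\<gamma> * \<epsilon> ^ d) * q \<rho> ^ d))"
  have "\<forall>\<^sub>F \<rho> in at_top. q \<rho> / \<rho> < 1 / \<epsilon>"
    by (rule order_tendstoD(2)[OF q_over_rho]) (use assms in simp)
  then have le: "\<forall>\<^sub>F \<rho> in at_top. prob (empty_cell S \<epsilon> \<rho>) \<le> ?f \<rho>"
    using q_pos[of 0] q_pos[of "1 / \<epsilon>"] eventually_gt_at_top[of 0]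
  proof eventually_elim
    case (elim \<rho>)
    define h where "h = \<epsilon> * q \<rho>"
    have h: "1 \<le> h" "h \<le> \<rho>" "0 < h" using elim assms by (auto simp: h_def field_simps)
    let ?Z = "quant h ` cball (0::'x) (S * \<rho>)"
    let ?A = "\<lambda>z. {x::'x. quant h x = z} \<times> {0::real..}"
    have fin: "finite ?Z" by (rule finite_quant_image) simp
    have A: "?A z \<in> sets (borel_of marked_space)" for z
      by (rule box_marked[OF quant_cell_sets half_line_sets])
    have p: "prob {\<omega>\<in>space P. emeasure (\<eta> \<omega>) (?A z) = 0} = exp (- \<gamma> * h ^ d)" if "z \<in> ?Z" for z
    proof -
      have e: "emeasure lborel {x::'x. quant h x = z} = ennreal (h ^ d)"
        using emeasure_quant_cell[of h z] h that by (auto simp: dim)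
      have "0 \<le> h ^ d" using h by simp
      note m = measure_box[OF quant_cell_sets half_line_sets e this]
      show ?thesis using count_zero[OF A m(2)] unfolding m(1) by (simp add: measure_half_line)
    qed
    have "prob (empty_cell S \<epsilon> \<rho>) \<le> (\<Sum>z\<in>?Z. prob {\<omega>\<in>space P. emeasure (\<eta> \<omega>) (?A z) = 0})"
      unfolding empty_cell_def h_def[symmetric]
      by (rule finite_measure_subadditive_finite[OF fin]) (use count_event[OF A] in auto)
    also have "\<dots> = real (card ?Z) * exp (- \<gamma> * h ^ d)" by (simp add: p)
    also have "\<dots> \<le> (vol * ((S + 2 * d) * \<rho>) ^ d) * exp (- \<gamma> * h ^ d)"
    proof (rule mult_right_mono)
      have "real (card ?Z) * 1 \<le> real (card ?Z) * h ^ d"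
        using h by (intro mult_left_mono) auto
      also have "real (card ?Z) * h ^ d \<le> vol * (S * \<rho> + 2 * d * h) ^ d"
        using card_quant_image_le[where 'a = 'x, OF h(3), of "S * \<rho>"] assms elim
        by (simp add: vol_def dim)
      also have "\<dots> \<le> vol * ((S + 2 * d) * \<rho>) ^ d"
      proof (intro mult_left_mono power_mono)
        have "2 * d * h \<le> 2 * d * \<rho>" using h by (intro mult_left_mono) auto
        then show "S * \<rho> + 2 * d * h \<le> (S + 2 * d) * \<rho>" by (simp add: algebra_simps)
      qed (use assms elim h in auto)
      finally show "real (card ?Z) \<le> vol * ((S + 2 * d) * \<rho>) ^ d" by simp
    qed simp
    finally show ?case by (simp add: K_def h_def power_mult_distrib mult.assoc)
  qed
  have "(?f \<longlongrightarrow> K * 0) at_top"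
    using assms gamma_pos by (intro tendsto_mult tendsto_const rho_exp_q) auto
  then have "(?f \<longlongrightarrow> 0) at_top" by simp
  from tendsto_sandwich[OF _ le tendsto_const this] show ?thesis by simp
qed

end

section \<open>Deterministic consequences of avoiding the exceptional events\<close>

context marked_poisson
begin

lemma close_pair_sets:
  assumes "0 \<le> \<kappa> * q \<rho>"
  shows "close_pair S g \<kappa> \<rho> \<in> sets P"
  unfolding close_pair_def
  by (intro sets.finite_UN finite_quant_image bounded_cball count_events ball_tail_sets assms)

lemma empty_cell_sets: "empty_cell S \<epsilon> \<rho> \<in> sets P"
  unfolding empty_cell_def
  by (intro sets.finite_UN finite_quant_image bounded_cball count_event box_marked quant_cell_sets half_line_sets)

lemma large_mark_sets: "0 \<le> T * q \<rho> \<Longrightarrow> large_mark S T \<rho> \<in> sets P"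
  unfolding large_mark_def by (intro count_events ball_tail_sets)

lemma huge_mark_sets:
  assumes "0 \<le> \<rho>"
  shows "huge_mark \<rho> \<in> sets P"
proof -
  have "{\<omega>\<in>space P. emeasure (\<eta> \<omega>) (cball 0 (2 ^ k * \<rho>) \<times> {2 ^ k * \<rho> / 12<..}) \<noteq> 0} \<in> sets P" for k :: nat
    by (rule count_events(1)[OF ball_tail_sets]) (use assms in simp)
  then show ?thesis unfolding huge_mark_def by blast
qed

lemma points_nonneg:
  assumes "\<omega> \<in> space P" "(y, t) \<in> points (\<eta> \<omega>)"
  shows "0 \<le> t"
  using assms(2) counting_measureD(1)[OF counting_measure[OF assms(1)]] by (auto simp: points_def marked_space_def)

text \<open>A dyadic radius can be chosen with |y| \<le> 2^k \<rho> \<le> 2 (|y| + \<rho>). A mark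
  above (|y| + \<rho>)/6 then exceeds 2^k \<rho>/12, which explains the 12 in
  \<open>huge_mark\<close>.\<close>

lemma not_huge_mark:
  assumes \<omega>: "\<omega> \<in> space P" "\<omega> \<notin> huge_mark \<rho>" and \<rho>: "0 < \<rho>" and p: "(y, t) \<in> points (\<eta> \<omega>)"
  shows "t \<le> (norm y + \<rho>) / 6"
proof (rule ccontr)
  assume *: "\<not> t \<le> (norm y + \<rho>) / 6"
  have "\<exists>k::nat. norm y \<le> 2 ^ k * \<rho> \<and> 2 ^ k * \<rho> \<le> max \<rho> (2 * norm y)"
  proof (cases "norm y \<le> \<rho>")
    case True
    then show ?thesis by (intro exI[of _ 0]) auto
  next
    case False
    then obtain k where k: "2 ^ k * \<rho> \<le> norm y" "norm y \<le> 2 ^ Suc k * \<rho>"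
      using Q.dyadic_interval[OF \<rho>, of "norm y"] by auto
    show ?thesis by (intro exI[of _ "Suc k"]) (use k in auto)
  qed
  then obtain k :: nat where k: "norm y \<le> 2 ^ k * \<rho>" "2 ^ k * \<rho> \<le> max \<rho> (2 * norm y)" by blast
  have "2 ^ k * \<rho> / 12 < t" 
  proof -
    have "max \<rho> (2 * norm y) \<le> 2 * norm y + 2 * \<rho>" using \<rho> by simp
    moreover have "norm y + \<rho> < 6 * t" using * by simp
    ultimately have "2 ^ k * \<rho> < 12 * t" using k(2) by linarith
    then show ?thesis by simp
  qed
  then have "(y, t) \<in> cball 0 (2 ^ k * \<rho>) \<times> {2 ^ k * \<rho> / 12<..}" using k by simp
  then have "emeasure (\<eta> \<omega>) (cball 0 (2 ^ k * \<rho>) \<times> {2 ^ k * \<rho> / 12<..}) \<noteq> 0"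
  proof (rule points_emeasure_nonzero[OF counting_measure[OF \<omega>(1)] p])
    have u: "0 \<le> 2 ^ k * \<rho> / 12" using \<rho> by simp
    then show "cball 0 (2 ^ k * \<rho>) \<times> {2 ^ k * \<rho> / 12<..} \<in> sets borel" by (intro box_sets Q.tail_sets) auto
    have "{2 ^ k * \<rho> / 12<..} \<subseteq> {0..}"
    proof
      fix b assume "b \<in> {2 ^ k * \<rho> / 12<..}"
      then have "2 ^ k * \<rho> / 12 < b" by simp
      with u have "0 \<le> b" by (rule order_trans[OF _ less_imp_le])
      then show "b \<in> {0..}" by simp
    qed
    then show "cball 0 (2 ^ k * \<rho>) \<times> {2 ^ k * \<rho> / 12<..} \<subseteq> UNIV \<times> {0..}" by blast
  qed
  then show False using \<omega> unfolding huge_mark_def by blast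
qed

lemma not_large_mark:
  assumes \<omega>: "\<omega> \<in> space P" "\<omega> \<notin> large_mark S T \<rho>" and T: "0 \<le> T * q \<rho>"
    and p: "(y, t) \<in> points (\<eta> \<omega>)" and y: "norm y \<le> S * \<rho>"
  shows "t \<le> T * q \<rho>"
proof (rule ccontr)
  assume "\<not> t \<le> T * q \<rho>"
  then have "(y, t) \<in> cball 0 (S * \<rho>) \<times> {T * q \<rho><..}" using y by simp
  then have "emeasure (\<eta> \<omega>) (cball 0 (S * \<rho>) \<times> {T * q \<rho><..}) \<noteq> 0"
    using T by (intro points_emeasure_nonzero[OF counting_measure[OF \<omega>(1)] p] box_sets Q.tail_sets) auto
  then show False using \<omega> unfolding large_mark_def by blast
qed

lemma not_close_pair:
  assumes \<omega>: "\<omega> \<in> space P" "\<omega> \<notin> close_pair S g \<kappa> \<rho>" and g: "0 < g * q \<rho>" and \<kappa>: "0 \<le> \<kappa> * q \<rho>"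
    and p: "(x, m) \<in> points (\<eta> \<omega>)" "(y, t) \<in> points (\<eta> \<omega>)" "(x, m) \<noteq> (y, t)"
    and x: "norm x \<le> S * \<rho>" and marks: "\<kappa> * q \<rho> < m" "\<kappa> * q \<rho> < t"
  shows "g * q \<rho> \<le> norm (y - x)"
proof (rule ccontr)
  assume *: "\<not> g * q \<rho> \<le> norm (y - x)"
  let ?h = "g * q \<rho>"
  let ?z = "quant ?h x"
  let ?A = "cball ?z ((d + 1) * ?h) \<times> {\<kappa> * q \<rho><..}"
  have xz: "norm (x - ?z) \<le> d * ?h" using norm_diff_quant[OF g, of x] by (simp add: dim)
  have yz: "norm (y - ?z) \<le> (d + 1) * ?h"
    using norm_triangle_ineq[of "y - x" "x - ?z"] xz * by (simp add: algebra_simps)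
  have xz': "norm (x - ?z) \<le> (d + 1) * ?h" using xz g by (simp add: algebra_simps)
  have "(x, m) \<in> ?A" "(y, t) \<in> ?A"
    using xz' yz marks by (simp_all add: dist_norm norm_minus_commute)
  then have "emeasure (\<eta> \<omega>) ?A \<notin> {0, 1}"
    using p \<kappa> by (intro points_emeasure_multiple[OF counting_measure[OF \<omega>(1)] p(1) _ p(2) _ p(3)] box_sets Q.tail_sets) auto
  moreover have "?z \<in> quant ?h ` cball 0 (S * \<rho>)" using x by auto
  ultimately show False using \<omega> unfolding close_pair_def by blast
qed

lemma not_empty_cell:
  assumes \<omega>: "\<omega> \<in> space P" "\<omega> \<notin> empty_cell S \<epsilon> \<rho>" "good_config (\<eta> \<omega>)" and \<epsilon>: "0 < \<epsilon> * q \<rho>"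
    and x: "norm x \<le> S * \<rho>"
  obtains y t where "(y, t) \<in> points (\<eta> \<omega>)" "norm (y - x) \<le> 2 * d * (\<epsilon> * q \<rho>)"
proof -
  let ?h = "\<epsilon> * q \<rho>"
  let ?A = "{y. quant ?h y = quant ?h x} \<times> {0::real..}"
  have "quant ?h x \<in> quant ?h ` cball 0 (S * \<rho>)" using x by auto
  then have ne: "emeasure (\<eta> \<omega>) ?A \<noteq> 0" using \<omega>(1,2) unfolding empty_cell_def by blast
  have close: "norm (y - x) \<le> 2 * d * ?h" if "quant ?h y = quant ?h x" for y
  proof -
    have "norm (y - x) \<le> norm (y - quant ?h y) + norm (quant ?h x - x)"
      using norm_triangle_ineq[of "y - quant ?h y" "quant ?h x - x"] that by simp
    then show ?thesis using norm_diff_quant[OF \<epsilon>, of y] norm_diff_quant[OF \<epsilon>, of x]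
      by (simp add: dim norm_minus_commute)
  qed
  have "{y. quant ?h y = quant ?h x} \<subseteq> cball x (2 * d * ?h)"
    using close by (auto simp: dist_norm norm_minus_commute)
  then have b: "bounded {y. quant ?h y = quant ?h x}" using bounded_cball bounded_subset by blast
  have "emeasure (\<eta> \<omega>) ?A = of_nat (card (points (\<eta> \<omega>) \<inter> ?A))"
    by (rule good_config_count(2)[OF \<omega>(3) box_sets[OF quant_cell_sets half_line_sets] subset_refl b])
  then have "points (\<eta> \<omega>) \<inter> ?A \<noteq> {}" using ne by (metis card.empty of_nat_0)
  then obtain y t where "(y, t) \<in> points (\<eta> \<omega>)" "quant ?h y = quant ?h x" by auto
  then show ?thesis using close that by blast
qed

text \<open>Off the four exceptional events the hypotheses of \<open>inradius_close_to_mark\<close>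
  hold simultaneously for all points of the window with mark at least b q. The events depend on
  \<delta>, b and e only through the constants fixed at the start of the proof.\<close>

lemma inradius_close_event:
  fixes W :: "'x set"
  assumes w: "1 \<le> w" "W \<subseteq> cball 0 w" and b: "0 < b" and \<delta>: "0 < \<delta>" "\<delta> \<le> 1/2" and e: "0 < e"
  shows "\<exists>Bad. \<forall>\<^sub>F \<rho> in at_top. Bad \<rho> \<in> sets P \<and> prob (Bad \<rho>) \<le> e \<and>
     (\<forall>\<omega>\<in>space P - Bad \<rho>. good_config (\<eta> \<omega>) \<longrightarrow>
       (\<forall>x m. (x, m) \<in> points (\<eta> \<omega>) \<and> x \<in> (\<lambda>x. \<rho> *\<^sub>R x) ` W \<and> b * q \<rho> \<le> m \<longrightarrow>
         ennreal ((1 - \<delta>) * m) \<le> inradius (x, m) (points (\<eta> \<omega>)) \<and>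
         inradius (x, m) (points (\<eta> \<omega>)) \<le> ennreal ((1 + \<delta>) * m)))"
proof -
  \<comment> \<open>The window has radius at most w \<rho>, and points within (w + 1) \<rho> of it
    lie in the ball of radius (2 w + 1) \<rho>.\<close>
  define S where "S = 2 * w + 1"
  have S: "0 \<le> S" using w by (simp add: S_def)
  \<comment> \<open>Chosen so that (\<kappa> q)^2 = \<delta>^2 (b q)^2 \<le> \<delta> m^2 for every
    mark m \<ge> b q.\<close>
  define \<kappa> where "\<kappa> = \<delta> * b"
  have \<kappa>: "0 < \<kappa>" "\<kappa> < b" using \<delta> b by (auto simp: \<kappa>_def)
  \<comment> \<open>A point found in the cube of a given location is within 2 d \<epsilon> q =
    \<delta> b q \<le> \<delta> m of it.\<close>
  define \<epsilon> where "\<epsilon> = \<delta> * b / (2 * d)"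
  have \<epsilon>: "0 < \<epsilon>" using \<delta> b d_pos by (simp add: \<epsilon>_def)
  have "((\<lambda>T. vol * S ^ d * T powr (- \<alpha>)) \<longlongrightarrow> vol * S ^ d * 0) at_top"
    using alpha_pos by (intro tendsto_mult tendsto_const tendsto_neg_powr filterlim_ident) auto
  then have "\<forall>\<^sub>F T in at_top. vol * S ^ d * T powr (- \<alpha>) < e / 4"
    by (rule order_tendstoD(2)) (use e in simp)
  then have "\<forall>\<^sub>F T in at_top. vol * S ^ d * T powr (- \<alpha>) < e / 4 \<and> 0 < T"
    using eventually_gt_at_top[of 0] by eventually_elim simp
  then obtain T where T: "vol * S ^ d * T powr (- \<alpha>) < e / 4" "0 < T"
    by (auto simp: eventually_at_top_linorder)
  \<comment> \<open>Marks that are not large are at most T q, so a separation of 3 T q is at least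
    three times the larger of two such marks; hence the argument \<open>3 * T\<close>. Each of the
    four events receives a quarter of \<open>e\<close>.\<close>
  define Bad where "Bad \<rho> = huge_mark \<rho> \<union> large_mark S T \<rho> \<union> close_pair S (3 * T) \<kappa> \<rho> \<union> empty_cell S \<epsilon> \<rho>" for \<rho>
  have e4: "0 < e / 4" using e by simp
  have T3: "0 < 3 * T" using T by simp
  have ev: "\<forall>\<^sub>F \<rho> in at_top. prob (huge_mark \<rho>) < e / 4 \<and> prob (large_mark S T \<rho>) < e / 4 \<and>
     prob (close_pair S (3 * T) \<kappa> \<rho>) < e / 4 \<and> prob (empty_cell S \<epsilon> \<rho>) < e / 4 \<and> 0 < q \<rho> \<and> 0 < \<rho>"
    using order_tendstoD(2)[OF huge_mark_tendsto e4] large_mark_tendsto[OF S T(2,1)]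
      order_tendstoD(2)[OF close_pair_tendsto[OF S T3 \<kappa>(1)] e4]
      order_tendstoD(2)[OF empty_cell_tendsto[OF S \<epsilon>] e4] q_pos[of 0] eventually_gt_at_top[of 0]
    by eventually_elim simp
  show ?thesis
  proof (rule exI[of _ Bad], rule eventually_mono[OF ev], intro conjI ballI impI allI)
    fix \<rho>
    assume *: "prob (huge_mark \<rho>) < e / 4 \<and> prob (large_mark S T \<rho>) < e / 4 \<and>
     prob (close_pair S (3 * T) \<kappa> \<rho>) < e / 4 \<and> prob (empty_cell S \<epsilon> \<rho>) < e / 4 \<and> 0 < q \<rho> \<and> 0 < \<rho>"
    then have q: "0 < q \<rho>" and \<rho>: "0 < \<rho>" by auto
    have sets: "huge_mark \<rho> \<in> sets P" "large_mark S T \<rho> \<in> sets P" "close_pair S (3 * T) \<kappa> \<rho> \<in> sets P"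
       "empty_cell S \<epsilon> \<rho> \<in> sets P"
      using q \<rho> T \<kappa> by (simp_all add: huge_mark_sets large_mark_sets close_pair_sets empty_cell_sets)
    then show "Bad \<rho> \<in> sets P" by (simp add: Bad_def)
    have "prob (Bad \<rho>) \<le> prob (huge_mark \<rho>) + prob (large_mark S T \<rho>) + prob (close_pair S (3 * T) \<kappa> \<rho>)
       + prob (empty_cell S \<epsilon> \<rho>)"
      unfolding Bad_def using measure_Un_le[OF sets(1,2)] measure_Un_le[OF sets.Un[OF sets(1,2)] sets(3)]
        measure_Un_le[OF sets.Un[OF sets.Un[OF sets(1,2)] sets(3)] sets(4)] by linarith
    then show "prob (Bad \<rho>) \<le> e" using * by linarith
    fix \<omega> x m
    assume \<omega>: "\<omega> \<in> space P - Bad \<rho>" and good: "good_config (\<eta> \<omega>)"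
      and p: "(x, m) \<in> points (\<eta> \<omega>) \<and> x \<in> (\<lambda>x. \<rho> *\<^sub>R x) ` W \<and> b * q \<rho> \<le> m"
    have \<omega>': "\<omega> \<in> space P" "\<omega> \<notin> huge_mark \<rho>" "\<omega> \<notin> large_mark S T \<rho>" "\<omega> \<notin> close_pair S (3 * T) \<kappa> \<rho>"
        "\<omega> \<notin> empty_cell S \<epsilon> \<rho>"
      using \<omega> by (auto simp: Bad_def)
    have "0 < b * q \<rho>" using b q by simp
    then have m: "0 < m" using p by linarith
    obtain x0 where x0: "x = \<rho> *\<^sub>R x0" "x0 \<in> W" using p by blast
    have "norm x0 \<le> w" using x0 w by auto
    then have x: "norm x \<le> w * \<rho>" using x0 \<rho> by (simp add: mult.commute)
    have m_le: "6 * m \<le> w * \<rho> + \<rho>"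
      using not_huge_mark[OF \<omega>'(1,2) \<rho>, of x m] p x by (simp add: algebra_simps)
    have xS: "norm x \<le> S * \<rho>"
    proof -
      have "w * \<rho> \<le> S * \<rho>" using w \<rho> by (intro mult_right_mono) (auto simp: S_def)
      then show ?thesis using x by linarith
    qed
    have "(\<kappa> * q \<rho>)\<^sup>2 = \<delta>\<^sup>2 * (b * q \<rho>)\<^sup>2" by (simp add: \<kappa>_def power_mult_distrib)
    also have "\<dots> \<le> \<delta> * m\<^sup>2"
    proof (rule mult_mono)
      show "\<delta>\<^sup>2 \<le> \<delta>" using \<delta> by (simp add: power2_eq_square)
      show "(b * q \<rho>)\<^sup>2 \<le> m\<^sup>2" using p b q by (intro power_mono) auto
    qed (use \<delta> in auto)
    finally have \<kappa>m: "(\<kappa> * q \<rho>)\<^sup>2 \<le> \<delta> * m\<^sup>2" .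
    have marks: "0 \<le> t" if "(y, t) \<in> points (\<eta> \<omega>)" for y t
      by (rule points_nonneg[OF \<omega>'(1) that])
    have sep: "t \<le> \<kappa> * q \<rho> \<or> 3 * max m t \<le> norm (y - x)"
      if y: "(y, t) \<in> points (\<eta> \<omega>)" "(y, t) \<noteq> (x, m)" for y t
    proof (rule disjCI)
      assume far: "\<not> 3 * max m t \<le> norm (y - x)"
      show "t \<le> \<kappa> * q \<rho>"
      proof (rule ccontr)
        assume t: "\<not> t \<le> \<kappa> * q \<rho>"
        have ny: "norm y \<le> norm (y - x) + norm x" using norm_triangle_ineq[of "y - x" x] by simp
        have t6: "6 * t \<le> norm y + \<rho>" using not_huge_mark[OF \<omega>'(1,2) \<rho> y(1)] by simp
        have wr: "(w + 1) * \<rho> = w * \<rho> + \<rho>" "S * \<rho> = 2 * (w * \<rho>) + \<rho>" by (simp_all add: S_def algebra_simps)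
        \<comment> \<open>Beyond this distance D, the bound off \<open>huge_mark\<close> gives 6 t
          \<le> |y| + \<rho> \<le> D + (w + 1) \<rho> \<le> 2 D and likewise 6 m \<le> D, so such a
          point is separated from x in any case.\<close>
        have D: "norm (y - x) < (w + 1) * \<rho>"
        proof (rule ccontr)
          assume D: "\<not> norm (y - x) < (w + 1) * \<rho>"
          have "3 * t \<le> norm (y - x)" using t6 ny x D wr by linarith
          moreover have "3 * m \<le> norm (y - x)" using m_le D wr m by linarith
          ultimately show False using far by auto
        qed
        have yS: "norm y \<le> S * \<rho>" using ny x D wr by linarith
        have Tq: "0 \<le> T * q \<rho>" using T q by simp
        have "m \<le> T * q \<rho>" using not_large_mark[OF \<omega>'(1,3) Tq _ xS] p by blast
        moreover have "t \<le> T * q \<rho>" by (rule not_large_mark[OF \<omega>'(1,3) Tq y(1) yS])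
        moreover have "3 * T * q \<rho> \<le> norm (y - x)"
        proof (rule not_close_pair[OF \<omega>'(1,4)])
          show "\<kappa> * q \<rho> < m"
          proof -
            have "\<kappa> * q \<rho> < b * q \<rho>" using \<kappa> q by simp
            then show ?thesis using p by linarith
          qed
        qed (use T q \<kappa> p y t xS in auto)
        ultimately show False using far by auto
      qed
    qed
    \<comment> \<open>Any unit vector serves: the cube of x + m v is not empty, and the point in it
      lies in the shell around x.\<close>
    obtain v :: 'x where v: "v \<in> Basis" using nonempty_Basis by blast
    have nv: "norm v = 1" using v by simp
    have "norm (x + m *\<^sub>R v) \<le> norm x + m" using norm_triangle_ineq[of x "m *\<^sub>R v"] nv m by simp
    also have "\<dots> \<le> S * \<rho>"
    proof -
      have "0 \<le> w * \<rho>" using w \<rho> by simp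
      moreover have "(w + 1) * \<rho> = w * \<rho> + \<rho>" "S * \<rho> = 2 * (w * \<rho>) + \<rho>" by (simp_all add: S_def algebra_simps)
      ultimately show ?thesis using x m_le \<rho> by linarith
    qed
    finally have vS: "norm (x + m *\<^sub>R v) \<le> S * \<rho>" .
    have \<epsilon>q: "0 < \<epsilon> * q \<rho>" using \<epsilon> q by simp
    obtain y t where y: "(y, t) \<in> points (\<eta> \<omega>)" "norm (y - (x + m *\<^sub>R v)) \<le> 2 * d * (\<epsilon> * q \<rho>)"
      using not_empty_cell[OF \<omega>'(1,5) good \<epsilon>q vS] by blast
    have "2 * d * (\<epsilon> * q \<rho>) = \<delta> * (b * q \<rho>)" using d_pos by (simp add: \<epsilon>_def)
    also have "\<dots> \<le> \<delta> * m" using p \<delta> by (intro mult_left_mono) auto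
    finally have y2: "norm (y - (x + m *\<^sub>R v)) \<le> \<delta> * m" using y(2) by linarith
    have nm: "norm (m *\<^sub>R v) = m" using nv m by simp
    have "norm (y - x) \<le> norm (y - (x + m *\<^sub>R v)) + m"
      using norm_triangle_ineq[of "y - (x + m *\<^sub>R v)" "m *\<^sub>R v"] nm by simp
    moreover have "m \<le> norm (y - x) + norm (y - (x + m *\<^sub>R v))"
      using norm_triangle_ineq4[of "y - x" "y - (x + m *\<^sub>R v)"] nm by simp
    ultimately have "(1 - \<delta>) * m \<le> norm (y - x) \<and> norm (y - x) \<le> (1 + \<delta>) * m"
      using y2 by (simp add: algebra_simps)
    then have shell: "\<exists>(y, t)\<in>points (\<eta> \<omega>). (1 - \<delta>) * m \<le> norm (y - x) \<and> norm (y - x) \<le> (1 + \<delta>) * m"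
      using y(1) by blast
    show "ennreal ((1 - \<delta>) * m) \<le> inradius (x, m) (points (\<eta> \<omega>))"
      by (rule inradius_close_to_mark(1)[OF \<delta> m \<kappa>m marks sep shell])
    show "inradius (x, m) (points (\<eta> \<omega>)) \<le> ennreal ((1 + \<delta>) * m)"
      by (rule inradius_close_to_mark(2)[OF \<delta> m \<kappa>m marks sep shell])
  qed
qed

end

section \<open>Measurability in the vague topology\<close>

definition box_set :: "'a::euclidean_space set \<Rightarrow> 'a set \<Rightarrow> real set \<Rightarrow> real set \<Rightarrow> ('a \<times> ennreal \<times> ennreal) set" where
  "box_set W S1 S2 S3 = {p \<in> topspace (limit_space W). fst p \<in> S1 \<and> recip (fst (snd p)) \<in> S2 \<and> recip (snd (snd p)) \<in> S3}"

lemma recip_map_preimage_sets: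
  assumes "A \<in> sets borel"
  shows "{p \<in> topspace (limit_space W). recip_map p \<in> A} \<in> sets (borel_of (limit_space W))"
  using measurable_sets[OF recip_map_measurable assms, of W] by (simp add: vimage_def Int_def conj_commute)

lemma box_set_sets:
  assumes "S1 \<in> sets borel" "S2 \<in> sets borel" "S3 \<in> sets borel"
  shows "box_set W S1 S2 S3 \<in> sets (borel_of (limit_space W))"
proof -
  have "S1 \<times> S2 \<times> S3 \<in> sets borel" using assms by (intro borel_Times)
  from recip_map_preimage_sets[OF this, of W] show ?thesis
    by (simp add: box_set_def recip_map_def)
qed

lemma dist_le_sum_components:
  fixes p q :: "'a::metric_space \<times> real \<times> real"
  shows "dist p q \<le> dist (fst p) (fst q) + (\<bar>fst (snd p) - fst (snd q)\<bar> + \<bar>snd (snd p) - snd (snd q)\<bar>)"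
proof -
  have le: "dist p q \<le> dist (fst p) (fst q) + dist (snd p) (snd q)" for p q :: "'b::metric_space \<times> 'c::metric_space"
    unfolding dist_prod_def by (rule sqrt_sum_squares_le_sum) auto
  show ?thesis using le[of p q] le[of "snd p" "snd q"] by (simp add: dist_real_def)
qed

definition mesh :: "nat \<Rightarrow> real" where "mesh n = 1 / real (Suc n)"

lemma mesh_pos [simp]: "0 < mesh n"
  by (simp add: mesh_def)

lemma mesh_tendsto: "mesh \<longlonglongrightarrow> 0"
  unfolding mesh_def using LIMSEQ_inverse_real_of_nat by (simp add: inverse_eq_divide)

text \<open>Labels of the (n + 1)^2 intervals of length 1/(n + 1) that tile [0, n + 1). Mesh and
  range improve together, so each compact set is eventually covered.\<close>

definition indices :: "nat \<Rightarrow> int set" where "indices n = {0..<(int n + 1)\<^sup>2}"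

lemma index_mem:
  assumes "0 \<le> u" "u < real (Suc n)"
  shows "\<lfloor>u / mesh n\<rfloor> \<in> indices n"
proof -
  have "u * real (Suc n) < real (Suc n) * real (Suc n)" using assms by (intro mult_strict_right_mono) auto
  moreover have "u / mesh n = u * real (Suc n)" by (simp add: mesh_def)
  moreover have "of_int ((int n + 1)\<^sup>2) = real (Suc n) * real (Suc n)"
    by (simp add: power2_eq_square algebra_simps)
  ultimately have "u / mesh n < of_int ((int n + 1)\<^sup>2)" by (simp only:)
  then show ?thesis using assms by (simp add: indices_def floor_less_iff less_imp_le)
qed

lemma same_floor_close:
  fixes u v h :: real
  assumes "0 < h" "\<lfloor>u / h\<rfloor> = \<lfloor>v / h\<rfloor>"
  shows "\<bar>u - v\<bar> \<le> h"
  using mult_floor_divide[OF assms(1), of u] mult_floor_divide[OF assms(1), of v] assms(2) by simp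

lemma same_quant_close:
  fixes x y :: "'a::euclidean_space" and h :: real
  assumes "0 < h" "quant h x = quant h y"
  shows "dist x y \<le> 2 * DIM('a) * h"
proof -
  have "norm (x - y) \<le> norm (x - quant h x) + norm (quant h y - y)"
    using norm_triangle_ineq[of "x - quant h x" "quant h y - y"] assms(2) by simp
  then show ?thesis
    using norm_diff_quant[OF assms(1), of x] norm_diff_quant[OF assms(1), of y]
    by (simp add: dist_norm norm_minus_commute)
qed

definition cell3 :: "'a::euclidean_space set \<Rightarrow> nat \<Rightarrow> 'a \<times> int \<times> int \<Rightarrow> ('a \<times> ennreal \<times> ennreal) set" where
  "cell3 W n z = box_set W {x. quant (mesh n) x = fst z} {u. \<lfloor>u / mesh n\<rfloor> = fst (snd z)} {u. \<lfloor>u / mesh n\<rfloor> = snd (snd z)}"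

definition cells3 :: "'a::euclidean_space set \<Rightarrow> nat \<Rightarrow> ('a \<times> int \<times> int) set" where
  "cells3 W n = quant (mesh n) ` W \<times> indices n \<times> indices n"

lemma floor_set_borel: "{u::real. \<lfloor>u / h\<rfloor> = i} \<in> sets borel"
  by measurable

text \<open>For open \<open>U\<close>, a measure lies in \<open>U\<close> iff at some level \<open>n\<close> all measures with the same cell counts
  lie in \<open>U\<close>. This expresses membership in \<open>U\<close> through countably many counts and makes second
  countability of the vague topology unnecessary.\<close>

lemma vague_measurableI:
  fixes W :: "'a::euclidean_space set"
  assumes W: "compact W"
    and Y: "\<And>\<omega>. \<omega> \<in> space P \<Longrightarrow> Y \<omega> \<in> locally_finite_counting_measures (limit_space W)"
    and counts: "\<And>S1 S2 S3. S1 \<in> sets borel \<Longrightarrow> S2 \<in> sets borel \<Longrightarrow> S3 \<in> sets borel \<Longrightarrow>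
      (\<lambda>\<omega>. emeasure (Y \<omega>) (box_set W S1 S2 S3)) \<in> borel_measurable P"
  shows "Y \<in> P \<rightarrow>\<^sub>M borel_of (vague_topology (limit_space W))"
proof (rule measurable_borel_ofI)
  fix \<omega> assume "\<omega> \<in> space P"
  then show "Y \<omega> \<in> topspace (vague_topology (limit_space W))" by (simp add: topspace_vague_topology Y)
next
  let ?M = "locally_finite_counting_measures (limit_space W)"
  fix U assume U: "openin (vague_topology (limit_space W)) U"
  have fin: "finite (cells3 W n)" for n
    unfolding cells3_def indices_def using finite_quant_image[OF compact_imp_bounded[OF W]] by auto
  define G where "G n = {k. \<forall>\<mu>\<in>?M. (\<forall>z\<in>cells3 W n. emeasure \<mu> (cell3 W n z) = k z) \<longrightarrow> \<mu> \<in> U}" for n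
  define N where "N n \<omega> = (\<lambda>z\<in>cells3 W n. emeasure (Y \<omega>) (cell3 W n z))" for n \<omega>
  have N: "N n \<in> P \<rightarrow>\<^sub>M count_space (cells3 W n \<rightarrow>\<^sub>E insert \<infinity> (range of_nat))" for n
    unfolding N_def cell3_def
    by (intro counts_vector_measurable[OF fin] counts quant_cell_sets floor_set_borel counting_measureD(3)[OF Y])
  have "Y -` U \<inter> space P = (\<Union>n. N n -` G n \<inter> space P)"
  proof (intro set_eqI iffI)
    fix \<omega> assume "\<omega> \<in> Y -` U \<inter> space P"
    then have \<omega>: "\<omega> \<in> space P" and YU: "Y \<omega> \<in> U" by auto
    show "\<omega> \<in> (\<Union>n. N n -` G n \<inter> space P)"
    proof (rule ccontr)
      assume "\<omega> \<notin> (\<Union>n. N n -` G n \<inter> space P)"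
      then have "\<forall>n. N n \<omega> \<notin> G n" using \<omega> by blast
      \<comment> \<open>Failure at every level produces measures outside \<open>U\<close> sharing
        the counts of \<open>Y \<omega>\<close> on ever finer and larger grids. They converge
        vaguely to \<open>Y \<omega>\<close> and would have to enter the open set
        \<open>U\<close>.\<close>
      then have "\<forall>n. \<exists>\<mu>. \<mu> \<in> ?M \<and> (\<forall>z\<in>cells3 W n. emeasure \<mu> (cell3 W n z) = N n \<omega> z) \<and> \<mu> \<notin> U"
        unfolding G_def by blast
      then obtain \<mu> where "\<forall>n. \<mu> n \<in> ?M \<and> (\<forall>z\<in>cells3 W n. emeasure (\<mu> n) (cell3 W n z) = N n \<omega> z) \<and> \<mu> n \<notin> U"
        by (rule choice[THEN exE])
      then have \<mu>: "\<And>n. \<mu> n \<in> ?M" "\<And>n z. z \<in> cells3 W n \<Longrightarrow> emeasure (\<mu> n) (cell3 W n z) = emeasure (Y \<omega>) (cell3 W n z)"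
         "\<And>n. \<mu> n \<notin> U"
        by (simp_all add: N_def)
      have null: "\<forall>\<^sub>F n in sequentially. emeasure (\<mu> n) (level_set W B - (\<Union>z\<in>cells3 W n. cell3 W n z)) = 0 \<and>
            emeasure (Y \<omega>) (level_set W B - (\<Union>z\<in>cells3 W n. cell3 W n z)) = 0" for B
      proof -
        obtain m :: nat where m: "B < m" using reals_Archimedean2 by blast
        have empty: "level_set W B - (\<Union>z\<in>cells3 W n. cell3 W n z) = {}" if mn: "m \<le> n" for n
        proof -
          have "p \<in> (\<Union>z\<in>cells3 W n. cell3 W n z)" if p: "p \<in> level_set W B" for p
          proof -
            obtain x s t where ps: "p = (x, s, t)" by (cases p)
            let ?z = "(quant (mesh n) x, \<lfloor>recip s / mesh n\<rfloor>, \<lfloor>recip t / mesh n\<rfloor>)"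
            have "p \<in> cell3 W n ?z" using p by (simp add: cell3_def box_set_def level_set_def ps)
            moreover have "recip s < real (Suc n)" "recip t < real (Suc n)"
              using p m mn by (auto simp: level_set_def ps)
            then have "?z \<in> cells3 W n"
              using p unfolding cells3_def
              by (auto simp: level_set_def topspace_limit_space ps intro!: index_mem)
            ultimately show ?thesis by blast
          qed
          then show ?thesis by blast
        qed
        show ?thesis
          using eventually_ge_at_top[of m] by eventually_elim (simp only: empty emeasure_empty simp_thms)
      qed
      have "limitin (vague_topology (limit_space W)) \<mu> (Y \<omega>) sequentially"
      proof (rule vague_convergence_cells[OF W Y[OF \<omega>] \<mu>(1), where C = "cell3 W" and I = "cells3 W"
            and e = "\<lambda>n. (2 * DIM('a) + 2) * mesh n"])
        show "finite (cells3 W n)" for n by (rule fin)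
        show "disjoint_family_on (cell3 W n) (cells3 W n)" for n
          by (auto simp: disjoint_family_on_def cell3_def box_set_def)
        show "cell3 W n z \<in> sets (borel_of (limit_space W))" for n z
          unfolding cell3_def by (intro box_set_sets quant_cell_sets floor_set_borel)
        show "emeasure (\<mu> n) (cell3 W n z) = emeasure (Y \<omega>) (cell3 W n z)" if "z \<in> cells3 W n" for n z
          by (rule \<mu>(2)[OF that])
        show "dist (recip_map x) (recip_map y) \<le> (2 * DIM('a) + 2) * mesh n"
          if "x \<in> cell3 W n z" "y \<in> cell3 W n z" for n z x y
        proof -
          have "dist (fst x) (fst y) \<le> 2 * DIM('a) * mesh n"
            by (rule same_quant_close) (use that in \<open>auto simp: cell3_def box_set_def\<close>)
          moreover have "\<bar>recip (fst (snd x)) - recip (fst (snd y))\<bar> \<le> mesh n"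
              "\<bar>recip (snd (snd x)) - recip (snd (snd y))\<bar> \<le> mesh n"
            by (rule same_floor_close; use that in \<open>auto simp: cell3_def box_set_def\<close>)+
          ultimately show ?thesis
            using dist_le_sum_components[of "recip_map x" "recip_map y"] by (simp add: recip_map_def algebra_simps)
        qed
        have "(\<lambda>n. (2 * DIM('a) + 2) * mesh n) \<longlonglongrightarrow> real (2 * DIM('a) + 2) * 0"
          by (intro tendsto_mult tendsto_const mesh_tendsto)
        then show "(\<lambda>n. (2 * DIM('a) + 2) * mesh n) \<longlonglongrightarrow> 0" by simp
        show "\<forall>\<^sub>F n in sequentially. emeasure (\<mu> n) (level_set W B - (\<Union>z\<in>cells3 W n. cell3 W n z)) = 0 \<and>
            emeasure (Y \<omega>) (level_set W B - (\<Union>z\<in>cells3 W n. cell3 W n z)) = 0" for B by (rule null)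
      qed
      then have "\<forall>\<^sub>F n in sequentially. \<mu> n \<in> U" using U YU by (auto simp: limitin_def)
      then show False using \<mu>(3) by (auto simp: eventually_sequentially)
    qed
  next
    fix \<omega> assume "\<omega> \<in> (\<Union>n. N n -` G n \<inter> space P)"
    then obtain n where \<omega>: "\<omega> \<in> space P" "N n \<omega> \<in> G n" by blast
    then show "\<omega> \<in> Y -` U \<inter> space P" using Y[OF \<omega>(1)] unfolding G_def N_def by simp
  qed
  also have "\<dots> \<in> sets P"
  proof (rule sets.countable_UN''[OF countableI_type])
    fix n
    let ?V = "cells3 W n \<rightarrow>\<^sub>E insert \<infinity> (range (of_nat :: nat \<Rightarrow> ennreal))"
    \<comment> \<open>\<open>G n\<close> is an arbitrary set of functions, but only its trace on the
      countable set \<open>?V\<close> is reached, and there every subset is measurable.\<close>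
    have "N n -` (G n \<inter> ?V) \<inter> space P \<in> sets P"
      by (rule measurable_sets[OF N]) simp
    moreover have "N n -` (G n \<inter> ?V) \<inter> space P = N n -` G n \<inter> space P"
      using measurable_space[OF N[of n]] by auto
    ultimately show "N n -` G n \<inter> space P \<in> sets P" by simp
  qed
  finally show "Y -` U \<inter> space P \<in> sets P" .
qed

section \<open>Kernels of good configurations\<close>

text \<open>Goodness is demanded at every \<omega>, so that counts are cardinalities without
  exception; \<open>good_version\<close> provides such a modification of the Poisson
  process.\<close>

locale good_kernel =
  fixes P :: "'w measure" and \<kappa> :: "'w \<Rightarrow> ('a::euclidean_space \<times> real) measure"
  assumes good: "\<And>\<omega>. \<omega> \<in> space P \<Longrightarrow> good_config (\<kappa> \<omega>)"
    and counts: "\<And>A. A \<in> sets borel \<Longrightarrow> A \<subseteq> UNIV \<times> {0..} \<Longrightarrow> (\<lambda>\<omega>. emeasure (\<kappa> \<omega>) A) \<in> borel_measurable P"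
begin

lemma sets_kernel: "\<omega> \<in> space P \<Longrightarrow> A \<in> sets borel \<Longrightarrow> A \<subseteq> UNIV \<times> {0..} \<Longrightarrow> A \<in> sets (\<kappa> \<omega>)"
  using good borel_of_marked_spaceI counting_measureD(2) unfolding good_config_def by blast

lemma hit_event:
  assumes U: "open U"
  shows "{\<omega>\<in>space P. points (\<kappa> \<omega>) \<inter> U \<noteq> {}} \<in> sets P"
proof -
  let ?A = "\<lambda>n::nat. U \<inter> (cball 0 (real n) \<times> {0..})"
  have A: "?A n \<in> sets borel" for n
    using U by (intro sets.Int borel_closed closed_Times borel_open) auto
  have "{\<omega>\<in>space P. points (\<kappa> \<omega>) \<inter> U \<noteq> {}} = (\<Union>n. {\<omega>\<in>space P. emeasure (\<kappa> \<omega>) (?A n) \<noteq> 0})"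
  proof (intro set_eqI iffI)
    fix \<omega> assume "\<omega> \<in> {\<omega>\<in>space P. points (\<kappa> \<omega>) \<inter> U \<noteq> {}}"
    then obtain x t where \<omega>: "\<omega> \<in> space P" and p: "(x, t) \<in> points (\<kappa> \<omega>)" "(x, t) \<in> U" by auto
    have l: "\<kappa> \<omega> \<in> locally_finite_counting_measures marked_space" using good[OF \<omega>] by (simp add: good_config_def)
    have "0 \<le> t" using p(1) counting_measureD(1)[OF l] by (auto simp: points_def marked_space_def)
    moreover obtain n :: nat where "norm x \<le> n" using real_arch_simple by blast
    ultimately have "(x, t) \<in> ?A n" using p(2) by simp
    then have "emeasure (\<kappa> \<omega>) (?A n) \<noteq> 0"
      by (intro points_emeasure_nonzero[OF l p(1)] A) auto
    then show "\<omega> \<in> (\<Union>n. {\<omega>\<in>space P. emeasure (\<kappa> \<omega>) (?A n) \<noteq> 0})" using \<omega> by blast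
  next
    fix \<omega> assume "\<omega> \<in> (\<Union>n. {\<omega>\<in>space P. emeasure (\<kappa> \<omega>) (?A n) \<noteq> 0})"
    then obtain n where \<omega>: "\<omega> \<in> space P" and ne: "emeasure (\<kappa> \<omega>) (?A n) \<noteq> 0" by blast
    have "points (\<kappa> \<omega>) \<inter> ?A n \<noteq> {}"
      using good_config_count(2)[OF good[OF \<omega>] A _ bounded_cball, of n "0" "real n"] ne by auto
    then show "\<omega> \<in> {\<omega>\<in>space P. points (\<kappa> \<omega>) \<inter> U \<noteq> {}}" using \<omega> by blast
  qed
  also have "\<dots> \<in> sets P"
  proof (rule sets.countable_UN''[OF countableI_type])
    fix n
    have m: "(\<lambda>\<omega>. emeasure (\<kappa> \<omega>) (?A n)) \<in> borel_measurable P" by (rule counts[OF A]) auto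
    have "(\<lambda>\<omega>. emeasure (\<kappa> \<omega>) (?A n)) -` (- {0}) \<inter> space P \<in> sets P"
      by (rule measurable_sets[OF m]) auto
    then show "{\<omega>\<in>space P. emeasure (\<kappa> \<omega>) (?A n) \<noteq> 0} \<in> sets P"
      by (simp add: vimage_def Int_def conj_commute)
  qed
  finally show ?thesis .
qed

text \<open>The inradius at p is below a iff some point p' of the configuration satisfies a strict
  inequality that is open in (p, p'). An open set is a countable union of basic rectangles U x U',
  so the event is a countable union of products of U with the event that U' is hit.\<close>

lemma inradius_measurable:
  "(\<lambda>(\<omega>, p). inradius p (points (\<kappa> \<omega>))) \<in> borel_measurable (P \<Otimes>\<^sub>M borel)"
proof (rule borel_measurableI_less)
  fix c :: ennreal
  let ?R = "\<lambda>(\<omega>, p). inradius p (points (\<kappa> \<omega>))"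
  have main: "{x \<in> space (P \<Otimes>\<^sub>M borel). ?R x < ennreal a} \<in> sets (P \<Otimes>\<^sub>M borel)" if a: "0 < a" for a
  proof -
    let ?g = "\<lambda>pp :: ('a \<times> real) \<times> ('a \<times> real). (norm (fst (snd pp) - fst (fst pp)))\<^sup>2
        - 2 * a * norm (fst (snd pp) - fst (fst pp)) - ((snd (snd pp))\<^sup>2 - (snd (fst pp))\<^sup>2)"
    let ?V = "{pp. ?g pp < 0}"
    have V: "open ?V" by (intro open_Collect_less continuous_intros)
    obtain B :: "('a \<times> real) set set" where B: "countable B" "topological_basis B"
      using ex_countable_basis by blast
    let ?I = "{UU \<in> B \<times> B. fst UU \<times> snd UU \<subseteq> ?V}"
    have cI: "countable ?I" by (rule countable_subset[of _ "B \<times> B"]) (use B in auto)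
    have "{x \<in> space (P \<Otimes>\<^sub>M borel). ?R x < ennreal a} =
       (\<Union>UU\<in>?I. {\<omega>\<in>space P. points (\<kappa> \<omega>) \<inter> snd UU \<noteq> {}} \<times> fst UU)"
    proof (intro set_eqI iffI)
      fix x assume x: "x \<in> {x \<in> space (P \<Otimes>\<^sub>M borel). ?R x < ennreal a}"
      obtain \<omega> p where xe: "x = (\<omega>, p)" by (cases x)
      then have \<omega>: "\<omega> \<in> space P" and lt: "\<not> ennreal a \<le> inradius (fst p, snd p) (points (\<kappa> \<omega>))"
        using x by (auto simp: space_pair_measure not_le)
      obtain p' where p': "p' \<in> points (\<kappa> \<omega>)" "(p, p') \<in> ?V"
        using lt unfolding inradius_ge_iff[OF a] by (auto simp: not_le)
      obtain A A' where A: "open A" "open A'" "(p, p') \<in> A \<times> A'" "A \<times> A' \<subseteq> ?V"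
        using open_prod_elim[OF V p'(2)] by blast
      obtain U where U: "U \<in> B" "p \<in> U" "U \<subseteq> A" using topological_basisE[OF B(2) A(1), of p] A(3) by blast
      obtain U' where U': "U' \<in> B" "p' \<in> U'" "U' \<subseteq> A'" using topological_basisE[OF B(2) A(2), of p'] A(3) by blast
      have "U \<times> U' \<subseteq> ?V" using U U' A(4) by blast
      then have "(U, U') \<in> ?I" using U U' by simp
      moreover have "x \<in> {\<omega>\<in>space P. points (\<kappa> \<omega>) \<inter> snd (U, U') \<noteq> {}} \<times> fst (U, U')"
        using \<omega> U U' p'(1) unfolding xe by auto
      ultimately show "x \<in> (\<Union>UU\<in>?I. {\<omega>\<in>space P. points (\<kappa> \<omega>) \<inter> snd UU \<noteq> {}} \<times> fst UU)" by blast
    next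
      fix x assume "x \<in> (\<Union>UU\<in>?I. {\<omega>\<in>space P. points (\<kappa> \<omega>) \<inter> snd UU \<noteq> {}} \<times> fst UU)"
      then obtain UU where UU: "UU \<in> ?I" "x \<in> {\<omega>\<in>space P. points (\<kappa> \<omega>) \<inter> snd UU \<noteq> {}} \<times> fst UU" by blast
      then obtain \<omega> p p' where xe: "x = (\<omega>, p)" "\<omega> \<in> space P" "p \<in> fst UU" "p' \<in> snd UU" "p' \<in> points (\<kappa> \<omega>)" by blast
      have "(p, p') \<in> ?V" using UU(1) xe(3,4) by blast
      then have "\<not> ennreal a \<le> inradius (fst p, snd p) (points (\<kappa> \<omega>))"
        unfolding inradius_ge_iff[OF a] using xe(5) by (auto simp: not_le intro!: bexI[of _ p'])
      then show "x \<in> {x \<in> space (P \<Otimes>\<^sub>M borel). ?R x < ennreal a}"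
        using xe by (auto simp: space_pair_measure not_le)
    qed
    also have "\<dots> \<in> sets (P \<Otimes>\<^sub>M borel)"
    proof (rule sets.countable_UN''[OF cI])
      fix UU assume "UU \<in> ?I"
      then have "open (fst UU)" "open (snd UU)" using B(2) topological_basis_open by auto
      then show "{\<omega>\<in>space P. points (\<kappa> \<omega>) \<inter> snd UU \<noteq> {}} \<times> fst UU \<in> sets (P \<Otimes>\<^sub>M borel)"
        by (intro pair_measureI) (auto intro: hit_event)
    qed
    finally show ?thesis .
  qed
  show "{x \<in> space (P \<Otimes>\<^sub>M borel). ?R x < c} \<in> sets (P \<Otimes>\<^sub>M borel)"
  proof (cases c)
    case (real a)
    show ?thesis
    proof (cases "0 < a")
      case True
      then show ?thesis using main real by simp
    next
      case False
      then have "c = 0" using real by simp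
      then show ?thesis by simp
    qed
  next
    case top
    have "{x \<in> space (P \<Otimes>\<^sub>M borel). ?R x < c} =
        (\<Union>n::nat. {x \<in> space (P \<Otimes>\<^sub>M borel). ?R x < ennreal (real (Suc n))})"
    proof (intro set_eqI iffI)
      fix x assume x: "x \<in> {x \<in> space (P \<Otimes>\<^sub>M borel). ?R x < c}"
      then have "?R x < top" using top by simp
      then obtain b where b: "?R x = ennreal b" "0 \<le> b" by (cases "?R x") auto
      obtain n :: nat where "b < n" using reals_Archimedean2 by blast
      then have "ennreal b < ennreal (real (Suc n))" using b(2) by (subst ennreal_less_iff) auto
      then have "?R x < ennreal (real (Suc n))" using b(1) by (simp only:)
      then show "x \<in> (\<Union>n::nat. {x \<in> space (P \<Otimes>\<^sub>M borel). ?R x < ennreal (real (Suc n))})" using x by blast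
    next
      fix x assume "x \<in> (\<Union>n::nat. {x \<in> space (P \<Otimes>\<^sub>M borel). ?R x < ennreal (real (Suc n))})"
      then show "x \<in> {x \<in> space (P \<Otimes>\<^sub>M borel). ?R x < c}" using top by (auto intro: less_trans ennreal_less_top)
    qed
    also have "\<dots> \<in> sets (P \<Otimes>\<^sub>M borel)" by (rule sets.countable_UN''[OF countableI_type]) (rule main, simp)
    finally show ?thesis .
  qed
qed

text \<open>The set in which points are counted depends on \<omega>, because it involves the
  inradius. A Dynkin argument extends measurability from rectangles; the complement step subtracts
  masses, hence the restriction to a strip over a bounded set, where they are finite.\<close>

lemma section_count_measurable:
  assumes D: "D \<in> sets (P \<Otimes>\<^sub>M borel)" and B: "bounded B" "B \<in> sets borel"
  shows "(\<lambda>\<omega>. emeasure (\<kappa> \<omega>) (Pair \<omega> -` D \<inter> (B \<times> {0..}))) \<in> borel_measurable P"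
proof -
  let ?R = "B \<times> {0::real..}"
  have R: "?R \<in> sets borel" using B by (intro borel_Times) auto
  have RU: "A \<inter> ?R \<in> sets borel" "A \<inter> ?R \<subseteq> UNIV \<times> {0..}" if "A \<in> sets borel" for A
    using that R by auto
  have sec: "Pair \<omega> -` D \<in> sets borel" if "D \<in> sets (P \<Otimes>\<^sub>M borel)" for D \<omega>
    by (rule sets_Pair1[OF that])
  have ss: "Pair \<omega> -` D \<inter> ?R \<in> sets (\<kappa> \<omega>)" if "D \<in> sets (P \<Otimes>\<^sub>M borel)" "\<omega> \<in> space P" for D \<omega>
    by (rule sets_kernel[OF that(2) RU[OF sec[OF that(1)]]])
  have gen: "sets (P \<Otimes>\<^sub>M borel) = sigma_sets (space P \<times> space borel) {a \<times> b | a b. a \<in> sets P \<and> b \<in> sets (borel :: ('a \<times> real) measure)}"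
    by (rule sets_pair_measure)
  show ?thesis
    using Int_stable_pair_measure_generator[of P "borel :: ('a \<times> real) measure"]
      pair_measure_closed[of P "borel :: ('a \<times> real) measure"] D[unfolded gen]
  proof (induction rule: sigma_sets_induct_disjoint)
    case (basic A)
    then obtain a b where A: "A = a \<times> b" "a \<in> sets P" "b \<in> sets borel" by blast
    have "(\<lambda>\<omega>. indicator a \<omega> * emeasure (\<kappa> \<omega>) (b \<inter> ?R)) \<in> borel_measurable P"
      using A by (intro borel_measurable_times_ennreal borel_measurable_indicator counts RU)
    moreover have "indicator a \<omega> * emeasure (\<kappa> \<omega>) (b \<inter> ?R) = emeasure (\<kappa> \<omega>) (Pair \<omega> -` A \<inter> ?R)" for \<omega>
      by (auto simp: A indicator_def)
    ultimately show ?case by (simp only:)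
  next
    case empty
    show ?case by simp
  next
    case (compl A)
    then have A: "A \<in> sets (P \<Otimes>\<^sub>M borel)" by (simp add: gen)
    have "(\<lambda>\<omega>. emeasure (\<kappa> \<omega>) (UNIV \<inter> ?R) - emeasure (\<kappa> \<omega>) (Pair \<omega> -` A \<inter> ?R)) \<in> borel_measurable P"
      by (intro borel_measurable_minus_ennreal counts RU compl.IH) auto
    moreover have "emeasure (\<kappa> \<omega>) (UNIV \<inter> ?R) - emeasure (\<kappa> \<omega>) (Pair \<omega> -` A \<inter> ?R) =
       emeasure (\<kappa> \<omega>) (Pair \<omega> -` (space P \<times> space borel - A) \<inter> ?R)" if \<omega>: "\<omega> \<in> space P" for \<omega>
    proof -
      have "emeasure (\<kappa> \<omega>) ?R < \<infinity>" by (rule good_config_finite[OF good[OF \<omega>] B(1)])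
      moreover have "emeasure (\<kappa> \<omega>) (Pair \<omega> -` A \<inter> ?R) \<le> emeasure (\<kappa> \<omega>) ?R"
        using sets_kernel[OF \<omega>, of ?R] R by (intro emeasure_mono) auto
      ultimately have fin: "emeasure (\<kappa> \<omega>) (Pair \<omega> -` A \<inter> ?R) \<noteq> \<infinity>" by (auto simp: top_unique)
      have "Pair \<omega> -` (space P \<times> space borel - A) \<inter> ?R = ?R - (Pair \<omega> -` A \<inter> ?R)" using \<omega> by auto
      moreover have "emeasure (\<kappa> \<omega>) (?R - (Pair \<omega> -` A \<inter> ?R)) = emeasure (\<kappa> \<omega>) ?R - emeasure (\<kappa> \<omega>) (Pair \<omega> -` A \<inter> ?R)"
        by (rule emeasure_Diff[OF fin _ ss[OF A \<omega>]]) (use sets_kernel[OF \<omega>, of ?R] R in auto)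
      ultimately show ?thesis by simp
    qed
    ultimately show ?case by (simp cong: measurable_cong)
  next
    case (union A)
    have A: "A i \<in> sets (P \<Otimes>\<^sub>M borel)" for i using union.hyps(2) unfolding gen by blast
    have "(\<lambda>\<omega>. \<Sum>i. emeasure (\<kappa> \<omega>) (Pair \<omega> -` A i \<inter> ?R)) \<in> borel_measurable P"
      by (intro borel_measurable_suminf_order union.IH)
    moreover have "(\<Sum>i. emeasure (\<kappa> \<omega>) (Pair \<omega> -` A i \<inter> ?R)) = emeasure (\<kappa> \<omega>) (Pair \<omega> -` (\<Union>i. A i) \<inter> ?R)"
      if \<omega>: "\<omega> \<in> space P" for \<omega>
    proof -
      have "(\<Sum>i. emeasure (\<kappa> \<omega>) (Pair \<omega> -` A i \<inter> ?R)) = emeasure (\<kappa> \<omega>) (\<Union>i. Pair \<omega> -` A i \<inter> ?R)"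
        by (rule suminf_emeasure) (use ss[OF A \<omega>] union.hyps in \<open>auto simp: disjoint_family_on_def\<close>)
      moreover have "(\<Union>i. Pair \<omega> -` A i \<inter> ?R) = Pair \<omega> -` (\<Union>i. A i) \<inter> ?R" by auto
      ultimately show ?thesis by simp
    qed
    ultimately show ?case by (simp cong: measurable_cong)
  qed
qed

end

section \<open>The rescaled inradius process\<close>

lemma recip_measurable [measurable]: "recip \<in> borel_measurable borel"
  unfolding recip_def by measurable

locale rescaled =
  fixes \<gamma> \<alpha> :: real and Q :: "real measure" and W :: "'a::euclidean_space set" and \<rho> s :: real
  assumes W: "compact W" and rho_pos: "0 < \<rho>" and scale: "s = q_scale \<gamma> \<alpha> Q DIM('a) \<rho>" and scale_pos: "0 < s"
begin

abbreviation "window \<equiv> (\<lambda>x. \<rho> *\<^sub>R x) ` W"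

definition contrib :: "('a \<times> real) measure \<Rightarrow> ('a \<times> real) set" where
  "contrib \<nu> = {p \<in> points \<nu> \<inter> (window \<times> {0<..}). 0 < inradius p (points \<nu>)}"

definition rescale :: "('a \<times> real) measure \<Rightarrow> 'a \<times> real \<Rightarrow> 'a \<times> ennreal \<times> ennreal" where
  "rescale \<nu> p = ((1 / \<rho>) *\<^sub>R fst p, ennreal (snd p / s), inradius p (points \<nu>) / ennreal s)"

lemma Xi_eq: "Xi \<gamma> \<alpha> Q W \<rho> \<nu> = distr (count_space (contrib \<nu>)) (borel_of (limit_space W)) (rescale \<nu>)"
  by (simp add: Xi_def contrib_def rescale_def[abs_def] Let_def flip: scale)

lemma window_compact: "compact window"
  using W by (rule compact_scaling)

lemma window_borel: "window \<in> sets borel"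
  using window_compact by (intro borel_closed compact_imp_closed)

lemma finite_contrib:
  assumes "good_config \<nu>"
  shows "finite (contrib \<nu>)"
proof -
  have "finite (points \<nu> \<inter> (window \<times> {0..}))"
    by (rule good_config_count(1)[OF assms _ subset_refl compact_imp_bounded[OF window_compact]])
       (intro borel_Times window_borel, simp)
  then show ?thesis by (rule finite_subset[rotated]) (auto simp: contrib_def)
qed

lemma rescale_topspace: "p \<in> contrib \<nu> \<Longrightarrow> rescale \<nu> p \<in> topspace (limit_space W)"
  using rho_pos scale_pos
  by (auto simp: contrib_def rescale_def topspace_limit_space ennreal_zero_less_divide)

lemma emeasure_Xi:
  assumes \<nu>: "good_config \<nu>" and B: "B \<in> sets (borel_of (limit_space W))"
  shows "emeasure (Xi \<gamma> \<alpha> Q W \<rho> \<nu>) B = of_nat (card {p \<in> contrib \<nu>. rescale \<nu> p \<in> B})"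
proof -
  have m: "rescale \<nu> \<in> count_space (contrib \<nu>) \<rightarrow>\<^sub>M borel_of (limit_space W)"
    using rescale_topspace by simp
  have "rescale \<nu> -` B \<inter> contrib \<nu> = {p \<in> contrib \<nu>. rescale \<nu> p \<in> B}" by auto
  then show ?thesis
    unfolding Xi_eq using finite_contrib[OF \<nu>]
    by (subst emeasure_distr[OF m B]) (simp add: emeasure_count_space_finite)
qed

lemma Xi_counting_measure:
  assumes \<nu>: "good_config \<nu>"
  shows "Xi \<gamma> \<alpha> Q W \<rho> \<nu> \<in> locally_finite_counting_measures (limit_space W)"
proof -
  have sp: "space (Xi \<gamma> \<alpha> Q W \<rho> \<nu>) = topspace (limit_space W)" by (simp add: Xi_eq)
  have st: "sets (Xi \<gamma> \<alpha> Q W \<rho> \<nu>) = sets (borel_of (limit_space W))" by (simp add: Xi_eq)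
  have int: "emeasure (Xi \<gamma> \<alpha> Q W \<rho> \<nu>) A \<in> range of_nat" if "A \<in> sets (borel_of (limit_space W))" for A
    unfolding emeasure_Xi[OF \<nu> that] by blast
  have fin: "emeasure (Xi \<gamma> \<alpha> Q W \<rho> \<nu>) A < \<infinity>" for A
  proof (cases "A \<in> sets (borel_of (limit_space W))")
    case True
    then show ?thesis unfolding emeasure_Xi[OF \<nu> True] by (simp add: of_nat_less_top)
  next
    case False
    then show ?thesis by (simp add: emeasure_notin_sets st)
  qed
  show ?thesis unfolding locally_finite_counting_measures_def using sp st int fin by simp
qed

text \<open>The count of the rescaled process in a box is the count of the configuration itself in
  an \<omega>-section of one jointly measurable set, to which
  \<open>section_count_measurable\<close> applies.\<close>

lemma Xi_count_measurable:
  assumes "good_kernel P \<kappa>" and S: "S1 \<in> sets borel" "S2 \<in> sets borel" "S3 \<in> sets borel"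
  shows "(\<lambda>\<omega>. emeasure (Xi \<gamma> \<alpha> Q W \<rho> (\<kappa> \<omega>)) (box_set W S1 S2 S3)) \<in> borel_measurable P"
proof -
  interpret good_kernel P \<kappa> by fact
  let ?r = "\<lambda>x. inradius (snd x) (points (\<kappa> (fst x)))"
  let ?M = "P \<Otimes>\<^sub>M (borel :: ('a \<times> real) measure)"
  have [measurable]: "?r \<in> borel_measurable ?M"
    using inradius_measurable by (simp add: case_prod_beta')
  have [measurable]: "(fst :: 'a \<times> real \<Rightarrow> 'a) \<in> borel_measurable borel" "(snd :: 'a \<times> real \<Rightarrow> real) \<in> borel_measurable borel"
    by (intro borel_measurable_continuous_onI continuous_intros)+
  note [measurable] = S window_borel
  let ?D = "{x \<in> space ?M. fst (snd x) \<in> window \<and> 0 < snd (snd x) \<and> 0 < ?r x \<and>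
     (1 / \<rho>) *\<^sub>R fst (snd x) \<in> S1 \<and> recip (ennreal (snd (snd x) / s)) \<in> S2 \<and> recip (?r x / ennreal s) \<in> S3}"
  have D: "?D \<in> sets ?M" by measurable
  have "emeasure (Xi \<gamma> \<alpha> Q W \<rho> (\<kappa> \<omega>)) (box_set W S1 S2 S3) =
     emeasure (\<kappa> \<omega>) (Pair \<omega> -` ?D \<inter> (window \<times> {0..}))" if \<omega>: "\<omega> \<in> space P" for \<omega>
  proof -
    have "{p \<in> contrib (\<kappa> \<omega>). rescale (\<kappa> \<omega>) p \<in> box_set W S1 S2 S3} =
        points (\<kappa> \<omega>) \<inter> (Pair \<omega> -` ?D \<inter> (window \<times> {0..}))"
    proof (intro set_eqI iffI)
      fix p assume p: "p \<in> {p \<in> contrib (\<kappa> \<omega>). rescale (\<kappa> \<omega>) p \<in> box_set W S1 S2 S3}"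
      then show "p \<in> points (\<kappa> \<omega>) \<inter> (Pair \<omega> -` ?D \<inter> (window \<times> {0..}))"
        using \<omega> unfolding contrib_def rescale_def box_set_def
        by (cases p) (auto simp: space_pair_measure)
    next
      fix p assume p: "p \<in> points (\<kappa> \<omega>) \<inter> (Pair \<omega> -` ?D \<inter> (window \<times> {0..}))"
      then have c: "p \<in> contrib (\<kappa> \<omega>)" unfolding contrib_def by (cases p) auto
      then have "rescale (\<kappa> \<omega>) p \<in> topspace (limit_space W)" by (rule rescale_topspace)
      then show "p \<in> {p \<in> contrib (\<kappa> \<omega>). rescale (\<kappa> \<omega>) p \<in> box_set W S1 S2 S3}"
        using p c unfolding box_set_def by (simp add: rescale_def)
    qed
    moreover have "emeasure (\<kappa> \<omega>) (Pair \<omega> -` ?D \<inter> (window \<times> {0..})) =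
        of_nat (card (points (\<kappa> \<omega>) \<inter> (Pair \<omega> -` ?D \<inter> (window \<times> {0..}))))"
    proof (rule good_config_count(2)[OF good[OF \<omega>] _ _ compact_imp_bounded[OF window_compact]])
      have "window \<times> {0::real..} \<in> sets borel" by (intro borel_Times window_borel) simp
      then show "Pair \<omega> -` ?D \<inter> (window \<times> {0..}) \<in> sets borel"
        using sets_Pair1[OF D, of \<omega>] by (intro sets.Int)
    qed blast
    ultimately show ?thesis
      unfolding emeasure_Xi[OF good[OF \<omega>] box_set_sets[OF S]] by simp
  qed
  then show ?thesis
    using section_count_measurable[OF D compact_imp_bounded[OF window_compact] window_borel]
    by (simp cong: measurable_cong)
qed

lemma Xi_measurable:
  assumes \<kappa>: "good_kernel P \<kappa>"
  shows "(\<lambda>\<omega>. Xi \<gamma> \<alpha> Q W \<rho> (\<kappa> \<omega>)) \<in> P \<rightarrow>\<^sub>M borel_of (vague_topology (limit_space W))"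
  by (rule vague_measurableI[OF W Xi_counting_measure[OF good_kernel.good[OF \<kappa>]] Xi_count_measurable[OF \<kappa>]])

lemma Xi_version:
  assumes \<kappa>: "good_kernel P \<kappa>" and eq: "AE \<omega> in P. \<kappa> \<omega> = \<eta> \<omega>"
  shows "is_version P (vague_topology (limit_space W)) (\<lambda>\<omega>. Xi \<gamma> \<alpha> Q W \<rho> (\<eta> \<omega>)) (\<lambda>\<omega>. Xi \<gamma> \<alpha> Q W \<rho> (\<kappa> \<omega>))"
  unfolding is_version_def using Xi_measurable[OF \<kappa>] eq by (auto elim: eventually_mono)

end

lemma good_config_null: "good_config (null_measure (borel_of marked_space))"
proof -
  have "0 \<in> insert \<infinity> (range (of_nat :: nat \<Rightarrow> ennreal))" by (metis insertI2 of_nat_0 rangeI)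
  then show ?thesis by (simp add: good_config_def locally_finite_counting_measures_def)
qed

context marked_poisson
begin

lemma good_version:
  obtains \<kappa> where "good_kernel P \<kappa>" "AE \<omega> in P. \<kappa> \<omega> = \<eta> \<omega>"
proof -
  obtain N where N: "{\<omega> \<in> space P. \<not> good_config (\<eta> \<omega>)} \<subseteq> N" "emeasure P N = 0" "N \<in> sets P"
    using AE_good by (rule AE_E)
  define \<kappa> where "\<kappa> \<omega> = (if \<omega> \<in> N then null_measure (borel_of marked_space) else \<eta> \<omega>)" for \<omega>
  have "good_kernel P \<kappa>"
  proof
    show "good_config (\<kappa> \<omega>)" if "\<omega> \<in> space P" for \<omega>
      using that N(1) good_config_null by (auto simp: \<kappa>_def)
    fix A :: "('x \<times> real) set" assume A: "A \<in> sets borel" "A \<subseteq> UNIV \<times> {0..}"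
    have "(\<lambda>\<omega>. if \<omega> \<in> N then 0 else emeasure (\<eta> \<omega>) A) \<in> borel_measurable P"
      using N(3) count_measurable[OF borel_of_marked_spaceI[OF A]] by measurable
    moreover have "(\<lambda>\<omega>. if \<omega> \<in> N then 0 else emeasure (\<eta> \<omega>) A) = (\<lambda>\<omega>. emeasure (\<kappa> \<omega>) A)"
      by (auto simp: \<kappa>_def)
    ultimately show "(\<lambda>\<omega>. emeasure (\<kappa> \<omega>) A) \<in> borel_measurable P" by simp
  qed
  moreover have "AE \<omega> in P. \<kappa> \<omega> = \<eta> \<omega>"
  proof -
    have "AE \<omega> in P. \<omega> \<notin> N" using N by (intro AE_not_in) (simp add: null_sets_def)
    then show ?thesis by eventually_elim (simp add: \<kappa>_def)
  qed
  ultimately show ?thesis by (rule that)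
qed

end

section \<open>Near-diagonal configurations with prescribed cell counts\<close>

text \<open>Only location and mark are gridded; the inradius coordinate merely has to stay in a band
  around the diagonal. The counts are then determined by locations and marks, whose joint law is
  Poisson.\<close>

definition cell2 :: "'a::euclidean_space set \<Rightarrow> nat \<Rightarrow> 'a \<times> int \<Rightarrow> ('a \<times> ennreal \<times> ennreal) set" where
  "cell2 W n z = {p \<in> topspace (limit_space W). quant (mesh n) (fst p) = fst z \<and>
     \<lfloor>recip (fst (snd p)) / mesh n\<rfloor> = snd z \<and> \<bar>recip (fst (snd p)) - recip (snd (snd p))\<bar> \<le> mesh n}"

definition cells2 :: "'a::euclidean_space set \<Rightarrow> nat \<Rightarrow> ('a \<times> int) set" where
  "cells2 W n = quant (mesh n) ` W \<times> indices n"

text \<open>The bound on the reciprocal mark leaves out small marks, about whose inradii nothing is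
  known at level \<open>n\<close>. Together with the cells of \<open>cells2\<close> this set covers
  all points with larger marks.\<close>

definition off_diag :: "'a::euclidean_space set \<Rightarrow> nat \<Rightarrow> ('a \<times> ennreal \<times> ennreal) set" where
  "off_diag W n = {p \<in> topspace (limit_space W). recip (fst (snd p)) < real (Suc n) \<and>
     mesh n < \<bar>recip (fst (snd p)) - recip (snd (snd p))\<bar>}"

definition compat :: "'a::euclidean_space set \<Rightarrow> nat \<Rightarrow> ('a \<times> ennreal \<times> ennreal) measure \<Rightarrow> ('a \<times> int \<Rightarrow> ennreal) \<Rightarrow> bool" where
  "compat W n \<mu> k \<longleftrightarrow> \<mu> \<in> locally_finite_counting_measures (limit_space W) \<and>
     (\<forall>z\<in>cells2 W n. emeasure \<mu> (cell2 W n z) = k z) \<and> emeasure \<mu> (off_diag W n) = 0"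

definition cell_counts :: "'a::euclidean_space set \<Rightarrow> nat \<Rightarrow> ('a \<times> ennreal \<times> ennreal) measure \<Rightarrow> 'a \<times> int \<Rightarrow> ennreal" where
  "cell_counts W n \<nu> = (\<lambda>z\<in>cells2 W n. emeasure \<nu> (cell2 W n z))"

lemma finite_cells2: "compact W \<Longrightarrow> finite (cells2 W n)"
  unfolding cells2_def indices_def using finite_quant_image[OF compact_imp_bounded] by auto

lemma fst_snd_borel [measurable]:
  "(fst :: 'a::second_countable_topology \<times> 'b::second_countable_topology \<Rightarrow> 'a) \<in> borel_measurable borel"
  "(snd :: 'a::second_countable_topology \<times> 'b::second_countable_topology \<Rightarrow> 'b) \<in> borel_measurable borel"
  by (intro borel_measurable_continuous_onI continuous_intros)+

lemma cell2_sets: "cell2 W n z \<in> sets (borel_of (limit_space W))"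
proof -
  let ?A = "{v. quant (mesh n) (fst v) = fst z \<and> \<lfloor>fst (snd v) / mesh n\<rfloor> = snd z \<and>
      \<bar>fst (snd v) - snd (snd v)\<bar> \<le> mesh n}"
  have "?A \<in> sets borel" by measurable
  from recip_map_preimage_sets[OF this, of W] show ?thesis by (simp add: cell2_def recip_map_def)
qed

lemma off_diag_sets: "off_diag W n \<in> sets (borel_of (limit_space W))"
proof -
  let ?A = "{v :: 'a \<times> real \<times> real. fst (snd v) < real (Suc n) \<and> mesh n < \<bar>fst (snd v) - snd (snd v)\<bar>}"
  have "?A \<in> sets borel" by measurable
  from recip_map_preimage_sets[OF this, of W] show ?thesis by (simp add: off_diag_def recip_map_def)
qed

lemma disjoint_cell2: "disjoint_family_on (cell2 W n) (cells2 W n)"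
  by (auto simp: disjoint_family_on_def cell2_def)

lemma level_set_cell2:
  assumes "B < real (Suc n)"
  shows "level_set W B - (\<Union>z\<in>cells2 W n. cell2 W n z) \<subseteq> off_diag W n"
proof
  fix p assume p: "p \<in> level_set W B - (\<Union>z\<in>cells2 W n. cell2 W n z)"
  let ?z = "(quant (mesh n) (fst p), \<lfloor>recip (fst (snd p)) / mesh n\<rfloor>)"
  have lt: "recip (fst (snd p)) < real (Suc n)" using p assms by (auto simp: level_set_def)
  have top: "p \<in> topspace (limit_space W)" using p by (simp add: level_set_def)
  then have "fst p \<in> W" by (auto simp: topspace_limit_space)
  then have "?z \<in> cells2 W n" unfolding cells2_def using index_mem[OF recip_nonneg lt] by simp
  then have "p \<notin> cell2 W n ?z" using p by blast
  then show "p \<in> off_diag W n" using top lt by (simp add: cell2_def off_diag_def)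
qed

lemma compat_convergence:
  fixes W :: "'a::euclidean_space set"
  assumes W: "compact W" and \<nu>: "\<nu> \<in> locally_finite_counting_measures (limit_space W)"
    and diag: "\<And>n. emeasure \<nu> (off_diag W n) = 0"
    and \<mu>: "\<And>n. compat W n (\<mu> n) (cell_counts W n \<nu>)"
  shows "limitin (vague_topology (limit_space W)) \<mu> \<nu> sequentially"
proof (rule vague_convergence_cells[OF W \<nu>, where C = "cell2 W" and I = "cells2 W"
      and e = "\<lambda>n. real (2 * DIM('a) + 4) * mesh n"])
  show \<mu>l: "\<mu> n \<in> locally_finite_counting_measures (limit_space W)" for n
    using \<mu>[of n] by (simp add: compat_def)
  show "finite (cells2 W n)" for n by (rule finite_cells2[OF W])
  show "disjoint_family_on (cell2 W n) (cells2 W n)" for n by (rule disjoint_cell2)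
  show "cell2 W n z \<in> sets (borel_of (limit_space W))" for n z by (rule cell2_sets)
  show "emeasure (\<mu> n) (cell2 W n z) = emeasure \<nu> (cell2 W n z)" if "z \<in> cells2 W n" for n z
    using \<mu>[of n] that by (simp add: compat_def cell_counts_def)
  show "dist (recip_map x) (recip_map y) \<le> real (2 * DIM('a) + 4) * mesh n"
    if "x \<in> cell2 W n z" "y \<in> cell2 W n z" for n z x y
  proof -
    have "dist (fst x) (fst y) \<le> 2 * DIM('a) * mesh n"
      by (rule same_quant_close) (use that in \<open>auto simp: cell2_def\<close>)
    moreover have "\<bar>recip (fst (snd x)) - recip (fst (snd y))\<bar> \<le> mesh n"
      by (rule same_floor_close) (use that in \<open>auto simp: cell2_def\<close>)
    moreover have "\<bar>recip (fst (snd x)) - recip (snd (snd x))\<bar> \<le> mesh n" "\<bar>recip (fst (snd y)) - recip (snd (snd y))\<bar> \<le> mesh n"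
      using that by (auto simp: cell2_def)
    \<comment> \<open>The third coordinate costs three meshes: from inradius to mark at x, across
      the mark cell, and from mark back to inradius at y. With one mesh for the second coordinate
      this makes 4.\<close>
    ultimately have "dist (fst x) (fst y) + (\<bar>recip (fst (snd x)) - recip (fst (snd y))\<bar> + \<bar>recip (snd (snd x)) - recip (snd (snd y))\<bar>)
       \<le> 2 * DIM('a) * mesh n + 4 * mesh n" by linarith
    then show ?thesis
      using dist_le_sum_components[of "recip_map x" "recip_map y"] by (simp add: recip_map_def algebra_simps)
  qed
  have "(\<lambda>n. real (2 * DIM('a) + 4) * mesh n) \<longlonglongrightarrow> real (2 * DIM('a) + 4) * 0"
    by (intro tendsto_mult tendsto_const mesh_tendsto)
  then show "(\<lambda>n. real (2 * DIM('a) + 4) * mesh n) \<longlonglongrightarrow> 0" by simp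
  show "\<forall>\<^sub>F n in sequentially. emeasure (\<mu> n) (level_set W B - (\<Union>z\<in>cells2 W n. cell2 W n z)) = 0 \<and>
      emeasure \<nu> (level_set W B - (\<Union>z\<in>cells2 W n. cell2 W n z)) = 0" for B
  proof -
    obtain m :: nat where m: "B < m" using reals_Archimedean2 by blast
    have null: "emeasure M (level_set W B - (\<Union>z\<in>cells2 W n. cell2 W n z)) = 0"
      if n: "m \<le> n" and M: "M \<in> locally_finite_counting_measures (limit_space W)" "emeasure M (off_diag W n) = 0" for M n
    proof -
      have "B < real (Suc n)" using m n by simp
      then have "emeasure M (level_set W B - (\<Union>z\<in>cells2 W n. cell2 W n z)) \<le> emeasure M (off_diag W n)"
        using off_diag_sets counting_measureD(2)[OF M(1)] by (intro emeasure_mono level_set_cell2) auto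
      then show ?thesis using M(2) by simp
    qed
    show ?thesis
      using eventually_ge_at_top[of m]
    proof eventually_elim
      case (elim n)
      have "emeasure (\<mu> n) (off_diag W n) = 0" using \<mu>[of n] by (simp add: compat_def)
      then show ?case using null[OF elim \<mu>l] null[OF elim \<nu> diag] by blast
    qed
  qed
qed

text \<open>The best upper bound for \<open>F\<close> that can be read off from the level-\<open>n\<close> cell counts; at a diagonal
  configuration it converges to the value of \<open>F\<close>. This replaces a tightness argument.\<close>

definition upper :: "'a::euclidean_space set \<Rightarrow> (('a \<times> ennreal \<times> ennreal) measure \<Rightarrow> real) \<Rightarrow> nat \<Rightarrow> ('a \<times> int \<Rightarrow> ennreal) \<Rightarrow> real" where
  "upper W F n k = (if \<exists>\<mu>. compat W n \<mu> k then Sup {F \<mu> | \<mu>. compat W n \<mu> k} else 0)"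

context
  fixes W :: "'a::euclidean_space set" and F :: "('a \<times> ennreal \<times> ennreal) measure \<Rightarrow> real" and B :: real
  assumes F: "\<And>\<mu>. \<mu> \<in> locally_finite_counting_measures (limit_space W) \<Longrightarrow> \<bar>F \<mu>\<bar> \<le> B"
begin

lemma compat_bound: "compat W n \<mu> k \<Longrightarrow> \<bar>F \<mu>\<bar> \<le> B"
  using F by (simp add: compat_def)

lemma upper_bdd: "bdd_above {F \<mu> | \<mu>. compat W n \<mu> k}"
  using compat_bound by (intro bdd_aboveI[of _ B]) (auto dest: abs_le_D1)

lemma le_upper: "compat W n \<mu> k \<Longrightarrow> F \<mu> \<le> upper W F n k"
  unfolding upper_def by (auto intro!: cSup_upper upper_bdd)

lemma upper_abs_le:
  assumes "0 \<le> B"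
  shows "\<bar>upper W F n k\<bar> \<le> B"
proof (cases "\<exists>\<mu>. compat W n \<mu> k")
  case True
  then obtain \<mu> where \<mu>: "compat W n \<mu> k" by blast
  have "upper W F n k \<le> B"
    unfolding upper_def using True compat_bound by (auto intro!: cSup_least dest: abs_le_D1)
  moreover have "- B \<le> upper W F n k" using compat_bound[OF \<mu>] le_upper[OF \<mu>] by linarith
  ultimately show ?thesis by simp
next
  case False
  then show ?thesis using assms by (simp add: upper_def)
qed

lemma upper_approx:
  assumes "compat W n \<mu> k" "0 < e"
  obtains \<mu>' where "compat W n \<mu>' k" "upper W F n k - e < F \<mu>'"
proof -
  have "upper W F n k - e < Sup {F \<mu> | \<mu>. compat W n \<mu> k}" using assms by (auto simp: upper_def)
  then obtain y where "y \<in> {F \<mu> | \<mu>. compat W n \<mu> k}" "upper W F n k - e < y"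
    using less_cSupD[of "{F \<mu> | \<mu>. compat W n \<mu> k}" "upper W F n k - e"] assms by blast
  then show ?thesis using that by blast
qed

text \<open>The limit is compatible with its own counts, so the bound is never below
  \<open>F \<nu>\<close>. In the other direction, near-maximisers at level n converge vaguely to the
  limit by \<open>compat_convergence\<close>, and continuity of \<open>F\<close> along this sequence
  suffices.\<close>

lemma upper_tendsto:
  assumes W: "compact W" and cont: "continuous_map (vague_topology (limit_space W)) euclideanreal F"
    and \<nu>: "\<nu> \<in> locally_finite_counting_measures (limit_space W)"
    and diag: "\<And>n. emeasure \<nu> (off_diag W n) = 0"
  shows "(\<lambda>n. upper W F n (cell_counts W n \<nu>)) \<longlonglongrightarrow> F \<nu>"
proof -
  have self: "compat W n \<nu> (cell_counts W n \<nu>)" for n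
    using \<nu> diag by (simp add: compat_def cell_counts_def)
  have "\<exists>\<mu>. compat W n \<mu> (cell_counts W n \<nu>) \<and> upper W F n (cell_counts W n \<nu>) - mesh n < F \<mu>" for n
    using upper_approx[OF self mesh_pos] by metis
  then have "\<exists>\<mu>. \<forall>n. compat W n (\<mu> n) (cell_counts W n \<nu>) \<and> upper W F n (cell_counts W n \<nu>) - mesh n < F (\<mu> n)"
    by (intro choice) blast
  then obtain \<mu> where \<mu>: "\<And>n. compat W n (\<mu> n) (cell_counts W n \<nu>)"
      "\<And>n. upper W F n (cell_counts W n \<nu>) - mesh n < F (\<mu> n)" by blast
  have "limitin (vague_topology (limit_space W)) \<mu> \<nu> sequentially"
    by (rule compat_convergence[OF W \<nu> diag \<mu>(1)])
  then have "limitin euclideanreal (F \<circ> \<mu>) (F \<nu>) sequentially"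
    by (rule continuous_map_limit[OF cont])
  then have "(\<lambda>n. F (\<mu> n)) \<longlonglongrightarrow> F \<nu>" by (simp add: o_def)
  then have "(\<lambda>n. F (\<mu> n) + mesh n) \<longlonglongrightarrow> F \<nu> + 0" by (intro tendsto_add mesh_tendsto)
  then have up: "(\<lambda>n. F (\<mu> n) + mesh n) \<longlonglongrightarrow> F \<nu>" by simp
  have "\<forall>\<^sub>F n in sequentially. F \<nu> \<le> upper W F n (cell_counts W n \<nu>)"
    by (intro always_eventually allI le_upper self)
  moreover have "\<forall>\<^sub>F n in sequentially. upper W F n (cell_counts W n \<nu>) \<le> F (\<mu> n) + mesh n"
  proof (intro always_eventually allI)
    fix n show "upper W F n (cell_counts W n \<nu>) \<le> F (\<mu> n) + mesh n" using \<mu>(2)[of n] by linarith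
  qed
  ultimately show ?thesis by (rule tendsto_sandwich[OF _ _ tendsto_const up])
qed

end

section \<open>The limiting intensity measure\<close>

locale diag_power =
  fixes \<alpha> :: real and K :: "(ennreal \<times> ennreal) measure"
  assumes K: "is_diag_power_measure \<alpha> K" and alpha_pos: "0 < \<alpha>"
begin

lemma sets_K: "sets K = sets (borel_of (prod_topology (mtopology_of recip_metric) (mtopology_of recip_metric)))"
  using K by (simp add: is_diag_power_measure_def)

lemma space_K: "space K = {0<..} \<times> {0<..}"
  using sets_eq_imp_space_eq[OF sets_K] by simp

lemma recip_components_measurable [measurable]:
  "(\<lambda>p. recip (fst p)) \<in> borel_measurable K" "(\<lambda>p. recip (snd p)) \<in> borel_measurable K"
proof -
  have c: "continuous_map (mtopology_of recip_metric) euclidean recip"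
    using homeomorphic_imp_continuous_map[OF homeomorphic_map_recip] by (simp add: continuous_map_in_subtopology)
  let ?T = "prod_topology (mtopology_of recip_metric) (mtopology_of recip_metric)"
  have "continuous_map ?T euclidean (\<lambda>p. recip (fst p))" "continuous_map ?T euclidean (\<lambda>p. recip (snd p))"
    using continuous_map_compose[OF continuous_map_fst c] continuous_map_compose[OF continuous_map_snd c]
    by (simp_all add: o_def)
  from this[THEN continuous_map_borel_measurable]
  show "(\<lambda>p. recip (fst p)) \<in> borel_measurable K" "(\<lambda>p. recip (snd p)) \<in> borel_measurable K"
    using measurable_cong_sets[OF sets_K refl] by blast+
qed

lemma recip_eq_iff: "0 < x \<Longrightarrow> 0 < y \<Longrightarrow> recip x = recip y \<longleftrightarrow> x = y"
  by (metis inverse_recip)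

text \<open>Reciprocals turn (a, b] into [1/b, 1/a), the half-open shape of the floor cells, so the
  prescribed values of \<open>K\<close> apply to grid cells directly.\<close>

lemma diag_piece_eq:
  assumes "0 < a" "a < b"
  shows "{(x, x) | x. ennreal a < x \<and> x \<le> ennreal b} = {p \<in> space K. recip (fst p) = recip (snd p) \<and> 1 / b \<le> recip (fst p) \<and> recip (fst p) < 1 / a}"
proof -
  have iff: "ennreal a < x \<and> x \<le> ennreal b \<longleftrightarrow> 0 < x \<and> 1 / b \<le> recip x \<and> recip x < 1 / a" for x
  proof (cases x)
    case (real r)
    show ?thesis
    proof (cases "0 < r")
      case True
      then show ?thesis using real assms
        by (auto simp: recip_ennreal ennreal_less_iff ennreal_le_iff divide_simps)
    next
      case False
      then show ?thesis using real assms by simp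
    qed
  next
    case top
    then show ?thesis using assms by (auto simp: top_unique)
  qed
  show ?thesis using iff recip_eq_iff by (auto simp: space_K)
qed

lemma diag_null: "emeasure K {p \<in> space K. recip (fst p) \<noteq> recip (snd p) \<or> recip (fst p) = 0} = 0"
proof -
  have "{p \<in> space K. recip (fst p) \<noteq> recip (snd p) \<or> recip (fst p) = 0} = space K - {(x, x) | x. 0 < x \<and> x < \<infinity>}"
  proof -
    have "recip x = 0 \<longleftrightarrow> x = \<infinity>" if "0 < x" for x
      using recip_eq_iff[OF that, of \<infinity>] by simp
    then show ?thesis using recip_eq_iff by (auto simp: space_K less_top)
  qed
  then show ?thesis using K by (simp add: is_diag_power_measure_def)
qed

definition strip :: "real \<Rightarrow> real \<Rightarrow> (ennreal \<times> ennreal) set" where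
  "strip u v = {p \<in> space K. recip (fst p) = recip (snd p) \<and> u \<le> recip (fst p) \<and> recip (fst p) < v}"

lemma strip_sets [measurable]: "strip u v \<in> sets K"
  unfolding strip_def by measurable

lemma emeasure_strip_pos:
  assumes "0 < u" "u < v"
  shows "emeasure K (strip u v) = ennreal (v powr \<alpha> - u powr \<alpha>)"
proof -
  have "emeasure K {(x, x) | x. ennreal (1 / v) < x \<and> x \<le> ennreal (1 / u)} =
      ennreal ((1 / v) powr (- \<alpha>) - (1 / u) powr (- \<alpha>))"
    using K assms unfolding is_diag_power_measure_def by (simp add: frac_less2)
  then show ?thesis
    using assms by (subst (asm) diag_piece_eq) (auto simp: strip_def frac_less2 powr_divide powr_minus_divide)
qed

text \<open>The defining formula covers only bounded pieces, that is, positive lower ends of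
  reciprocals. The strips starting at v/(n + 2) increase to everything but the point at infinity,
  which is null for \<open>K\<close>; the 2 keeps their lower ends strictly below v already at n =
  0.\<close>

lemma emeasure_strip_zero:
  assumes v: "0 < v"
  shows "emeasure K (strip 0 v) = ennreal (v powr \<alpha>)"
proof -
  let ?A = "\<lambda>n. strip (v / real (n + 2)) v"
  have lim: "(\<lambda>n. emeasure K (?A n)) \<longlonglongrightarrow> emeasure K (\<Union>n. ?A n)"
  proof (rule Lim_emeasure_incseq)
    show "range ?A \<subseteq> sets K" by (auto intro: strip_sets)
    show "incseq ?A"
    proof (rule incseq_SucI)
      fix n
      have "v / real (Suc n + 2) \<le> v / real (n + 2)" using v by (intro divide_left_mono) auto
      then show "?A n \<le> ?A (Suc n)" by (auto simp: strip_def)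
    qed
  qed
  have "(\<lambda>n. v powr \<alpha> - (v / real (n + 2)) powr \<alpha>) \<longlonglongrightarrow> v powr \<alpha> - 0 powr \<alpha>"
  proof (intro tendsto_diff tendsto_const tendsto_powr')
    have "(\<lambda>n. v / real (n + 2)) \<longlonglongrightarrow> 0"
      by (rule LIMSEQ_ignore_initial_segment[of "\<lambda>n. v / real n", OF lim_const_over_n])
    then show "(\<lambda>n. v / real (n + 2)) \<longlonglongrightarrow> 0" .
  qed (use v alpha_pos in auto)
  then have "(\<lambda>n. ennreal (v powr \<alpha> - (v / real (n + 2)) powr \<alpha>)) \<longlonglongrightarrow> ennreal (v powr \<alpha>)"
    using alpha_pos by (intro tendsto_ennrealI) simp
  moreover have "ennreal (v powr \<alpha> - (v / real (n + 2)) powr \<alpha>) = emeasure K (?A n)" for n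
    using v by (subst emeasure_strip_pos) (auto simp: field_simps add_pos_nonneg)
  ultimately have "(\<lambda>n. emeasure K (?A n)) \<longlonglongrightarrow> ennreal (v powr \<alpha>)" by simp
  with lim have eq: "emeasure K (\<Union>n. ?A n) = ennreal (v powr \<alpha>)" by (rule LIMSEQ_unique)
  let ?N = "{p \<in> space K. recip (fst p) \<noteq> recip (snd p) \<or> recip (fst p) = 0}"
  have N: "?N \<in> null_sets K"
  proof -
    have "?N \<in> sets K" by measurable
    then show ?thesis using diag_null by auto
  qed
  have sub: "strip 0 v \<subseteq> (\<Union>n. ?A n) \<union> ?N"
  proof
    fix p assume p: "p \<in> strip 0 v"
    show "p \<in> (\<Union>n. ?A n) \<union> ?N"
    proof (cases "recip (fst p) = 0")
      case False
      then have pos: "0 < recip (fst p)" using recip_nonneg[of "fst p"] by linarith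
      obtain n :: nat where n: "v / recip (fst p) < n" using reals_Archimedean2 by blast
      have "v < recip (fst p) * real n" using n pos by (simp add: field_simps)
      also have "\<dots> \<le> recip (fst p) * real (n + 2)" using pos by (intro mult_left_mono) auto
      finally have "v / real (n + 2) \<le> recip (fst p)" by (simp add: field_simps)
      then have "p \<in> ?A n" using p by (simp add: strip_def)
      then show ?thesis by blast
    qed (use p in \<open>auto simp: strip_def\<close>)
  qed
  have "emeasure K (strip 0 v) \<le> emeasure K ((\<Union>n. ?A n) \<union> ?N)"
    using sub N by (intro emeasure_mono) auto
  also have "\<dots> = emeasure K (\<Union>n. ?A n)" using N by (intro emeasure_Un_null_set) auto
  finally have "emeasure K (strip 0 v) \<le> ennreal (v powr \<alpha>)" by (simp only: eq)
  moreover have "emeasure K (\<Union>n. ?A n) \<le> emeasure K (strip 0 v)"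
    using v by (intro emeasure_mono) (auto simp: strip_def intro: order_trans[rotated])
  ultimately show ?thesis using eq by (intro antisym) auto
qed

lemma emeasure_strip:
  assumes "0 \<le> u" "u < v"
  shows "emeasure K (strip u v) = ennreal (v powr \<alpha> - u powr \<alpha>)"
proof (cases "u = 0")
  case True
  then show ?thesis using emeasure_strip_zero[of v] assms alpha_pos by simp
next
  case False
  then show ?thesis using emeasure_strip_pos[of u v] assms by simp
qed

lemma emeasure_diag_part:
  assumes A: "A \<in> sets K" and eq: "A \<inter> {p. recip (fst p) = recip (snd p)} = strip u v"
  shows "emeasure K A = emeasure K (strip u v)"
proof -
  let ?N = "{p \<in> space K. recip (fst p) \<noteq> recip (snd p) \<or> recip (fst p) = 0}"
  have N: "?N \<in> null_sets K"
  proof -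
    have "?N \<in> sets K" by measurable
    then show ?thesis using diag_null by auto
  qed
  have "A \<subseteq> strip u v \<union> ?N" using eq sets.sets_into_space[OF A] by blast
  then have "emeasure K A \<le> emeasure K (strip u v \<union> ?N)" using N by (intro emeasure_mono) auto
  also have "\<dots> = emeasure K (strip u v)" using N by (intro emeasure_Un_null_set) auto
  finally show ?thesis using emeasure_mono[of "strip u v" A K] A eq by (intro antisym) auto
qed

lemma sigma_finite_K: "sigma_finite_measure K"
proof
  let ?A = "\<lambda>n::nat. {p \<in> space K. recip (fst p) < real (n + 1)}"
  have A: "?A n \<in> sets K" for n by measurable
  have "emeasure K (?A n) = emeasure K (strip 0 (real (n + 1)))" for n
    by (rule emeasure_diag_part[OF A]) (auto simp: strip_def)
  then have fin: "emeasure K (?A n) \<noteq> \<infinity>" for n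
    using emeasure_strip_zero[of "real (n + 1)"] by simp
  have "(\<Union>n. ?A n) = space K"
  proof safe
    fix x y assume p: "(x, y) \<in> space K"
    obtain n :: nat where "recip x < n" using reals_Archimedean2 by blast
    then have "(x, y) \<in> ?A n" using p by simp
    then show "(x, y) \<in> (\<Union>n. ?A n)" by blast
  qed
  then show "\<exists>A. countable A \<and> A \<subseteq> sets K \<and> \<Union>A = space K \<and> (\<forall>a\<in>A. emeasure K a \<noteq> \<infinity>)"
    using A fin by (intro exI[of _ "range ?A"]) auto
qed

lemma emeasure_limit_box:
  fixes W :: "'a::euclidean_space set"
  assumes W: "W \<in> sets borel" and S: "S \<in> sets borel" and A: "A \<in> sets K"
  shows "emeasure (restrict_space lborel W \<Otimes>\<^sub>M K) ((W \<inter> S) \<times> A) = emeasure lborel (W \<inter> S) * emeasure K A"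
proof -
  interpret K: sigma_finite_measure K by (rule sigma_finite_K)
  have "W \<inter> S \<in> sets (restrict_space lborel W)"
    using W S by (auto simp: sets_restrict_space)
  then have "emeasure (restrict_space lborel W \<Otimes>\<^sub>M K) ((W \<inter> S) \<times> A) = emeasure (restrict_space lborel W) (W \<inter> S) * emeasure K A"
    using A by (rule K.emeasure_pair_measure_Times)
  also have "emeasure (restrict_space lborel W) (W \<inter> S) = emeasure lborel (W \<inter> S)"
    using W by (intro emeasure_restrict_space) auto
  finally show ?thesis .
qed

lemma emeasure_cell2:
  fixes W :: "'a::euclidean_space set"
  assumes W: "W \<in> sets borel" and z: "0 \<le> snd z"
  shows "emeasure (restrict_space lborel W \<Otimes>\<^sub>M K) (cell2 W n z) =
    emeasure lborel (W \<inter> {x. quant (mesh n) x = fst z}) *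
      ennreal ((mesh n * (snd z + 1)) powr \<alpha> - (mesh n * snd z) powr \<alpha>)"
proof -
  let ?A = "{p \<in> space K. \<lfloor>recip (fst p) / mesh n\<rfloor> = snd z \<and> \<bar>recip (fst p) - recip (snd p)\<bar> \<le> mesh n}"
  have A: "?A \<in> sets K" by measurable
  have floor: "\<lfloor>u / mesh n\<rfloor> = i \<longleftrightarrow> mesh n * i \<le> u \<and> u < mesh n * (i + 1)" for u i
    by (simp add: floor_eq_iff pos_le_divide_eq pos_divide_less_eq mult.commute)
  have eq: "cell2 W n z = (W \<inter> {x. quant (mesh n) x = fst z}) \<times> ?A"
    by (auto simp: cell2_def topspace_limit_space space_K)
  have "emeasure K ?A = emeasure K (strip (mesh n * snd z) (mesh n * (snd z + 1)))"
    using mesh_pos[of n] by (intro emeasure_diag_part[OF A]) (auto simp: strip_def floor less_imp_le)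
  also have "\<dots> = ennreal ((mesh n * (snd z + 1)) powr \<alpha> - (mesh n * snd z) powr \<alpha>)"
    using z by (intro emeasure_strip) (auto simp: less_imp_le)
  finally show ?thesis
    unfolding eq using emeasure_limit_box[OF W quant_cell_sets A] by simp
qed

lemma emeasure_off_diag:
  fixes W :: "'a::euclidean_space set"
  assumes W: "W \<in> sets borel"
  shows "emeasure (restrict_space lborel W \<Otimes>\<^sub>M K) (off_diag W n) = 0"
proof -
  let ?A = "{p \<in> space K. recip (fst p) < real (Suc n) \<and> mesh n < \<bar>recip (fst p) - recip (snd p)\<bar>}"
  have A: "?A \<in> sets K" by measurable
  have "\<not> mesh n < 0" using mesh_pos[of n] by linarith
  \<comment> \<open>The diagonal does not meet the set; \<open>strip 1 0\<close> serves as a name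
    for the empty set, so that \<open>emeasure_diag_part\<close> applies.\<close>
  then have "?A \<inter> {p. recip (fst p) = recip (snd p)} = strip 1 0"
    by (auto simp: strip_def)
  then have "emeasure K ?A = emeasure K (strip 1 0)" by (rule emeasure_diag_part[OF A])
  also have "strip 1 0 = {}" by (auto simp: strip_def)
  finally have "emeasure K ?A = 0" by simp
  moreover have "off_diag W n = (W \<inter> UNIV) \<times> ?A"
    by (auto simp: off_diag_def topspace_limit_space space_K)
  ultimately show ?thesis using emeasure_limit_box[OF W _ A, of UNIV] by simp
qed

end

section \<open>Convergence\<close>

text \<open>The preimage of \<open>cell2\<close> under the rescaling when the inradius is replaced
  by the mark. The Poisson process has explicitly known counts on it.\<close>

definition eta_cell :: "'a::euclidean_space set \<Rightarrow> nat \<Rightarrow> real \<Rightarrow> real \<Rightarrow> 'a \<times> int \<Rightarrow> ('a \<times> real) set" where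
  "eta_cell W n \<rho> s z = {x. (1 / \<rho>) *\<^sub>R x \<in> W \<inter> {x. quant (mesh n) x = fst z}} \<times> {m. 0 < m \<and> \<lfloor>s / m / mesh n\<rfloor> = snd z}"

lemma index_less:
  assumes "\<lfloor>u / mesh n\<rfloor> \<in> indices n"
  shows "u < real (Suc n)"
proof -
  have "\<lfloor>u / mesh n\<rfloor> < (int n + 1)\<^sup>2" using assms by (simp add: indices_def)
  then have "u / mesh n < of_int ((int n + 1)\<^sup>2)" by linarith
  then have "u * real (Suc n) < real (Suc n) * real (Suc n)"
    by (simp add: mesh_def power2_eq_square algebra_simps)
  then show ?thesis by (simp only: mult_less_cancel_right_pos of_nat_0_less_iff zero_less_Suc)
qed

lemma scaled_sets:
  fixes S :: "'a::euclidean_space set"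
  assumes "S \<in> sets borel"
  shows "{x. c *\<^sub>R x \<in> S} \<in> sets borel"
proof -
  have "(\<lambda>x::'a. c *\<^sub>R x) \<in> borel_measurable borel" by measurable
  from measurable_sets[OF this assms] show ?thesis by (simp add: vimage_def)
qed

lemma mark_cell_sets: "{m::real. 0 < m \<and> \<lfloor>s / m / h\<rfloor> = i} \<in> sets borel"
  by measurable

lemma eta_cell_sets:
  assumes "W \<in> sets borel"
  shows "eta_cell W n \<rho> s z \<in> sets borel"
  unfolding eta_cell_def
  by (intro borel_Times scaled_sets mark_cell_sets sets.Int assms quant_cell_sets)

context rescaled
begin

lemma window_iff: "x \<in> window \<longleftrightarrow> (1 / \<rho>) *\<^sub>R x \<in> W"
proof
  assume "(1 / \<rho>) *\<^sub>R x \<in> W"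
  then show "x \<in> window" using rho_pos by (intro image_eqI[of _ _ "(1 / \<rho>) *\<^sub>R x"]) auto
qed (use rho_pos in auto)

text \<open>For reciprocal marks below n + 1, a relative inradius error \<delta> gives a reciprocal
  error of at most 2 \<delta> (n + 1). With \<delta> = mesh^2/2 this is exactly the band width of
  \<open>cell2\<close>, so every counted point falls into the cell of its mark and none is off the
  diagonal.\<close>

lemma compat_Xi:
  assumes \<nu>: "good_config \<nu>"
    and close: "\<And>x m. (x, m) \<in> points \<nu> \<Longrightarrow> x \<in> window \<Longrightarrow> mesh n * s \<le> m \<Longrightarrow>
        ennreal ((1 - (mesh n)\<^sup>2 / 2) * m) \<le> inradius (x, m) (points \<nu>) \<and>
        inradius (x, m) (points \<nu>) \<le> ennreal ((1 + (mesh n)\<^sup>2 / 2) * m)"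
  shows "compat W n (Xi \<gamma> \<alpha> Q W \<rho> \<nu>) (\<lambda>z\<in>cells2 W n. emeasure \<nu> (eta_cell W n \<rho> s z))"
proof -
  let ?\<delta> = "(mesh n)\<^sup>2 / 2"
  have mesh1: "mesh n \<le> 1" by (simp add: mesh_def)
  have "(mesh n)\<^sup>2 \<le> 1" using mesh1 mesh_pos[of n] by (simp add: power_le_one less_imp_le)
  moreover have "0 < (mesh n)\<^sup>2" by (intro zero_less_power mesh_pos)
  ultimately have \<delta>: "0 < ?\<delta>" "?\<delta> \<le> 1 / 2" by linarith+
  have rcm: "recip (ennreal (m / s)) = s / m" if "0 < m" for m
    using that scale_pos by (simp add: recip_ennreal)
  have near: "0 < inradius (x, m) (points \<nu>) \<and> \<bar>s / m - recip (inradius (x, m) (points \<nu>) / ennreal s)\<bar> \<le> mesh n"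
    if p: "(x, m) \<in> points \<nu>" "x \<in> window" "0 < m" "s / m < real (Suc n)" for x m
  proof -
    have "mesh n * s \<le> m" using p(3,4) by (simp add: mesh_def field_simps)
    note c = close[OF p(1,2) this]
    have "0 < (1 - ?\<delta>) * m" using \<delta> p(3) by simp
    then have "0 < inradius (x, m) (points \<nu>)" using c by (metis ennreal_less_zero_iff less_le_trans)
    moreover have "\<bar>recip (ennreal (m / s)) - recip (inradius (x, m) (points \<nu>) / ennreal s)\<bar> \<le> 2 * ?\<delta> * (s / m)"
      by (rule recip_inradius_close[OF \<delta> p(3) scale_pos]) (use c in auto)
    moreover have "2 * ?\<delta> * (s / m) \<le> 2 * ?\<delta> * real (Suc n)"
      using p(4) \<delta> by (intro mult_left_mono) auto
    moreover have "2 * ?\<delta> * real (Suc n) = mesh n" by (simp add: mesh_def power2_eq_square)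
    ultimately show ?thesis by (simp add: rcm[OF p(3)])
  qed
  have cell: "{p \<in> contrib \<nu>. rescale \<nu> p \<in> cell2 W n z} = points \<nu> \<inter> eta_cell W n \<rho> s z"
    if z: "z \<in> cells2 W n" for z
  proof (intro set_eqI iffI)
    fix p assume p: "p \<in> {p \<in> contrib \<nu>. rescale \<nu> p \<in> cell2 W n z}"
    obtain x m where xm: "p = (x, m)" by (cases p)
    have "(x, m) \<in> points \<nu>" "x \<in> window" "0 < m" using p by (auto simp: contrib_def xm)
    then show "p \<in> points \<nu> \<inter> eta_cell W n \<rho> s z"
      using p rcm[of m] window_iff[of x] by (simp add: eta_cell_def cell2_def rescale_def xm)
  next
    fix p assume p: "p \<in> points \<nu> \<inter> eta_cell W n \<rho> s z"
    obtain x m where xm: "p = (x, m)" by (cases p)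
    have a: "(x, m) \<in> points \<nu>" "x \<in> window" "0 < m" "\<lfloor>s / m / mesh n\<rfloor> = snd z" "quant (mesh n) ((1 / \<rho>) *\<^sub>R x) = fst z"
      using p by (auto simp: eta_cell_def xm window_iff)
    have "s / m < real (Suc n)" by (rule index_less) (use a(4) z in \<open>auto simp: cells2_def\<close>)
    note nr = near[OF a(1-3) this]
    have c: "p \<in> contrib \<nu>" using a nr by (simp add: contrib_def xm)
    then have "rescale \<nu> p \<in> topspace (limit_space W)" by (rule rescale_topspace)
    then show "p \<in> {p \<in> contrib \<nu>. rescale \<nu> p \<in> cell2 W n z}"
      using c a nr by (simp add: cell2_def rescale_def xm rcm)
  qed
  have off: "{p \<in> contrib \<nu>. rescale \<nu> p \<in> off_diag W n} = {}"
  proof -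
    have False if p: "p \<in> contrib \<nu>" "rescale \<nu> p \<in> off_diag W n" for p
    proof -
      obtain x m where xm: "p = (x, m)" by (cases p)
      have a: "(x, m) \<in> points \<nu>" "x \<in> window" "0 < m" using p by (auto simp: contrib_def xm)
      have "s / m < real (Suc n)" "mesh n < \<bar>s / m - recip (inradius (x, m) (points \<nu>) / ennreal s)\<bar>"
        using p(2) rcm[OF a(3)] by (auto simp: off_diag_def rescale_def xm)
      then show False using near[OF a] by linarith
    qed
    then show ?thesis by blast
  qed
  have count: "emeasure \<nu> (eta_cell W n \<rho> s z) = of_nat (card (points \<nu> \<inter> eta_cell W n \<rho> s z))" for z
  proof (rule good_config_count(2)[OF \<nu> eta_cell_sets _ compact_imp_bounded[OF window_compact]])
    show "W \<in> sets borel" using W by (intro borel_closed compact_imp_closed)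
    show "eta_cell W n \<rho> s z \<subseteq> window \<times> {0..}" by (auto simp: eta_cell_def window_iff)
  qed
  show ?thesis
    unfolding compat_def
  proof (intro conjI ballI)
    show "Xi \<gamma> \<alpha> Q W \<rho> \<nu> \<in> locally_finite_counting_measures (limit_space W)" by (rule Xi_counting_measure[OF \<nu>])
    show "emeasure (Xi \<gamma> \<alpha> Q W \<rho> \<nu>) (off_diag W n) = 0"
      unfolding emeasure_Xi[OF \<nu> off_diag_sets] off by simp
    fix z assume z: "z \<in> cells2 W n"
    show "emeasure (Xi \<gamma> \<alpha> Q W \<rho> \<nu>) (cell2 W n z) = (\<lambda>z\<in>cells2 W n. emeasure \<nu> (eta_cell W n \<rho> s z)) z"
      unfolding emeasure_Xi[OF \<nu> cell2_sets] cell[OF z] using count z by simp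
  qed
qed

end

section \<open>Intensities of the grid cells and their limits\<close>

lemma emeasure_scaled:
  fixes S :: "'a::euclidean_space set"
  assumes S: "S \<in> sets borel" and r: "0 < r"
  shows "emeasure lborel {x. (1 / r) *\<^sub>R x \<in> S} = ennreal (r ^ DIM('a)) * emeasure lborel S"
proof -
  have eq: "{x. (1 / r) *\<^sub>R x \<in> S} = (\<lambda>x. r *\<^sub>R x + 0) ` S"
  proof safe
    fix x assume "(1 / r) *\<^sub>R x \<in> S"
    then show "x \<in> (\<lambda>x. r *\<^sub>R x + 0) ` S" using r by (intro image_eqI[of _ _ "(1 / r) *\<^sub>R x"]) auto
  qed (use r in auto)
  have "emeasure lebesgue ((\<lambda>x. r *\<^sub>R x + 0) ` S) = ennreal (\<bar>r\<bar> ^ DIM('a)) * emeasure lebesgue S"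
    using emeasure_lebesgue_affine[of r 0 S] by simp
  moreover have "emeasure lebesgue S = emeasure lborel S" using S by simp
  moreover have "emeasure lebesgue {x. (1 / r) *\<^sub>R x \<in> S} = emeasure lborel {x. (1 / r) *\<^sub>R x \<in> S}"
    using scaled_sets[OF S] by simp
  ultimately show ?thesis using r unfolding eq by simp
qed

context marked_poisson
begin

lemma mark_cell_Q: "{m::real. 0 < m \<and> \<lfloor>s / m / h\<rfloor> = i} \<in> sets Q"
  by (rule Q.sets_QI[OF mark_cell_sets]) auto

text \<open>The cell with index 0 is a half-line containing all sufficiently large marks, whereas
  the others are differences of two tails. It is a separate case because the division by zero in the
  second tail would give the tail at 0.\<close>

lemma measure_mark_cell:
  assumes s: "0 < s" and h: "0 < h" and i: "0 \<le> i"
  shows "measure Q {m. 0 < m \<and> \<lfloor>s / m / h\<rfloor> = i} =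
     Q.tail (1 / (h * (real_of_int i + 1)) * s) - (if i = 0 then 0 else Q.tail (1 / (h * real_of_int i) * s))"
proof (cases "i = 0")
  case True
  have "{m. 0 < m \<and> \<lfloor>s / m / h\<rfloor> = i} = {s / h<..}"
  proof (intro set_eqI iffI)
    fix m assume "m \<in> {m. 0 < m \<and> \<lfloor>s / m / h\<rfloor> = i}"
    then show "m \<in> {s / h<..}" using h True by (auto simp: floor_eq_iff field_simps)
  next
    fix m assume m: "m \<in> {s / h<..}"
    have "0 < s / h" using s h by simp
    also have "s / h < m" using m by simp
    finally have "0 < m" .
    then show "m \<in> {m. 0 < m \<and> \<lfloor>s / m / h\<rfloor> = i}" using m s h True by (auto simp: floor_eq_iff field_simps)
  qed
  then show ?thesis using True by (simp add: Q.tail_def)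
next
  case False
  then have i0: "0 < real_of_int i" using i by simp
  have "{m. 0 < m \<and> \<lfloor>s / m / h\<rfloor> = i} = {s / (h * (i + 1))<..} - {s / (h * i)<..}"
  proof (intro set_eqI iffI)
    fix m assume "m \<in> {m. 0 < m \<and> \<lfloor>s / m / h\<rfloor> = i}"
    then have m: "0 < m" "real_of_int i \<le> s / m / h" "s / m / h < real_of_int i + 1" by (auto simp: floor_eq_iff)
    have p: "0 < h * (real_of_int i + 1)" "0 < h * real_of_int i" using h i0 by auto
    have "s < m * (h * (real_of_int i + 1))" "m * (h * real_of_int i) \<le> s"
      using m h by (simp_all add: pos_divide_less_eq pos_le_divide_eq algebra_simps)
    then show "m \<in> {s / (h * (i + 1))<..} - {s / (h * i)<..}"
      using p by (simp add: pos_divide_less_eq pos_le_divide_eq)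
  next
    fix m assume m: "m \<in> {s / (h * (i + 1))<..} - {s / (h * i)<..}"
    have p: "0 < h * (real_of_int i + 1)" "0 < h * real_of_int i" using h i0 by simp_all
    have m1: "s / (h * (real_of_int i + 1)) < m" and m2: "m \<le> s / (h * real_of_int i)"
      using m by (simp_all only: Diff_iff greaterThan_iff not_less of_int_add of_int_1)
    have m0: "0 < m" by (rule less_trans[OF divide_pos_pos[OF s p(1)] m1])
    have a: "s < (real_of_int i + 1) * (m * h)"
      using iffD1[OF pos_divide_less_eq[OF p(1)] m1] by (simp only: mult_ac)
    have b: "real_of_int i * (m * h) \<le> s"
      using iffD1[OF pos_le_divide_eq[OF p(2)] m2] by (simp only: mult_ac)
    have mh: "0 < m * h" using m0 h by simp
    have "real_of_int i \<le> s / (m * h)" "s / (m * h) < real_of_int i + 1"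
      unfolding pos_divide_less_eq[OF mh] pos_le_divide_eq[OF mh] by (rule b, rule a)
    then have "\<lfloor>s / m / h\<rfloor> = i"
      by (simp only: divide_divide_eq_left floor_eq_iff simp_thms)
    with m0 show "m \<in> {m. 0 < m \<and> \<lfloor>s / m / h\<rfloor> = i}" by simp
  qed
  moreover have "measure Q ({s / (h * (i + 1))<..} - {s / (h * i)<..}) =
      Q.tail (s / (h * (i + 1))) - Q.tail (s / (h * i))"
    unfolding Q.tail_def
  proof (rule Q.finite_measure_Diff)
    show "{s / (h * (i + 1))<..} \<in> sets Q" "{s / (h * i)<..} \<in> sets Q"
      using s h i0 by (auto intro!: Q.tail_sets)
    show "{s / (h * i)<..} \<subseteq> {s / (h * (i + 1))<..}"
    proof (rule subsetI)
      fix x assume "x \<in> {s / (h * i)<..}"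
      moreover have "s / (h * (i + 1)) \<le> s / (h * i)"
        by (rule divide_left_mono) (use s h i0 in simp_all)
      ultimately have "s / (h * (i + 1)) < x" by simp
      then show "x \<in> {s / (h * (i + 1))<..}" by simp
    qed
  qed
  ultimately show ?thesis using False by simp
qed

text \<open>Empty for the irrelevant \<open>\<rho>\<close> where \<open>1 / \<rho>\<close> or \<open>q \<rho>\<close> is degenerate, so that its intensity is always finite.\<close>

definition eta_cell' :: "'x set \<Rightarrow> nat \<Rightarrow> real \<Rightarrow> 'x \<times> int \<Rightarrow> ('x \<times> real) set" where
  "eta_cell' W n \<rho> z = (if 0 < \<rho> \<and> 0 < q \<rho> then eta_cell W n \<rho> (q \<rho>) z else {})"

lemma measure_eta_cell:
  fixes W :: "'x set"
  assumes W: "compact W" and \<rho>: "0 < \<rho>"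
  shows "measure \<mu> (eta_cell W n \<rho> s z) = measure lborel (W \<inter> {x. quant (mesh n) x = fst z}) *
      (\<gamma> * \<rho> ^ d * measure Q {m. 0 < m \<and> \<lfloor>s / m / mesh n\<rfloor> = snd z})"
    and "emeasure \<mu> (eta_cell W n \<rho> s z) < \<infinity>"
proof -
  have Wb: "W \<in> sets borel" using W by (intro borel_closed compact_imp_closed)
  let ?S = "W \<inter> {x. quant (mesh n) x = fst z}"
  have S: "?S \<in> sets borel" using Wb quant_cell_sets by (intro sets.Int)
  have "emeasure lborel ?S \<le> emeasure lborel W" using Wb by (intro emeasure_mono) auto
  also have "\<dots> < \<infinity>" using emeasure_bounded_finite[OF compact_imp_bounded[OF W]] by simp
  finally have fin: "emeasure lborel ?S = ennreal (measure lborel ?S)" by (intro emeasure_eq_ennreal_measure) auto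
  have e: "emeasure lborel {x. (1 / \<rho>) *\<^sub>R x \<in> ?S} = ennreal (\<rho> ^ d * measure lborel ?S)"
    unfolding emeasure_scaled[OF S \<rho>] fin using \<rho> by (simp add: ennreal_mult dim)
  have nn: "0 \<le> \<rho> ^ d * measure lborel ?S" using \<rho> by simp
  note m = measure_box[OF scaled_sets[OF S] mark_cell_Q e nn]
  show "measure \<mu> (eta_cell W n \<rho> s z) = measure lborel ?S *
      (\<gamma> * \<rho> ^ d * measure Q {m. 0 < m \<and> \<lfloor>s / m / mesh n\<rfloor> = snd z})"
    unfolding eta_cell_def m(1) by (simp add: mult_ac)
  show "emeasure \<mu> (eta_cell W n \<rho> s z) < \<infinity>" unfolding eta_cell_def by (rule m(2))
qed

text \<open>An endpoint u > 0 of the reciprocal interval contributes \<gamma> \<rho>^d times the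
  tail at q/u, which tends to u^\<alpha>. The difference of the two endpoints is the
  \<open>K\<close>-mass of the corresponding strip; an endpoint 0 contributes 0.\<close>

lemma measure_eta_cell_tendsto:
  fixes W :: "'x set"
  assumes W: "compact W" and z: "0 \<le> snd z"
  shows "((\<lambda>\<rho>. measure \<mu> (eta_cell' W n \<rho> z)) \<longlongrightarrow> measure lborel (W \<inter> {x. quant (mesh n) x = fst z}) *
      ((mesh n * (snd z + 1)) powr \<alpha> - (mesh n * snd z) powr \<alpha>)) at_top"
proof -
  let ?i = "real_of_int (snd z)"
  let ?t = "\<lambda>\<rho>. \<gamma> * \<rho> ^ d * Q.tail (1 / (mesh n * (?i + 1)) * q \<rho>)
     - (if snd z = 0 then 0 else \<gamma> * \<rho> ^ d * Q.tail (1 / (mesh n * ?i) * q \<rho>))"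
  have p: "0 < mesh n * (?i + 1)" using z by (intro mult_pos_pos) auto
  have inv: "(1 / u) powr (- \<alpha>) = u powr \<alpha>" if "0 < u" for u :: real
    using that by (simp add: powr_divide powr_minus_divide)
  have "((\<lambda>\<rho>. \<gamma> * \<rho> ^ d * Q.tail (1 / (mesh n * (?i + 1)) * q \<rho>)) \<longlongrightarrow> (1 / (mesh n * (?i + 1))) powr (- \<alpha>)) at_top"
    by (rule tail_q_asymp) (use p in simp)
  then have t1: "((\<lambda>\<rho>. \<gamma> * \<rho> ^ d * Q.tail (1 / (mesh n * (?i + 1)) * q \<rho>)) \<longlongrightarrow> (mesh n * (?i + 1)) powr \<alpha>) at_top"
    unfolding inv[OF p] .
  have t2: "((\<lambda>\<rho>. if snd z = 0 then 0 else \<gamma> * \<rho> ^ d * Q.tail (1 / (mesh n * ?i) * q \<rho>)) \<longlongrightarrow> (mesh n * ?i) powr \<alpha>) at_top"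
  proof (cases "snd z = 0")
    case True
    then show ?thesis using alpha_pos by simp
  next
    case False
    then have p: "0 < mesh n * ?i" using z by (intro mult_pos_pos) auto
    have "((\<lambda>\<rho>. \<gamma> * \<rho> ^ d * Q.tail (1 / (mesh n * ?i) * q \<rho>)) \<longlongrightarrow> (1 / (mesh n * ?i)) powr (- \<alpha>)) at_top"
      by (rule tail_q_asymp) (use p in simp)
    then show ?thesis unfolding inv[OF p] using False by simp
  qed
  have lim: "((\<lambda>\<rho>. measure lborel (W \<inter> {x. quant (mesh n) x = fst z}) * ?t \<rho>) \<longlongrightarrow>
      measure lborel (W \<inter> {x. quant (mesh n) x = fst z}) * ((mesh n * (?i + 1)) powr \<alpha> - (mesh n * ?i) powr \<alpha>)) at_top"
    by (intro tendsto_mult tendsto_const tendsto_diff t1 t2)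
  have "\<forall>\<^sub>F \<rho> in at_top. measure lborel (W \<inter> {x. quant (mesh n) x = fst z}) * ?t \<rho> = measure \<mu> (eta_cell' W n \<rho> z)"
    using eventually_gt_at_top[of 0] q_pos[of 0]
  proof eventually_elim
    case (elim \<rho>)
    have "eta_cell' W n \<rho> z = eta_cell W n \<rho> (q \<rho>) z" using elim by (simp add: eta_cell'_def)
    then show ?case
      unfolding measure_eta_cell(1)[OF W elim(1)] measure_mark_cell[OF elim(2) mesh_pos z]
      by (simp only: measure_eta_cell(1)[OF W elim(1)] measure_mark_cell[OF elim(2) mesh_pos z])
        (simp add: right_diff_distrib)
  qed
  from tendsto_cong[OF this] lim show ?thesis by simp
qed

end

section \<open>Asymptotic upper bound for expectations of bounded continuous functionals\<close>

context marked_poisson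
begin

text \<open>Off a bad event the functional is dominated by the level-n bound evaluated at counts of
  the Poisson process itself, whose expectation converges. Fixing n first and then letting \<rho>
  grow decouples the discretisation from the inradius approximation.\<close>

lemma expectation_upper_bound:
  fixes W :: "'x set" and F :: "('x \<times> ennreal \<times> ennreal) measure \<Rightarrow> real"
    and \<Psi> :: "'v \<Rightarrow> ('x \<times> ennreal \<times> ennreal) measure"
  assumes W: "compact W"
    and K: "diag_power \<alpha> K"
    and \<Psi>: "poisson_process P' (limit_space W) (restrict_space lborel W \<Otimes>\<^sub>M K) \<Psi>"
    and \<kappa>: "good_kernel P \<kappa>" and eq: "AE \<omega> in P. \<kappa> \<omega> = \<eta> \<omega>"
    and cont: "continuous_map (vague_topology (limit_space W)) euclideanreal F"
    and bound: "\<And>\<mu>. \<mu> \<in> locally_finite_counting_measures (limit_space W) \<Longrightarrow> \<bar>F \<mu>\<bar> \<le> B"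
    and B: "0 \<le> B" and e: "0 < e"
  shows "\<forall>\<^sub>F \<rho> in at_top. (\<integral>\<omega>. F (Xi \<gamma> \<alpha> Q W \<rho> (\<kappa> \<omega>)) \<partial>P) < (\<integral>\<omega>. F (\<Psi> \<omega>) \<partial>P') + e"
proof -
  interpret D: diag_power \<alpha> K by (rule K)
  interpret X': poisson P' "limit_space W" "restrict_space lborel W \<Otimes>\<^sub>M K" \<Psi> by unfold_locales (rule \<Psi>)
  have Wb: "W \<in> sets borel" using W by (intro borel_closed compact_imp_closed)
  have Fm: "F \<in> borel_measurable (borel_of (vague_topology (limit_space W)))"
    by (rule continuous_map_borel_measurable[OF cont])
  have \<Psi>m: "\<Psi> \<in> P' \<rightarrow>\<^sub>M borel_of (vague_topology (limit_space W))"
    using \<Psi> by (simp add: poisson_process_def)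
  have uB: "\<bar>upper W F n k\<bar> \<le> B" for n k
    by (rule upper_abs_le[where F = F, OF bound B])
  have le_u: "F \<mu> \<le> upper W F n k" if "compat W n \<mu> k" for \<mu> n k
    by (rule le_upper[where F = F, OF bound that])
  have fin: "finite (cells2 W n)" for n by (rule finite_cells2[OF W])
  have index: "0 \<le> snd z" if "z \<in> cells2 W n" for z n using that by (auto simp: cells2_def indices_def)
  have cell2_measure: "emeasure (restrict_space lborel W \<Otimes>\<^sub>M K) (cell2 W n z) =
      ennreal (measure lborel (W \<inter> {x. quant (mesh n) x = fst z}) *
        ((mesh n * (snd z + 1)) powr \<alpha> - (mesh n * snd z) powr \<alpha>))"
    "0 \<le> measure lborel (W \<inter> {x. quant (mesh n) x = fst z}) *
        ((mesh n * (snd z + 1)) powr \<alpha> - (mesh n * snd z) powr \<alpha>)" if z: "z \<in> cells2 W n" for n z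
  proof -
    let ?S = "W \<inter> {x. quant (mesh n) x = fst z}"
    have "emeasure lborel ?S \<le> emeasure lborel W" using Wb by (intro emeasure_mono) auto
    also have "\<dots> < \<infinity>" using emeasure_bounded_finite[OF compact_imp_bounded[OF W]] by simp
    finally have f: "emeasure lborel ?S = ennreal (measure lborel ?S)" by (intro emeasure_eq_ennreal_measure) auto
    have "mesh n * snd z \<le> mesh n * (snd z + 1)" using mesh_pos[of n] by (simp add: less_imp_le)
    then have nn: "0 \<le> (mesh n * (snd z + 1)) powr \<alpha> - (mesh n * snd z) powr \<alpha>"
      using index[OF z] alpha_pos by (simp add: powr_mono2 less_imp_le)
    show "emeasure (restrict_space lborel W \<Otimes>\<^sub>M K) (cell2 W n z) =
      ennreal (measure lborel ?S * ((mesh n * (snd z + 1)) powr \<alpha> - (mesh n * snd z) powr \<alpha>))"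
      unfolding D.emeasure_cell2[OF Wb index[OF z]] f by (rule ennreal_mult[symmetric, OF measure_nonneg nn])
    show "0 \<le> measure lborel ?S * ((mesh n * (snd z + 1)) powr \<alpha> - (mesh n * snd z) powr \<alpha>)"
      using nn by simp
  qed
  define U where "U n = (\<integral>\<omega>. upper W F n (cell_counts W n (\<Psi> \<omega>)) \<partial>P')" for n
  have cc: "(\<lambda>\<omega>. cell_counts W n (\<Psi> \<omega>)) \<in> P' \<rightarrow>\<^sub>M count_space (cells2 W n \<rightarrow>\<^sub>E insert \<infinity> (range of_nat))" for n
    unfolding cell_counts_def by (rule X'.count_vector_measurable[OF fin cell2_sets])
  have AE_diag: "AE \<omega> in P'. \<forall>n. emeasure (\<Psi> \<omega>) (off_diag W n) = 0"
    unfolding AE_all_countable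
    by (intro allI X'.count_null off_diag_sets D.emeasure_off_diag Wb)
  have U_lim: "U \<longlonglongrightarrow> (\<integral>\<omega>. F (\<Psi> \<omega>) \<partial>P')"
    unfolding U_def
  proof (rule integral_dominated_convergence[where w = "\<lambda>_. B"])
    show "(\<lambda>\<omega>. F (\<Psi> \<omega>)) \<in> borel_measurable P'" by (rule measurable_compose[OF \<Psi>m Fm])
    show "(\<lambda>\<omega>. upper W F n (cell_counts W n (\<Psi> \<omega>))) \<in> borel_measurable P'" for n
      by (rule measurable_compose[OF cc]) simp
    show "AE \<omega> in P'. (\<lambda>n. upper W F n (cell_counts W n (\<Psi> \<omega>))) \<longlonglongrightarrow> F (\<Psi> \<omega>)"
      using AE_diag AE_space
    proof eventually_elim
      case (elim \<omega>)
      then show ?case by (intro upper_tendsto[where F = F, OF bound W cont X'.counting_measure]) auto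
    qed
    show "AE \<omega> in P'. norm (upper W F n (cell_counts W n (\<Psi> \<omega>))) \<le> B" for n
      by (intro AE_I2) (simp add: uB)
  qed simp
  have "\<forall>\<^sub>F n in sequentially. U n < (\<integral>\<omega>. F (\<Psi> \<omega>) \<partial>P') + e / 3"
    by (rule order_tendstoD(2)[OF U_lim]) (use e in simp)
  \<comment> \<open>From here on \<open>n\<close> is fixed. The inequality is strict, so it passes
    from \<open>U n\<close> to the expectations at large \<rho> with no additional error.\<close>
  then obtain n where n: "U n < (\<integral>\<omega>. F (\<Psi> \<omega>) \<partial>P') + e / 3" by (auto simp: eventually_sequentially)
  let ?N = "\<lambda>\<rho> \<omega>. \<lambda>z\<in>cells2 W n. emeasure (\<eta> \<omega>) (eta_cell' W n \<rho> z)"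
  have Nsets: "eta_cell' W n \<rho> z \<in> sets (borel_of marked_space)" for \<rho> z
  proof (cases "0 < \<rho> \<and> 0 < q \<rho>")
    case True
    have "eta_cell W n \<rho> (q \<rho>) z \<in> sets (borel_of marked_space)"
      by (rule borel_of_marked_spaceI[OF eta_cell_sets[OF Wb]]) (auto simp: eta_cell_def)
    then show ?thesis using True by (simp add: eta_cell'_def)
  qed (auto simp: eta_cell'_def)
  have "((\<lambda>\<rho>. \<integral>\<omega>. upper W F n (?N \<rho> \<omega>) \<partial>P) \<longlongrightarrow>
     (\<integral>\<omega>. upper W F n (\<lambda>z\<in>cells2 W n. emeasure (\<Psi> \<omega>) (cell2 W n z)) \<partial>P')) at_top"
  proof (rule poisson_count_vector_convergence[OF poisson \<Psi> fin])
    show "eta_cell' W n \<rho> z \<in> sets (borel_of marked_space)" for \<rho> z by (rule Nsets)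
    show "emeasure \<mu> (eta_cell' W n \<rho> z) < \<infinity>" for \<rho> z
      using measure_eta_cell(2)[OF W, of \<rho>] by (simp add: eta_cell'_def)
    show "disjoint_family_on (eta_cell' W n \<rho>) (cells2 W n)" for \<rho>
      by (auto simp: disjoint_family_on_def eta_cell'_def eta_cell_def)
    show "cell2 W n z \<in> sets (borel_of (limit_space W))" for z by (rule cell2_sets)
    show "emeasure (restrict_space lborel W \<Otimes>\<^sub>M K) (cell2 W n z) < \<infinity>" if "z \<in> cells2 W n" for z
      unfolding cell2_measure(1)[OF that] by simp
    show "disjoint_family_on (cell2 W n) (cells2 W n)" by (rule disjoint_cell2)
    show "((\<lambda>\<rho>. measure \<mu> (eta_cell' W n \<rho> z)) \<longlongrightarrow> measure (restrict_space lborel W \<Otimes>\<^sub>M K) (cell2 W n z)) at_top"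
      if z: "z \<in> cells2 W n" for z
    proof -
      have "measure (restrict_space lborel W \<Otimes>\<^sub>M K) (cell2 W n z) =
          measure lborel (W \<inter> {x. quant (mesh n) x = fst z}) * ((mesh n * (snd z + 1)) powr \<alpha> - (mesh n * snd z) powr \<alpha>)"
      proof -
        have "measure (restrict_space lborel W \<Otimes>\<^sub>M K) (cell2 W n z) = enn2real (emeasure (restrict_space lborel W \<Otimes>\<^sub>M K) (cell2 W n z))"
          by (rule measure_def)
        then show ?thesis by (simp only: cell2_measure(1)[OF z] enn2real_ennreal[OF cell2_measure(2)[OF z]])
      qed
      then show ?thesis using measure_eta_cell_tendsto[OF W index[OF z]] by simp
    qed
    show "\<bar>upper W F n k\<bar> \<le> B" for k by (rule uB)
  qed
  then have "((\<lambda>\<rho>. \<integral>\<omega>. upper W F n (?N \<rho> \<omega>) \<partial>P) \<longlongrightarrow> U n) at_top"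
    by (simp only: U_def cell_counts_def)
  then have step1: "\<forall>\<^sub>F \<rho> in at_top. (\<integral>\<omega>. upper W F n (?N \<rho> \<omega>) \<partial>P) < (\<integral>\<omega>. F (\<Psi> \<omega>) \<partial>P') + e / 3"
    by (rule order_tendstoD(2)) (rule n)
  obtain w0 where w0: "\<And>x. x \<in> W \<Longrightarrow> norm x \<le> w0"
    using compact_imp_bounded[OF W] by (auto simp: bounded_iff)
  have w: "1 \<le> max 1 w0" "W \<subseteq> cball 0 (max 1 w0)" using w0 by force+
  have m2: "0 < (mesh n)\<^sup>2" "(mesh n)\<^sup>2 \<le> 1"
  proof -
    show "0 < (mesh n)\<^sup>2" by (intro zero_less_power mesh_pos)
    have "mesh n \<le> 1" by (simp add: mesh_def)
    then show "(mesh n)\<^sup>2 \<le> 1" using mesh_pos[of n] by (simp add: power_le_one less_imp_le)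
  qed
  have \<delta>: "0 < (mesh n)\<^sup>2 / 2" "(mesh n)\<^sup>2 / 2 \<le> 1 / 2" using m2 by linarith+
  \<comment> \<open>The bad event costs at most 2 B times its probability, hence at most
    \<open>e / 3\<close>; the summand 1 covers \<open>B = 0\<close>.\<close>
  have e': "0 < e / (6 * (B + 1))" using e B by simp
  obtain Bad where Bad: "\<forall>\<^sub>F \<rho> in at_top. Bad \<rho> \<in> sets P \<and> prob (Bad \<rho>) \<le> e / (6 * (B + 1)) \<and>
     (\<forall>\<omega>\<in>space P - Bad \<rho>. good_config (\<eta> \<omega>) \<longrightarrow>
       (\<forall>x m. (x, m) \<in> points (\<eta> \<omega>) \<and> x \<in> (\<lambda>x. \<rho> *\<^sub>R x) ` W \<and> mesh n * q \<rho> \<le> m \<longrightarrow>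
         ennreal ((1 - (mesh n)\<^sup>2 / 2) * m) \<le> inradius (x, m) (points (\<eta> \<omega>)) \<and>
         inradius (x, m) (points (\<eta> \<omega>)) \<le> ennreal ((1 + (mesh n)\<^sup>2 / 2) * m)))"
    using inradius_close_event[OF w mesh_pos \<delta> e'] by blast
  show ?thesis
    using Bad step1 q_pos[of 0] eventually_gt_at_top[of 0]
  proof eventually_elim
    case (elim \<rho>)
    interpret R: rescaled \<gamma> \<alpha> Q W \<rho> "q \<rho>"
      by unfold_locales (use W elim in \<open>auto simp: q_def dim\<close>)
    have Bs: "Bad \<rho> \<in> sets P" and Bp: "prob (Bad \<rho>) \<le> e / (6 * (B + 1))" using elim(1) by auto
    have Nm: "?N \<rho> \<in> P \<rightarrow>\<^sub>M count_space (cells2 W n \<rightarrow>\<^sub>E insert \<infinity> (range of_nat))"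
      by (rule count_vector_measurable[OF fin Nsets])
    have um: "(\<lambda>\<omega>. upper W F n (?N \<rho> \<omega>)) \<in> borel_measurable P"
      by (rule measurable_compose[OF Nm]) simp
    have ui: "integrable P (\<lambda>\<omega>. upper W F n (?N \<rho> \<omega>))"
      by (rule integrable_const_bound[of _ B]) (simp_all add: um uB)
    have Fi: "integrable P (\<lambda>\<omega>. F (Xi \<gamma> \<alpha> Q W \<rho> (\<kappa> \<omega>)))"
    proof (rule integrable_const_bound[of _ B])
      show "(\<lambda>\<omega>. F (Xi \<gamma> \<alpha> Q W \<rho> (\<kappa> \<omega>))) \<in> borel_measurable P"
        by (rule measurable_compose[OF R.Xi_measurable[OF \<kappa>] Fm])
      show "AE \<omega> in P. norm (F (Xi \<gamma> \<alpha> Q W \<rho> (\<kappa> \<omega>))) \<le> B"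
        using bound[OF R.Xi_counting_measure[OF good_kernel.good[OF \<kappa>]]] by (intro AE_I2) simp
    qed
    have bi: "integrable P (indicator (Bad \<rho>) :: _ \<Rightarrow> real)"
      using Bs by (simp add: integrable_indicator_iff emeasure_eq_measure)
    \<comment> \<open>On the bad event only the trivial estimate is available: both quantities lie
      between -B and B, so they differ by at most 2 B.\<close>
    have "AE \<omega> in P. F (Xi \<gamma> \<alpha> Q W \<rho> (\<kappa> \<omega>)) \<le> upper W F n (?N \<rho> \<omega>) + 2 * B * indicator (Bad \<rho>) \<omega>"
      using eq AE_space
    proof eventually_elim
      case (elim \<omega>)
      have g: "good_config (\<kappa> \<omega>)" by (rule good_kernel.good[OF \<kappa> elim(2)])
      show ?case
      proof (cases "\<omega> \<in> Bad \<rho>")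
        case True
        have "\<bar>F (Xi \<gamma> \<alpha> Q W \<rho> (\<kappa> \<omega>))\<bar> \<le> B" by (rule bound[OF R.Xi_counting_measure[OF g]])
        moreover have "\<bar>upper W F n (?N \<rho> \<omega>)\<bar> \<le> B" by (rule uB)
        ultimately show ?thesis using True by simp
      next
        case False
        have "compat W n (Xi \<gamma> \<alpha> Q W \<rho> (\<eta> \<omega>)) (\<lambda>z\<in>cells2 W n. emeasure (\<eta> \<omega>) (eta_cell W n \<rho> (q \<rho>) z))"
        proof (rule R.compat_Xi)
          show g': "good_config (\<eta> \<omega>)" using g elim(1) by simp
          fix x m assume "(x, m) \<in> points (\<eta> \<omega>)" "x \<in> (\<lambda>x. \<rho> *\<^sub>R x) ` W" "mesh n * q \<rho> \<le> m"
          then show "ennreal ((1 - (mesh n)\<^sup>2 / 2) * m) \<le> inradius (x, m) (points (\<eta> \<omega>)) \<and>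
             inradius (x, m) (points (\<eta> \<omega>)) \<le> ennreal ((1 + (mesh n)\<^sup>2 / 2) * m)"
            using \<open>Bad \<rho> \<in> sets P \<and> _\<close> False elim(2) g' by blast
        qed
        moreover have "(\<lambda>z\<in>cells2 W n. emeasure (\<eta> \<omega>) (eta_cell W n \<rho> (q \<rho>) z)) = ?N \<rho> \<omega>"
          using \<open>0 < \<rho>\<close> \<open>0 < q \<rho>\<close> by (simp add: eta_cell'_def)
        ultimately have "F (Xi \<gamma> \<alpha> Q W \<rho> (\<kappa> \<omega>)) \<le> upper W F n (?N \<rho> \<omega>)"
          using le_u elim(1) by simp
        then show ?thesis using False by simp
      qed
    qed
    then have "(\<integral>\<omega>. F (Xi \<gamma> \<alpha> Q W \<rho> (\<kappa> \<omega>)) \<partial>P) \<le>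
       (\<integral>\<omega>. upper W F n (?N \<rho> \<omega>) + 2 * B * indicator (Bad \<rho>) \<omega> \<partial>P)"
      using Fi ui bi by (intro integral_mono_AE) auto
    also have "\<dots> = (\<integral>\<omega>. upper W F n (?N \<rho> \<omega>) \<partial>P) + 2 * B * prob (Bad \<rho>)"
      using ui bi Bs by simp
    also have "2 * B * prob (Bad \<rho>) \<le> 2 * B * (e / (6 * (B + 1)))"
      using B Bp by (intro mult_left_mono) auto
    also have "\<dots> \<le> e / 3" using B e by (simp add: field_simps)
    finally show ?case using elim(2) e by linarith
  qed
qed

end

lemma law_integral:
  assumes "is_version M T X Y" "continuous_map T euclideanreal f"
  shows "(\<integral>\<nu>. f \<nu> \<partial>law M T X) = (\<integral>\<omega>. f (Y \<omega>) \<partial>M)"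
  unfolding law_eq[OF assms(1)]
  using assms(1) continuous_map_borel_measurable[OF assms(2)] by (intro integral_distr) (auto simp: is_version_def)

theorem theorem1p4:
  fixes \<gamma> \<alpha> :: real
    and W :: "'a::euclidean_space set"
    and Q :: "real measure"
    and P :: "'w measure" and \<eta> :: "'w \<Rightarrow> ('a \<times> real) measure"
    and K :: "(ennreal \<times> ennreal) measure"
    and P' :: "'v measure" and \<Psi> :: "'v \<Rightarrow> ('a \<times> ennreal \<times> ennreal) measure"
  assumes "\<gamma> > 0"
    and "compact W" "convex W" "emeasure lborel W = 1"
    and "prob_space Q" "sets Q = sets (restrict_space borel {0..})"
    and "poisson_process P marked_space (scale_measure (ennreal \<gamma>) (lborel \<Otimes>\<^sub>M Q)) \<eta>"
    and "DIM('a) \<ge> 2"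
    and "\<alpha> > real DIM('a)" "regularly_varying_tail Q \<alpha>"
    and "AE m in Q. m > 0"
    and "is_diag_power_measure \<alpha> K"
    and "poisson_process P' (limit_space W) (restrict_space lborel W \<Otimes>\<^sub>M K) \<Psi>"
  shows "converges_in_distribution (vague_topology (limit_space W))
           P (\<lambda>\<rho> \<omega>. Xi \<gamma> \<alpha> Q W \<rho> (\<eta> \<omega>)) at_top P' \<Psi>"
proof -
  let ?T = "vague_topology (limit_space W)"
  have a0: "0 < \<alpha>" using assms(9) DIM_positive[where 'a = 'a] by linarith
  interpret marked_poisson Q \<alpha> \<gamma> "DIM('a)" P \<eta>
    unfolding marked_poisson_def marked_poisson_axioms_def regular_tail_def regular_tail_axioms_def poisson_def
    using assms a0 by auto
  have K: "diag_power \<alpha> K" unfolding diag_power_def using assms a0 by simp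
  interpret P': prob_space P' using assms(13) by (simp add: poisson_process_def)
  obtain \<kappa> where \<kappa>: "good_kernel P \<kappa>" "AE \<omega> in P. \<kappa> \<omega> = \<eta> \<omega>" by (rule good_version)
  \<comment> \<open>Only for large \<rho>: for small \<rho> the scale \<open>q \<rho>\<close> may
    vanish and the rescaling degenerates.\<close>
  have version: "\<forall>\<^sub>F \<rho> in at_top. is_version P ?T (\<lambda>\<omega>. Xi \<gamma> \<alpha> Q W \<rho> (\<eta> \<omega>)) (\<lambda>\<omega>. Xi \<gamma> \<alpha> Q W \<rho> (\<kappa> \<omega>))"
    using q_pos[of 0] eventually_gt_at_top[of 0]
  proof eventually_elim
    case (elim \<rho>)
    interpret R: rescaled \<gamma> \<alpha> Q W \<rho> "q \<rho>"
      by unfold_locales (use assms(2) elim in \<open>auto simp: q_def\<close>)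
    show ?case by (rule R.Xi_version[OF \<kappa>])
  qed
  have \<Psi>v: "is_version P' ?T \<Psi> \<Psi>"
    using assms(13) by (simp add: is_version_def poisson_process_def)
  show ?thesis
    unfolding converges_in_distribution_def
  proof (intro conjI allI impI)
    show "\<forall>\<^sub>F \<rho> in at_top. random_element P ?T (\<lambda>\<omega>. Xi \<gamma> \<alpha> Q W \<rho> (\<eta> \<omega>))"
      using version by eventually_elim (auto simp: random_element_def)
    show "random_element P' ?T \<Psi>" using \<Psi>v by (auto simp: random_element_def)
    fix f assume f: "continuous_map ?T euclideanreal f \<and> bounded (f ` topspace ?T)"
    then obtain B where B: "\<And>\<mu>. \<mu> \<in> locally_finite_counting_measures (limit_space W) \<Longrightarrow> \<bar>f \<mu>\<bar> \<le> B"
      by (auto simp: bounded_iff topspace_vague_topology)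
    have B': "\<bar>f \<mu>\<bar> \<le> max B 0" "\<bar>- f \<mu>\<bar> \<le> max B 0"
      if "\<mu> \<in> locally_finite_counting_measures (limit_space W)" for \<mu>
      using B[OF that] by auto
    have cont: "continuous_map ?T euclideanreal f" "continuous_map ?T euclideanreal (\<lambda>\<mu>. - f \<mu>)"
      using f by (auto intro: continuous_map_minus)
    have "((\<lambda>\<rho>. \<integral>\<omega>. f (Xi \<gamma> \<alpha> Q W \<rho> (\<kappa> \<omega>)) \<partial>P) \<longlongrightarrow> (\<integral>\<omega>. f (\<Psi> \<omega>) \<partial>P')) at_top"
    proof (rule tendstoI)
      fix e :: real assume e: "0 < e"
      have up: "\<forall>\<^sub>F \<rho> in at_top. (\<integral>\<omega>. f (Xi \<gamma> \<alpha> Q W \<rho> (\<kappa> \<omega>)) \<partial>P) < (\<integral>\<omega>. f (\<Psi> \<omega>) \<partial>P') + e"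
        by (rule expectation_upper_bound[OF assms(2) K assms(13) \<kappa> cont(1) B'(1) _ e]) auto
      have low: "\<forall>\<^sub>F \<rho> in at_top. (\<integral>\<omega>. - f (Xi \<gamma> \<alpha> Q W \<rho> (\<kappa> \<omega>)) \<partial>P) < (\<integral>\<omega>. - f (\<Psi> \<omega>) \<partial>P') + e"
        by (rule expectation_upper_bound[OF assms(2) K assms(13) \<kappa> cont(2) B'(2) _ e]) auto
      from up low show "\<forall>\<^sub>F \<rho> in at_top. dist (\<integral>\<omega>. f (Xi \<gamma> \<alpha> Q W \<rho> (\<kappa> \<omega>)) \<partial>P) (\<integral>\<omega>. f (\<Psi> \<omega>) \<partial>P') < e"
        by eventually_elim (simp add: dist_real_def abs_less_iff)
    qed
    moreover have "(\<integral>\<nu>. f \<nu> \<partial>law P' ?T \<Psi>) = (\<integral>\<omega>. f (\<Psi> \<omega>) \<partial>P')"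
      by (rule law_integral[OF \<Psi>v cont(1)])
    moreover have "\<forall>\<^sub>F \<rho> in at_top. (\<integral>\<omega>. f (Xi \<gamma> \<alpha> Q W \<rho> (\<kappa> \<omega>)) \<partial>P) = (\<integral>\<nu>. f \<nu> \<partial>law P ?T (\<lambda>\<omega>. Xi \<gamma> \<alpha> Q W \<rho> (\<eta> \<omega>)))"
      using version by eventually_elim (rule law_integral[OF _ cont(1), symmetric])
    ultimately show "((\<lambda>\<rho>. \<integral>\<nu>. f \<nu> \<partial>law P ?T (\<lambda>\<omega>. Xi \<gamma> \<alpha> Q W \<rho> (\<eta> \<omega>))) \<longlongrightarrow> (\<integral>\<nu>. f \<nu> \<partial>law P' ?T \<Psi>)) at_top"
      by (simp add: tendsto_cong)
  qed
qed

end
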